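(* Let $0<|q|<1$. With the notation of the context (with $\ell=5$), the following identities hold: $$R_{12}(0) =-1 -q^2 \frac{(-q^{5}; q^{10})_{\infty}}{(q^{10}; q^{10})_{\infty}}\sum_{n \in \mathbb{Z}}\frac{(-1)^nq^{10n^2+15n}}{1-q^{10n+2}} + \frac{(q, q^{9}; q^{10})_{\infty}^2 (q^{6}, q^{8}, q^{12}, q^{14}; q^{20})_{\infty}(q^{10}; q^{20})_{\infty}^3 (q^{20}; q^{20})_{\infty}^2}{(q; q)_{\infty}},$$ $$R_{12}(1)=0,\qquad R_{12}(2)=\frac{q(q^2, q^{18}; q^{20})_{\infty} (q^5; q^5)_{\infty} (-q^{10}; q^{10})_{\infty}}{(q, q^4; q^5)_{\infty}},\qquad R_{12}(3)=\frac{(-q^5, q^{10}; q^{10})_{\infty}}{(q^4, q^6; q^{10})_{\infty}},$$ $$R_{12}(4)=2q^3 \frac{(-q^{5}; q^{10})_{\infty}}{(q^{10};q^{10})_{\infty}} \sum_{n \in \mathbb{Z}}\frac{(-1)^nq^{10n^2+15n}}{1-q^{10n+4}} + \frac{(q^{3}, q^{7},q^{10}; q^{10})_{\infty}^2} {(q; q^{2})_{\infty} (q^{6}, q^{8},q^{12}, q^{14}, q^{20}; q^{20})_{\infty}},$$ $$R_{02}(0)=1 + 2q^2 \frac{(-q^{5}; q^{10})_{\infty}}{(q^{10};q^{10})_{\infty}} \sum_{n \in\mathbb{Z}}\frac{(-1)^nq^{10n^2+15n}}{1-q^{10n+2}} - \frac{(q,q^{9}; q^{10})_{\infty}^2 (q^{10};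 q^{10})_{\infty}^3 (q^{6},q^{8}, q^{12}, q^{14}; q^{20})_{\infty}} {(q; q)_{\infty} (q^{20};q^{20})_{\infty}},$$ $$R_{02}(1)=\frac{(-q^5, q^{10}; q^{10})_{\infty}}{(q^2, q^8; q^{10})_{\infty}},\qquad R_{02}(2)=\frac{(q^5; q^5)_{\infty} (-q^{10}; q^{10})_{\infty} (q^6, q^{14}; q^{20})_{\infty}}{(q^2, q^3; q^5)_{\infty}},\qquad R_{02}(3)=0,$$ $$R_{02}(4)=q^3 \frac{(-q^{5}; q^{10})_{\infty}}{(q^{10};q^{10})_{\infty}} \sum_{n \in\mathbb{Z}}\frac{(-1)^nq^{10n^2+15n}}{1-q^{10n+4}} + \frac{(q^{3},q^{7}, q^{10}; q^{10})_{\infty}^2}{(q; q^{2})_{\infty} (q^{6},q^{8}, q^{12}, q^{14}, q^{20}; q^{20})_{\infty}}.$$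
   Context: Notation: $(a_1,\dots,a_j;q)_\infty=\prod_{k\ge0}(1-a_1q^k)\cdots(1-a_jq^k)$. A partition without repeated odd parts is a partition of $n$ in which each odd part occurs at most once. For such a partition $\lambda$, its $M_2$-rank is $\lceil l(\lambda)/2\rceil-\nu(\lambda)$, where $l(\lambda)$ is the largest part and $\nu(\lambda)$ the number of parts. For $n\ge1$ let $N_2(m,n)$ be the number of partitions of $n$ without repeated odd parts with $M_2$-rank $m$, and set $N_2(m,0)=0$ for all $m$ (the empty partition is not counted). For a positive integer $\ell$ and an integer $s$, let $N_2(s,\ell,n)=\sum_{m\equiv s \pmod \ell}N_2(m,n)$. Define $R_{st}(d)=\sum_{n\ge0}\big(N_2(s,\ell,\ell n+d)-N_2(t,\ell,\ell n+d)\big)q^n$. Sums over $n\in\mathbb{Z}$ with terms $1/(1-q^{k})$ for negative $k$ are understood as analytic functions in $0<|q|<1$. *)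

theory Defs
  imports
    "HOL-Analysis.Analysis"
    "HOL-Library.Multiset"
    "HOL-Number_Theory.Cong"
begin

definition partitions_no_rep_odd :: "nat \<Rightarrow> nat multiset set" where
  "partitions_no_rep_odd n =
     {p. 0 \<notin># p \<and> sum_mset p = n \<and> (\<forall>i. odd i \<longrightarrow> count p i \<le> 1)}"

(* Only meaningful for nonempty partitions, since Max {} is unspecified; N2 never uses it
   on the empty one. *)
definition M2_rank :: "nat multiset \<Rightarrow> int" where
  "M2_rank p = \<lceil>real (Max (set_mset p)) / 2\<rceil> - int (size p)"

(* The empty partition is not counted. *)
definition N2 :: "int \<Rightarrow> nat \<Rightarrow> nat" where
  "N2 m n = (if n = 0 then 0 else card {p \<in> partitions_no_rep_odd n. M2_rank p = m})"

(* For fixed n only finitely many m contribute, so the sum is an ordinary finite one. *)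
definition N2_mod :: "int \<Rightarrow> nat \<Rightarrow> nat \<Rightarrow> nat" where
  "N2_mod s l n = (\<Sum>\<^sub>\<infinity>m\<in>{m. [m = s] (mod int l)}. N2 m n)"

definition R :: "nat \<Rightarrow> int \<Rightarrow> int \<Rightarrow> nat \<Rightarrow> complex \<Rightarrow> complex" where
  "R l s t d q =
     (\<Sum>n. (of_nat (N2_mod s l (l * n + d)) - of_nat (N2_mod t l (l * n + d))) * q ^ n)"

(* qpoch [a1, ..., aj] q is the multi-parameter symbol (a1, ..., aj; q) with index infinity. *)
definition qpoch :: "complex list \<Rightarrow> complex \<Rightarrow> complex" where
  "qpoch as q = (\<Prod>a\<leftarrow>as. \<Prod>k. 1 - a * q ^ k)"

end

theory Submission
  imports Defs "HOL-Complex_Analysis.Complex_Analysis"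
begin

text \<open>
  Put x = -q. Decomposing a partition by its largest part turns the rank generating function G(z)
  into a q-series which satisfies a first order difference equation in z. So does a Lambert sum, and a
  holomorphic function on a punctured disc with f(pz) = const z f(z) vanishes; this gives
  1 + G(z) = (1 - z) S(z) / \<psi>, where \<psi> is the theta series of x and S a Lambert
  series. For z a primitive fifth root of unity, (1 - z) S(z) and \<psi> split according to the
  exponent of x modulo 5 into Lambert and theta series in q^5. The claimed components, multiplied
  by \<psi>, are compared with this residue by residue. A three-term relation between Lambert
  series and the four-term relations for theta functions and their logarithmic derivatives reduce
  each residue to an identity of theta products. Finally, the components of 1 + G are of the form
  \<alpha> + \<beta> (z + 1/z) for every z, which determines the differences of the rank counts.
\<close>

section \<open>Infinite products\<close>

text \<open>The sign x = -q turns the factor 1 + q^(2k+1)/z of an odd part into 1 - (x/z) p^k with p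
  = q^2, so odd and even parts give products to one base p, of which x is a square root. The
  obstacle is that Lambert sums have poles at powers of p, while the uniqueness argument wants
  holomorphic functions. Hence \<open>S w a\<close> is multiplied by the theta function
  \<open>th a\<close>, and the product is defined termwise, so that it makes sense at the poles,
  where its value is elementary. A function with multiplier const z^(-k) can be divided by a theta
  function at each known zero, which raises the exponent by one; more than k inequivalent zeros
  force it to vanish. The theta and Lambert relations are proved in this way, and putting a = 1 or z
  = 1 in such identities evaluates theta series as products. The exponent 2 n^2 + n is only 0, 1 or
  3 modulo 5, so \<psi> has three components \<open>A\<close>, \<open>B\<close>, \<open>C\<close>,
  and each residue is an identity with three terms on the product side. The 1 in 1 + G is the empty
  partition. The symmetry of the rank counts under s -> -s comes out of the components being
  functions of z + 1/z.\<close>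

definition qp :: "complex \<Rightarrow> complex \<Rightarrow> complex" where
  "qp a p = (\<Prod>k. 1 - a * p ^ k)"

lemma qpoch_Nil [simp]: "qpoch [] q = 1"
  and qpoch_Cons [simp]: "qpoch (a # as) q = qp a q * qpoch as q"
  by (simp_all add: qpoch_def qp_def)

lemma qp_has_prod:
  assumes "norm p < 1"
  shows "(\<lambda>k. 1 - a * p ^ k) has_prod qp a p"
proof -
  have "summable (\<lambda>k. norm a * norm p ^ k)"
    using assms by (intro summable_mult summable_geometric) auto
  hence "abs_convergent_prod (\<lambda>k. 1 - a * p ^ k)"
    by (simp add: abs_convergent_prod_conv_summable norm_mult norm_power)
  thus ?thesis
    unfolding qp_def by (intro convergent_prod_has_prod abs_convergent_prod_imp_convergent_prod)
qed

lemma qp_tendsto: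
  assumes "norm p < 1"
  shows "(\<lambda>n. \<Prod>k<n. 1 - a * p ^ k) \<longlonglongrightarrow> qp a p"
  using has_prod_imp_tendsto'[OF qp_has_prod[OF assms]] .

lemma qp_eq_0_iff:
  assumes "norm p < 1"
  shows "qp a p = 0 \<longleftrightarrow> (\<exists>k. a * p ^ k = 1)"
  using has_prod_eq_0_iff[OF qp_has_prod[OF assms]] by (metis (no_types, lifting) eq_iff_diff_eq_0 rangeE rangeI)

lemma qp_head:
  assumes "norm p < 1"
  shows "qp a p = (1 - a) * qp (a * p) p"
proof (rule LIMSEQ_unique)
  show "(\<lambda>n. \<Prod>k<Suc n. 1 - a * p ^ k) \<longlonglongrightarrow> qp a p"
    using qp_tendsto[OF assms] by (rule LIMSEQ_Suc)
  have "(\<lambda>n. (1 - a) * (\<Prod>k<n. 1 - a * p * p ^ k)) \<longlonglongrightarrow> (1 - a) * qp (a * p) p"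
    using qp_tendsto[OF assms] by (intro tendsto_intros)
  thus "(\<lambda>n. \<Prod>k<Suc n. 1 - a * p ^ k) \<longlonglongrightarrow> (1 - a) * qp (a * p) p"
    by (simp add: prod.lessThan_Suc_shift mult.assoc del: prod.lessThan_Suc)
qed

lemma qp_split_head:
  assumes "norm p < 1"
  shows "qp a p = (\<Prod>k<n. 1 - a * p ^ k) * qp (a * p ^ n) p"
proof (induction n)
  case (Suc n)
  thus ?case using qp_head[OF assms, of "a * p ^ n"] by (simp add: mult_ac)
qed auto

lemma qp_1 [simp]: "norm p < 1 \<Longrightarrow> qp 1 p = 0"
  by (simp add: qp_eq_0_iff exI[of _ 0])

lemma qp_nonzero:
  assumes "norm p < 1" "norm a < 1"
  shows "qp a p \<noteq> 0"
proof
  assume "qp a p = 0"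
  then obtain k where k: "a * p ^ k = 1"
    using qp_eq_0_iff[OF assms(1)] by blast
  have "norm (a * p ^ k) = norm a * norm p ^ k" by (simp add: norm_mult norm_power)
  also have "\<dots> \<le> norm a * 1"
    using assms by (intro mult_left_mono power_le_one) auto
  finally show False using k assms by simp
qed

text \<open>Factors are grouped by exponent modulo m; along the partial products of length n m this
  is a finite rearrangement.\<close>

lemma qp_split:
  assumes "norm p < 1" "m > 0"
  shows "qp a p = (\<Prod>i<m. qp (a * p ^ i) (p ^ m))"
proof (rule LIMSEQ_unique)
  have pm: "norm (p ^ m) < 1"
    using assms by (auto simp: norm_power power_less_one_iff)
  have "strict_mono (\<lambda>n::nat. n * m)"
    using assms by (auto simp: strict_mono_def)
  thus "(\<lambda>n. \<Prod>k<n*m. 1 - a * p ^ k) \<longlonglongrightarrow> qp a p"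
    using LIMSEQ_subseq_LIMSEQ[OF qp_tendsto[OF assms(1)], of "\<lambda>n. n * m" a] by (simp add: o_def)
  have "(\<Prod>k<n*m. 1 - a * p ^ k) = (\<Prod>i<m. \<Prod>k<n. 1 - a * p ^ i * (p ^ m) ^ k)" for n
  proof -
    have "(\<Prod>k<n*m. 1 - a * p ^ k) = (\<Prod>k<n. \<Prod>i<m. 1 - a * p ^ (k * m + i))"
    proof -
      have "(\<Prod>i<m. 1 - a * p ^ (k * m + i)) = (\<Prod>j=k*m..<k*m+m. 1 - a * p ^ j)" for k
        by (rule prod.reindex_bij_witness[of _ "\<lambda>i. i - k * m" "\<lambda>i. k * m + i"]) auto
      thus ?thesis by (simp add: prod.nat_group)
    qed
    also have "\<dots> = (\<Prod>i<m. \<Prod>k<n. 1 - a * p ^ (k * m + i))"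
      by (rule prod.swap)
    finally show ?thesis
      by (simp add: power_add mult_ac flip: power_mult)
  qed
  thus "(\<lambda>n. \<Prod>k<n*m. 1 - a * p ^ k) \<longlonglongrightarrow> (\<Prod>i<m. qp (a * p ^ i) (p ^ m))"
    by (simp only:) (intro tendsto_prod qp_tendsto pm)
qed

lemma qp_square:
  assumes "norm p < 1"
  shows "qp a p * qp (- a) p = qp (a\<^sup>2) (p\<^sup>2)"
proof (rule LIMSEQ_unique)
  have "norm (p\<^sup>2) < 1"
    using assms by (auto simp: norm_power power_less_one_iff)
  thus "(\<lambda>n. \<Prod>k<n. 1 - a\<^sup>2 * (p\<^sup>2) ^ k) \<longlonglongrightarrow> qp (a\<^sup>2) (p\<^sup>2)"
    by (rule qp_tendsto)
  have "(\<lambda>n. (\<Prod>k<n. 1 - a * p ^ k) * (\<Prod>k<n. 1 - (-a) * p ^ k)) \<longlonglongrightarrow> qp a p * qp (- a) p"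
    by (intro tendsto_mult qp_tendsto assms)
  moreover have "(1 - a * p ^ k) * (1 - (-a) * p ^ k) = 1 - a\<^sup>2 * (p\<^sup>2) ^ k" for k
    by (simp add: algebra_simps power2_eq_square power_mult_distrib)
  ultimately show "(\<lambda>n. \<Prod>k<n. 1 - a\<^sup>2 * (p\<^sup>2) ^ k) \<longlonglongrightarrow> qp a p * qp (- a) p"
    by (simp flip: prod.distrib)
qed

lemma holomorphic_qp:
  assumes "norm p < 1"
  shows "(\<lambda>a. qp a p) holomorphic_on A"
proof -
  have "(\<lambda>a. qp a p) holomorphic_on UNIV"
  proof (rule holomorphic_uniform_sequence)
    fix a :: complex
    have "uniformly_convergent_on (cball a 1) (\<lambda>n b. \<Prod>k<n. 1 - b * p ^ k)"
    proof (rule uniformly_convergent_on_prod')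
      show "uniformly_convergent_on (cball a 1) (\<lambda>N x. \<Sum>n<N. norm (1 - x * p ^ n - 1))"
      proof (rule Weierstrass_m_test'_ev)
        show "summable (\<lambda>n. (norm a + 1) * norm p ^ n)"
          using assms by (intro summable_mult summable_geometric) auto
        show "\<forall>\<^sub>F n in sequentially. \<forall>x\<in>cball a 1. norm (norm (1 - x * p ^ n - 1)) \<le> (norm a + 1) * norm p ^ n"
        proof (intro always_eventually allI ballI)
          fix n x assume "x \<in> cball a 1"
          hence "norm x \<le> norm a + 1"
            using norm_triangle_ineq2[of x a] by (simp add: dist_norm norm_minus_commute)
          thus "norm (norm (1 - x * p ^ n - 1)) \<le> (norm a + 1) * norm p ^ n"
            by (simp add: norm_mult norm_power mult_right_mono)
        qed
      qed
    qed (auto intro!: continuous_intros)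
    then obtain l where l: "uniform_limit (cball a 1) (\<lambda>n b. \<Prod>k<n. 1 - b * p ^ k) l sequentially"
      by (auto simp: uniformly_convergent_on_def)
    have "l b = qp b p" if "b \<in> cball a 1" for b
      using LIMSEQ_unique[OF tendsto_uniform_limitI[OF l that] qp_tendsto[OF assms]] .
    hence "uniform_limit (cball a 1) (\<lambda>n b. \<Prod>k<n. 1 - b * p ^ k) (\<lambda>b. qp b p) sequentially"
      using l uniform_limit_cong'[of "cball a 1" "\<lambda>n b. \<Prod>k<n. 1 - b * p ^ k" _ l "\<lambda>b. qp b p"] by simp
    thus "\<exists>d>0. cball a d \<subseteq> UNIV \<and> uniform_limit (cball a d) (\<lambda>n b. \<Prod>k<n. 1 - b * p ^ k) (\<lambda>b. qp b p) sequentially"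
      by (intro exI[of _ 1]) auto
  qed (auto intro!: holomorphic_intros)
  thus ?thesis by (rule holomorphic_on_subset) auto
qed

lemma holomorphic_qp' [holomorphic_intros]:
  assumes "f holomorphic_on A" "norm p < 1"
  shows "(\<lambda>z. qp (f z) p) holomorphic_on A"
  using holomorphic_on_compose[OF assms(1) holomorphic_qp[OF assms(2)]] by (simp add: o_def)

section \<open>Theta functions and Lambert sums\<close>

text \<open>The term is (c^n b)^n, and c^n b is eventually below 1/2: the quadratic exponent beats
  every geometric growth.\<close>

lemma summable_nat_quadratic_exponent:
  fixes c b :: real
  assumes "0 < c" "c < 1" "0 < b"
  shows "summable (\<lambda>n::nat. c ^ (n\<^sup>2) * b ^ n)"
proof -
  have "(\<lambda>n. c ^ n * b) \<longlonglongrightarrow> 0"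
    using assms by (intro tendsto_mult_left_zero LIMSEQ_power_zero) auto
  hence ev: "eventually (\<lambda>n. c ^ n * b < 1/2) sequentially"
    by (rule order_tendstoD) auto
  show ?thesis
  proof (rule summable_comparison_test_ev)
    show "summable (\<lambda>n. (1/2::real) ^ n)" by (rule summable_geometric) auto
    show "\<forall>\<^sub>F n in sequentially. norm (c ^ (n\<^sup>2) * b ^ n) \<le> (1/2) ^ n"
      using ev
    proof eventually_elim
      case (elim n)
      have "c ^ (n\<^sup>2) * b ^ n = (c ^ n * b) ^ n"
        by (simp add: power_mult_distrib power2_eq_square flip: power_mult)
      also have "\<dots> \<le> (1/2) ^ n"
        using elim assms by (intro power_mono) auto
      finally show ?case using assms by simp
    qed
  qed
qed

lemma summable_on_int_iff_nat:
  fixes f :: "int \<Rightarrow> real"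
  assumes "(\<lambda>n. f (int n)) summable_on UNIV" "(\<lambda>n. f (- int n)) summable_on UNIV"
  shows "f summable_on UNIV"
proof -
  have "f summable_on range int"
    using assms(1) by (subst summable_on_reindex) (auto simp: o_def)
  moreover have "f summable_on range (\<lambda>n. - int n)"
    using assms(2) by (subst summable_on_reindex) (auto simp: o_def inj_on_def)
  ultimately have "f summable_on (range int \<union> range (\<lambda>n. - int n))"
    by (rule summable_on_union)
  moreover have "range int \<union> range (\<lambda>n. - int n) = UNIV"
    by (auto simp: image_iff) (metis int_cases2)
  ultimately show ?thesis by simp
qed

lemma summable_on_quadratic_exponent:
  fixes c b :: real
  assumes "0 < c" "c < 1" "0 < b"
  shows "(\<lambda>n::int. c powi (n\<^sup>2) * b powi n) summable_on UNIV"
proof (rule summable_on_int_iff_nat)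
  have *: "c powi (int n ^ 2) = c ^ (n\<^sup>2)" for n
    by (metis of_nat_power power_int_of_nat)
  show "(\<lambda>n. c powi (int n ^ 2) * b powi (int n)) summable_on UNIV"
    using summable_nat_quadratic_exponent[OF assms] assms
    by (intro summable_nonneg_imp_summable_on) (auto simp: *)
  show "(\<lambda>n. c powi ((- int n) ^ 2) * b powi (- int n)) summable_on UNIV"
    using summable_nat_quadratic_exponent[OF assms(1,2), of "inverse b"] assms
    by (intro summable_nonneg_imp_summable_on) (auto simp: * power_int_minus power_inverse)
qed

text \<open>Only a local majorant is required; the bounds available later depend on the distance of
  the point from 0.\<close>

lemma holomorphic_on_infsum:
  fixes f :: "'i \<Rightarrow> complex \<Rightarrow> complex"
  assumes "open A" "\<And>n. n \<in> I \<Longrightarrow> f n holomorphic_on A"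
    and "\<And>z. z \<in> A \<Longrightarrow> \<exists>d>0. \<exists>M. cball z d \<subseteq> A \<and> M summable_on I \<and> (\<forall>n\<in>I. \<forall>w\<in>cball z d. norm (f n w) \<le> M n)"
  shows "(\<lambda>z. \<Sum>\<^sub>\<infinity>n\<in>I. f n z) holomorphic_on A"
proof -
  have "(\<lambda>z. \<Sum>\<^sub>\<infinity>n\<in>I. f n z) field_differentiable at z" if z: "z \<in> A" for z
  proof -
    obtain d M where d: "d > 0" "cball z d \<subseteq> A" "M summable_on I" "\<And>n w. n \<in> I \<Longrightarrow> w \<in> cball z d \<Longrightarrow> norm (f n w) \<le> M n"
      using assms(3)[OF z] by blast
    have u: "uniform_limit (cball z d) (\<lambda>X w. \<Sum>n\<in>X. f n w) (\<lambda>w. \<Sum>\<^sub>\<infinity>n\<in>I. f n w) (finite_subsets_at_top I)"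
      using d(4,3) by (rule Weierstrass_m_test_general)
    have h: "(\<lambda>w. \<Sum>n\<in>X. f n w) holomorphic_on A" if "X \<subseteq> I" for X
      using assms(2) that by (intro holomorphic_intros) auto
    have "\<forall>\<^sub>F X in finite_subsets_at_top I. continuous_on (cball z d) (\<lambda>w. \<Sum>n\<in>X. f n w) \<and> (\<lambda>w. \<Sum>n\<in>X. f n w) holomorphic_on ball z d"
    proof (rule eventually_finite_subsets_at_top_weakI)
      fix X assume "finite X" "X \<subseteq> I"
      thus "continuous_on (cball z d) (\<lambda>w. \<Sum>n\<in>X. f n w) \<and> (\<lambda>w. \<Sum>n\<in>X. f n w) holomorphic_on ball z d"
        using h[of X] d(2) ball_subset_cball holomorphic_on_imp_continuous_on holomorphic_on_subset
        by (metis order_trans)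
    qed
    from holomorphic_uniform_limit[OF this u]
    have "(\<lambda>z. \<Sum>\<^sub>\<infinity>n\<in>I. f n z) holomorphic_on ball z d"
      by auto
    thus ?thesis
      using d(1) by (meson centre_in_ball holomorphic_on_imp_differentiable_at open_ball)
  qed
  thus ?thesis
    unfolding holomorphic_on_def using field_differentiable_at_within by blast
qed

lemma continuous_on_infsum:
  fixes f :: "'i \<Rightarrow> complex \<Rightarrow> complex"
  assumes "\<And>n. n \<in> I \<Longrightarrow> continuous_on A (f n)" "M summable_on I"
    and "\<And>n z. n \<in> I \<Longrightarrow> z \<in> A \<Longrightarrow> norm (f n z) \<le> M n"
  shows "continuous_on A (\<lambda>z. \<Sum>\<^sub>\<infinity>n\<in>I. f n z)"
proof (rule uniform_limit_theorem)
  show "uniform_limit A (\<lambda>X w. \<Sum>n\<in>X. f n w) (\<lambda>w. \<Sum>\<^sub>\<infinity>n\<in>I. f n w) (finite_subsets_at_top I)"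
    using assms(3,2) by (rule Weierstrass_m_test_general)
  show "\<forall>\<^sub>F X in finite_subsets_at_top I. continuous_on A (\<lambda>w. \<Sum>n\<in>X. f n w)"
    by (rule eventually_finite_subsets_at_top_weakI) (use assms(1) in \<open>auto intro!: continuous_intros\<close>)
qed auto

locale nome =
  fixes p :: complex
  assumes p_nz [simp]: "p \<noteq> 0" and p_lt_1 [simp]: "norm p < 1"
begin

definition E :: complex where "E = qp p p"

text \<open>The multiplicative Jacobi theta function: holomorphic off 0, with simple zeros exactly
  at the powers of p and multiplier -1/a under a -> p a.\<close>

definition th :: "complex \<Rightarrow> complex" where
  "th a = qp a p * qp (p / a) p"

text \<open>This is \<open>th\<close> with the zero at 1 divided out, so its value at 1 is
  nonzero.\<close>

definition th0 :: "complex \<Rightarrow> complex" where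
  "th0 a = qp (p * a) p * qp (p / a) p"

text \<open>Jacobi's theta series with exponent n^2 instead of n (n - 1) / 2. Hence its natural
  shift is w -> p^2 w, and w = x with x^2 = p gives the series with exponents 2 n^2 + n in
  x.\<close>

definition tau :: "complex \<Rightarrow> complex" where
  "tau w = (\<Sum>\<^sub>\<infinity>n::int. p powi (n\<^sup>2) * w powi n)"

text \<open>If a is a power of p, then the one term with vanishing denominator is 0; in particular, S w 1
  is the sum over all nonzero n.\<close>

definition S :: "complex \<Rightarrow> complex \<Rightarrow> complex" where
  "S w a = (\<Sum>\<^sub>\<infinity>n::int. p powi (n\<^sup>2) * w powi n / (1 - a * p powi n))"

lemma E_nz [simp]: "E \<noteq> 0"
  by (simp add: E_def qp_nonzero)

lemma th_eq: "th a = (1 - a) * th0 a"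
  unfolding th_def th0_def using qp_head[of p a] by (simp add: mult_ac)

lemma th_p:
  assumes "a \<noteq> 0"
  shows "th (p * a) = - th a / a"
proof -
  have "th a = (1 - a) * qp (p * a) p * qp (p / a) p"
    unfolding th_def using qp_head[of p a] by (simp add: mult.commute)
  moreover have "th (p * a) = qp (p * a) p * ((1 - 1 / a) * qp (p / a) p)"
    unfolding th_def using qp_head[of p "1 / a"] by simp
  moreover have "(1 - 1 / a) = - (1 - a) / a" using assms by (simp add: field_simps)
  ultimately show ?thesis by (simp only:) (simp only: minus_divide_left[symmetric] mult_minus_left mult_minus_right mult_ac times_divide_eq_right times_divide_eq_left)
qed

lemma th_inverse: "a \<noteq> 0 \<Longrightarrow> th (1 / a) = - th a / a"
  using th_p[of a] by (simp add: th_def mult_ac)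

lemma th_reflect: "a \<noteq> 0 \<Longrightarrow> th (p / a) = th a"
  unfolding th_def by (simp add: field_simps)

lemma th_1 [simp]: "th 1 = 0"
  by (simp add: th_def)

lemma th0_1 [simp]: "th0 1 = E\<^sup>2"
  by (simp add: th0_def E_def power2_eq_square)

lemma th_eq_0_iff:
  assumes "a \<noteq> 0"
  shows "th a = 0 \<longleftrightarrow> (\<exists>n::int. a = p powi n)"
proof
  assume "th a = 0"
  then consider k where "a * p ^ k = 1" | k where "p / a * p ^ k = 1"
    by (auto simp: th_def qp_eq_0_iff)
  thus "\<exists>n::int. a = p powi n"
  proof cases
    case (1 k)
    thus ?thesis by (intro exI[of _ "- int k"]) (simp add: power_int_minus field_simps)
  next
    case (2 k)
    thus ?thesis using assms by (intro exI[of _ "int (Suc k)"]) (simp add: field_simps del: of_nat_Suc)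
  qed
next
  assume "\<exists>n::int. a = p powi n"
  then obtain n :: int where n: "a = p powi n" by blast
  show "th a = 0"
  proof (cases "n \<le> 0")
    case True
    then obtain m where "n = - int m" by (metis nonpos_int_cases)
    hence "a * p ^ m = 1"
      by (simp add: n power_int_minus)
    thus ?thesis by (auto simp: th_def qp_eq_0_iff)
  next
    case False
    then obtain k where k: "n = int (Suc k)"
      by (metis not_le_imp_less zero_less_imp_eq_int gr0_implies_Suc)
    hence "p / a * p ^ k = 1" by (simp add: n del: of_nat_Suc)
    thus ?thesis by (auto simp: th_def qp_eq_0_iff)
  qed
qed

lemma th_p_powi: "a \<noteq> 0 \<Longrightarrow> th (a * p powi n) = 0 \<longleftrightarrow> th a = 0"
  by (subst (1 2) th_eq_0_iff)
     (auto simp: field_simps intro: exI[of _ "_ + n"] exI[of _ "_ - n"] simp: power_int_diff power_int_add)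

lemma holomorphic_th' [holomorphic_intros]:
  assumes "f holomorphic_on A" "\<And>z. z \<in> A \<Longrightarrow> f z \<noteq> 0"
  shows "(\<lambda>z. th (f z)) holomorphic_on A"
  unfolding th_def using assms by (intro holomorphic_intros) auto

lemma holomorphic_th0' [holomorphic_intros]:
  assumes "f holomorphic_on A" "\<And>z. z \<in> A \<Longrightarrow> f z \<noteq> 0"
  shows "(\<lambda>z. th0 (f z)) holomorphic_on A"
  unfolding th0_def using assms by (intro holomorphic_intros) auto

text \<open>thn n a is th a / (1 - a p^n), continued analytically to the zero of the denominator. Hence SR w
  continues th a * S w a to a holomorphic function on the punctured plane.\<close>

definition thn :: "int \<Rightarrow> complex \<Rightarrow> complex" where
  "thn n a = (-1) powi n * p powi (n * (n - 1) div 2) * a powi n * th0 (a * p powi n)"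

definition SR :: "complex \<Rightarrow> complex \<Rightarrow> complex" where
  "SR w a = (\<Sum>\<^sub>\<infinity>n::int. p powi (n\<^sup>2) * w powi n * thn n a)"

lemma triangular_int: "(n + 1) * (n + 1 - 1) div 2 = n * (n - 1) div 2 + (n :: int)"
proof -
  have "(n + 1) * (n + 1 - 1) = n * (n - 1) + n * 2" by (simp add: algebra_simps)
  thus ?thesis by simp
qed

lemma thn_p: "a \<noteq> 0 \<Longrightarrow> thn n (p * a) = - thn (n + 1) a / a"
  unfolding thn_def triangular_int
  by (simp add: power_int_add power_int_mult_distrib mult_ac)

text \<open>The factor in front is the accumulated multiplier of n shifts by p, so the left-hand
  side does not change with n. \<open>thn\<close> is built from the same factor.\<close>

lemma th_shift_int:
  assumes "a \<noteq> 0"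
  shows "(-1) powi n * p powi (n * (n - 1) div 2) * a powi n * th (a * p powi n) = th a"
proof -
  define g where "g n = (-1) powi n * p powi (n * (n - 1) div 2) * a powi n * th (a * p powi n)" for n :: int
  have step: "g (n + 1) = g n" for n
  proof -
    have "th (a * p powi (n + 1)) = - th (a * p powi n) / (a * p powi n)"
      using th_p[of "a * p powi n"] assms by (simp add: power_int_add mult_ac)
    thus ?thesis
      unfolding g_def triangular_int using assms by (simp add: power_int_add)
  qed
  have "g n = g 0"
    by (induction n rule: int_induct[of _ 0]) (use step step[of "_ - 1"] in auto)
  thus ?thesis by (simp add: g_def)
qed

lemma thn_mult: "a \<noteq> 0 \<Longrightarrow> (1 - a * p powi n) * thn n a = th a"
  using th_shift_int[of a n] by (simp add: thn_def th_eq[of "a * p powi n"] mult_ac)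

lemma thn_zero [simp]: "thn 0 a = th0 a"
  by (simp add: thn_def)

lemma p_powi_square_Suc: "p powi ((n + 1)\<^sup>2) = p powi (n\<^sup>2) * (p powi n)\<^sup>2 * p"
proof -
  have "p powi ((n + 1)\<^sup>2) = p powi (n\<^sup>2 + (n + n + 1))"
    by (rule arg_cong) (simp add: power2_eq_square algebra_simps)
  also have "\<dots> = p powi (n\<^sup>2) * (p powi n * p powi n * p)"
    by (simp only: power_int_add p_nz simp_thms power_int_1_right)
  finally show ?thesis by (simp only: power2_eq_square[of "p powi n"] mult_ac)
qed

lemma p_square_powi: "(p\<^sup>2) powi n = (p powi n)\<^sup>2"
  by (simp add: power_int_power power_int_power' mult.commute)

lemma p_powi_eq_1_iff: "p powi n = 1 \<longleftrightarrow> n = 0"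
proof
  assume "p powi n = 1"
  hence "norm p powi n = 1" by (metis norm_one norm_power_int)
  thus "n = 0"
    using power_int_strict_decreasing[of n 0 "norm p"] power_int_strict_decreasing[of 0 n "norm p"]
    by (cases n "0 :: int" rule: linorder_cases) auto
qed auto

text \<open>Since \<open>th 1\<close> is 0, only the term whose denominator vanishes at a = 1
  survives. This makes \<open>SR w 1\<close> independent of w.\<close>

lemma thn_1: "thn n 1 = (if n = 0 then E\<^sup>2 else 0)"
proof -
  show ?thesis using thn_mult[of 1 n] by (auto simp: p_powi_eq_1_iff)
qed

lemma summable_tau: "w \<noteq> 0 \<Longrightarrow> (\<lambda>n::int. p powi (n\<^sup>2) * w powi n) summable_on UNIV"
  and abs_summable_tau: "w \<noteq> 0 \<Longrightarrow> (\<lambda>n::int. norm (p powi (n\<^sup>2) * w powi n)) summable_on UNIV"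
proof -
  show *: "(\<lambda>n::int. norm (p powi (n\<^sup>2) * w powi n)) summable_on UNIV" if "w \<noteq> 0"
    using summable_on_quadratic_exponent[of "norm p" "norm w"] that by (simp add: norm_mult norm_power_int)
  show "(\<lambda>n::int. p powi (n\<^sup>2) * w powi n) summable_on UNIV" if "w \<noteq> 0"
    using *[OF that] by (rule abs_summable_summable)
qed

lemma tau_inverse: "tau (1 / w) = tau w"
  unfolding tau_def
  by (rule infsum_reindex_bij_witness[of _ uminus uminus]) (auto simp: power_int_minus power_int_inverse divide_inverse)

lemma tau_shift:
  assumes "w \<noteq> 0"
  shows "tau w = p * w * tau (p\<^sup>2 * w)"
proof -
  have "tau w = (\<Sum>\<^sub>\<infinity>n::int. p powi ((n+1)\<^sup>2) * w powi (n+1))"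
    unfolding tau_def
    by (rule infsum_reindex_bij_witness[of _ "\<lambda>n. n + 1" "\<lambda>n. n - 1"]) auto
  also have "\<dots> = (\<Sum>\<^sub>\<infinity>n::int. p * w * (p powi (n\<^sup>2) * (p\<^sup>2 * w) powi n))"
    using assms by (intro infsum_cong)
      (simp add: p_powi_square_Suc power_int_add power_int_mult_distrib p_square_powi mult_ac)
  finally show ?thesis by (simp add: infsum_cmult_right' tau_def)
qed

text \<open>The quotient tends to 1 for n -> infinity and, after expanding by a power of p, to 0 for
  n -> -infinity; convergent sequences are bounded. A vanishing denominator is harmless, as the
  quotient is then 0.\<close>

lemma denominator_bound:
  assumes "a \<noteq> 0"
  obtains K where "K > 0" "\<And>n::int. norm (1 / (1 - a * p powi n)) \<le> K"
proof -
  have l1: "(\<lambda>n. 1 / (1 - a * p ^ n)) \<longlonglongrightarrow> 1 / (1 - a * 0)"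
    by (intro tendsto_intros LIMSEQ_power_zero) auto
  have l2: "(\<lambda>n. p ^ n / (p ^ n - a)) \<longlonglongrightarrow> 0 / (0 - a)"
    using assms by (intro tendsto_intros LIMSEQ_power_zero) auto
  obtain K1 where K1: "\<And>n. norm (1 / (1 - a * p ^ n)) \<le> K1"
    using Bseq_conv_Bfun convergent_imp_Bseq[OF convergentI[OF l1]] unfolding Bseq_def by blast
  obtain K2 where K2: "\<And>n. norm (p ^ n / (p ^ n - a)) \<le> K2"
    using convergent_imp_Bseq[OF convergentI[OF l2]] unfolding Bseq_def by blast
  show ?thesis
  proof (rule that[of "\<bar>K1\<bar> + \<bar>K2\<bar> + 1"])
    fix n :: int
    show "norm (1 / (1 - a * p powi n)) \<le> \<bar>K1\<bar> + \<bar>K2\<bar> + 1"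
    proof (cases n rule: int_cases2)
      case (nonneg m) thus ?thesis using K1[of m] by simp
    next
      case (nonpos m)
      have "1 / (1 - a * p powi n) = p ^ m / (p ^ m - a)"
        by (simp add: nonpos power_int_minus divide_simps)
      thus ?thesis using K2[of m] by simp
    qed
  qed auto
qed

lemma abs_summable_S:
  assumes "w \<noteq> 0" "a \<noteq> 0"
  shows "(\<lambda>n::int. norm (p powi (n\<^sup>2) * w powi n / (1 - a * p powi n))) summable_on UNIV"
proof -
  obtain K where K: "K > 0" "\<And>n::int. norm (1 / (1 - a * p powi n)) \<le> K"
    using denominator_bound[OF assms(2)] by blast
  have "norm (p powi (n\<^sup>2) * w powi n / (1 - a * p powi n)) \<le> norm (p powi (n\<^sup>2) * w powi n) * K" for n :: int
    using mult_left_mono[OF K(2)[of n], of "norm (p powi (n\<^sup>2) * w powi n)"]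
    by (simp add: norm_divide norm_mult)
  thus ?thesis
    using summable_on_comparison_test[OF summable_on_cmult_left[OF abs_summable_tau[OF assms(1)], of K]] by simp
qed

lemma summable_S:
  assumes "w \<noteq> 0" "a \<noteq> 0"
  shows "(\<lambda>n::int. p powi (n\<^sup>2) * w powi n / (1 - a * p powi n)) summable_on UNIV"
  using abs_summable_S[OF assms] by (rule abs_summable_summable)

section \<open>Majorants and holomorphy of the regularized Lambert sum\<close>

lemma th_bound_near_1:
  obtains K where "K > 0" "\<And>b. norm (1 - b) < 1/2 \<Longrightarrow> norm (th0 b) \<le> K"
proof -
  have "continuous_on (cball 1 (1/2)) th0"
    by (intro holomorphic_on_imp_continuous_on holomorphic_intros) (auto simp: dist_norm)
  hence "compact (th0 ` cball 1 (1/2))" by (intro compact_continuous_image) auto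
  then obtain K where "\<forall>x\<in>th0 ` cball 1 (1/2). norm x \<le> K"
    using compact_imp_bounded bounded_iff by metis
  hence "norm (th0 b) \<le> \<bar>K\<bar> + 1" if "norm (1 - b) < 1/2" for b
  proof -
    have "b \<in> cball 1 (1/2)" using that by (simp add: dist_norm)
    hence "norm (th0 b) \<le> K" using \<open>\<forall>x\<in>th0 ` cball 1 (1/2). norm x \<le> K\<close> by blast
    thus ?thesis by linarith
  qed
  thus ?thesis by (intro that[of "\<bar>K\<bar> + 1"]) auto
qed

text \<open>If 1 - a p^n is bounded away from 0, divide \<open>th a\<close> by it; otherwise a p^n
  lies near 1, where \<open>th0\<close> is bounded, and the explicit form of \<open>thn\<close>
  applies. The bound is uniform in n up to a geometric factor, which p^(n^2) will absorb.\<close>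

lemma thn_bound:
  obtains K where "K > 0" "\<And>n a. a \<noteq> 0 \<Longrightarrow> norm (thn n a) \<le> 2 * norm (th a) + K * norm a powi n"
proof -
  obtain K where K: "K > 0" "\<And>b. norm (1 - b) < 1/2 \<Longrightarrow> norm (th0 b) \<le> K"
    using th_bound_near_1 by blast
  have "norm (thn n a) \<le> 2 * norm (th a) + K * norm a powi n" if a: "a \<noteq> 0" for n a
  proof (cases "norm (1 - a * p powi n) < 1/2")
    case True
    have "0 \<le> n * (n - 1)" by (cases "n \<le> 0") (auto simp: mult_nonneg_nonneg mult_nonpos_nonpos)
    hence "norm p powi (n * (n - 1) div 2) \<le> 1"
      by (intro power_int_le_one) (auto simp: less_imp_le)
    hence "norm (p powi (n * (n - 1) div 2)) * norm a powi n * norm (th0 (a * p powi n)) \<le> 1 * norm a powi n * K"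
      using K(2)[OF True] K(1) by (intro mult_mono mult_right_mono) (auto simp: norm_power_int)
    hence "norm (thn n a) \<le> 1 * norm a powi n * K"
      unfolding thn_def by (simp add: norm_mult norm_power_int)
    thus ?thesis by (simp add: mult_ac add_increasing)
  next
    case False
    have "norm (th a) = norm (1 - a * p powi n) * norm (thn n a)"
      using thn_mult[OF a, of n] by (metis norm_mult)
    moreover have "1/2 * norm (thn n a) \<le> norm (1 - a * p powi n) * norm (thn n a)"
      using False by (intro mult_right_mono) auto
    moreover have "0 \<le> K * norm a powi n" using K(1) by simp
    ultimately show ?thesis by linarith
  qed
  with K(1) show ?thesis using that by blast
qed

text \<open>The power is increasing or decreasing in x according to the sign of n; adding both
  endpoint values covers the two cases at once.\<close>

lemma powi_between:
  fixes x l u :: real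
  assumes "0 < l" "l \<le> x" "x \<le> u"
  shows "x powi n \<le> l powi n + u powi n"
proof (cases "n \<ge> 0")
  case True
  hence "x powi n \<le> u powi n" using assms by (intro power_int_mono) auto
  thus ?thesis using assms by (simp add: add_increasing)
next
  case False
  hence "x powi n \<le> l powi n" using assms by (intro power_int_antimono) auto
  thus ?thesis using assms by (simp add: add_increasing2)
qed

lemma SR_majorant:
  assumes "w \<noteq> 0" "z \<noteq> 0"
  shows "\<exists>M. M summable_on UNIV \<and>
     (\<forall>n. \<forall>a\<in>cball z (norm z / 2). norm (p powi (n\<^sup>2) * w powi n * thn n a) \<le> M n)"
proof -
  obtain K where K: "K > 0" "\<And>n a. a \<noteq> 0 \<Longrightarrow> norm (thn n a) \<le> 2 * norm (th a) + K * norm a powi n"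
    using thn_bound by blast
  have nz: "a \<noteq> 0" if "a \<in> cball z (norm z / 2)" for a
    using that assms by (auto simp: dist_norm)
  have "compact (th ` cball z (norm z / 2))"
    by (intro compact_continuous_image holomorphic_on_imp_continuous_on holomorphic_intros nz) auto
  then obtain T where T: "\<And>a. a \<in> cball z (norm z / 2) \<Longrightarrow> norm (th a) \<le> T"
    using compact_imp_bounded bounded_iff by (metis imageI)
  define M where "M = (\<lambda>n::int. 2 * T * (norm p powi (n\<^sup>2) * norm w powi n) +
     (K * (norm p powi (n\<^sup>2) * (norm w * (norm z / 2)) powi n) + K * (norm p powi (n\<^sup>2) * (norm w * (3 * norm z / 2)) powi n)))"
  have "M summable_on UNIV"
    unfolding M_def using assms
    by (intro summable_on_add summable_on_cmult_right summable_on_quadratic_exponent) auto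
  moreover have "norm (p powi (n\<^sup>2) * w powi n * thn n a) \<le> M n" if a: "a \<in> cball z (norm z / 2)" for n a
  proof -
    have "norm z / 2 \<le> norm a" "norm a \<le> 3 * norm z / 2"
      using a norm_triangle_ineq2[of z a] norm_triangle_ineq2[of a z] by (auto simp: dist_norm norm_minus_commute)
    hence "norm a powi n \<le> (norm z / 2) powi n + (3 * norm z / 2) powi n"
      using assms by (intro powi_between) auto
    hence "K * norm a powi n \<le> K * ((norm z / 2) powi n + (3 * norm z / 2) powi n)"
      using K(1) by (intro mult_left_mono) auto
    hence "norm (thn n a) \<le> 2 * T + K * ((norm z / 2) powi n + (3 * norm z / 2) powi n)"
      using K(2)[OF nz[OF a], of n] T[OF a] by linarith
    hence "norm (p powi (n\<^sup>2) * w powi n) * norm (thn n a) \<le> norm (p powi (n\<^sup>2) * w powi n) * (2 * T + K * ((norm z / 2) powi n + (3 * norm z / 2) powi n))"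
      by (intro mult_left_mono) auto
    also have "\<dots> = M n"
      unfolding M_def norm_mult norm_power_int power_int_mult_distrib by (simp only: algebra_simps)
    finally show ?thesis by (simp add: norm_mult)
  qed
  ultimately show ?thesis by blast
qed

lemma summable_SR:
  assumes "w \<noteq> 0" "a \<noteq> 0"
  shows "(\<lambda>n::int. p powi (n\<^sup>2) * w powi n * thn n a) summable_on UNIV"
proof -
  obtain M where M: "M summable_on UNIV" "\<And>n b. b \<in> cball a (norm a / 2) \<Longrightarrow> norm (p powi (n\<^sup>2) * w powi n * thn n b) \<le> M n"
    using SR_majorant[OF assms] by auto
  have "(\<lambda>n::int. norm (p powi (n\<^sup>2) * w powi n * thn n a)) summable_on UNIV"
    using M(1) by (rule summable_on_comparison_test) (auto intro: M(2))
  thus ?thesis by (rule abs_summable_summable)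
qed

lemma holomorphic_SR:
  assumes "w \<noteq> 0"
  shows "SR w holomorphic_on - {0}"
  unfolding SR_def[abs_def]
proof (rule holomorphic_on_infsum)
  fix n :: int
  show "(\<lambda>a. p powi (n\<^sup>2) * w powi n * thn n a) holomorphic_on - {0}"
    unfolding thn_def by (intro holomorphic_intros) auto
next
  fix z :: complex assume "z \<in> - {0}"
  hence z: "z \<noteq> 0" by simp
  hence "cball z (norm z / 2) \<subseteq> - {0}" by (auto simp: dist_norm)
  with SR_majorant[OF assms z] z
  show "\<exists>d>0. \<exists>M. cball z d \<subseteq> - {0} \<and> M summable_on UNIV \<and> (\<forall>n\<in>UNIV. \<forall>a\<in>cball z d. norm (p powi (n\<^sup>2) * w powi n * thn n a) \<le> M n)"
    by (intro exI[of _ "norm z / 2"]) auto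
qed auto

lemma holomorphic_SR' [holomorphic_intros]:
  assumes "f holomorphic_on A" "\<And>z. z \<in> A \<Longrightarrow> f z \<noteq> 0" "w \<noteq> 0"
  shows "(\<lambda>z. SR w (f z)) holomorphic_on A"
  using holomorphic_on_compose_gen[OF assms(1) holomorphic_SR[OF assms(3)]] assms(2)
  by (force simp: o_def)

section \<open>Functional equations of the Lambert sums\<close>

lemma SR_eq:
  assumes "a \<noteq> 0" "th a \<noteq> 0"
  shows "SR w a = th a * S w a"
proof -
  have "thn n a = th a / (1 - a * p powi n)" for n
    using thn_mult[OF assms(1), of n] assms(2) by (metis mult_zero_left nonzero_mult_div_cancel_left)
  thus ?thesis
    unfolding SR_def S_def by (simp add: infsum_cmult_right'[symmetric] mult_ac)
qed

lemma SR_1: "SR w 1 = E\<^sup>2"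
proof -
  have "SR w 1 = (\<Sum>\<^sub>\<infinity>n\<in>{0::int}. p powi (n\<^sup>2) * w powi n * thn n 1)"
    unfolding SR_def by (rule infsum_cong_neutral) (auto simp: thn_1)
  thus ?thesis by (simp add: thn_1)
qed

text \<open>Shift n by one and put X = p^(n+1). The new factor 1 / X^2 is split by 1 = (a X)^2 + (1
  - a X) (1 + a X): the first part reproduces \<open>SR w a\<close>, while in the second part 1 - a
  X times \<open>thn\<close> is \<open>th a\<close>, which leaves theta series at w / p^2 and w /
  p.\<close>

lemma SR_p:
  assumes "w \<noteq> 0" "a \<noteq> 0"
  shows "SR w (p * a) = - p / (a * w) * (a\<^sup>2 * SR w a + th a * (tau (w / p\<^sup>2) + a * tau (w / p)))"
proof -
  have eq: "p powi (n\<^sup>2) * w powi n * thn n (p * a) =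
    - p / (a * w) * (a\<^sup>2 * (p powi ((n+1)\<^sup>2) * w powi (n+1) * thn (n+1) a)
      + th a * (p powi ((n+1)\<^sup>2) * (w / p\<^sup>2) powi (n+1)) + a * th a * (p powi ((n+1)\<^sup>2) * (w / p) powi (n+1)))" for n :: int
  proof -
    define X where "X = p powi (n + 1)"
    have X: "X \<noteq> 0" by (simp add: X_def)
    have th: "th a = (1 - a * X) * thn (n + 1) a"
      using thn_mult[OF assms(2), of "n+1"] by (simp add: X_def)
    have sq: "p powi (n\<^sup>2) = p powi ((n+1)\<^sup>2) * p / X\<^sup>2"
      unfolding p_powi_square_Suc X_def by (simp add: power_int_add field_simps power2_eq_square)
    have w1: "(w / p\<^sup>2) powi (n+1) = w powi (n+1) / X\<^sup>2"
      by (simp add: X_def power_int_divide_distrib p_square_powi)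
    have w2: "(w / p) powi (n+1) = w powi (n+1) / X"
      by (simp add: X_def power_int_divide_distrib)
    have w3: "w powi n = w powi (n+1) / w"
      using assms by (simp add: power_int_add)
    show ?thesis
      unfolding thn_p[OF assms(2)] sq w1 w2 w3 th using assms X
      by (simp add: field_simps power2_eq_square)
  qed
  define f where "f = (\<lambda>n. - p / (a * w) * (a\<^sup>2 * (p powi (n\<^sup>2) * w powi n * thn n a)
      + th a * (p powi (n\<^sup>2) * (w / p\<^sup>2) powi n) + a * th a * (p powi (n\<^sup>2) * (w / p) powi n)))"
  have "SR w (p * a) = (\<Sum>\<^sub>\<infinity>n. f n)"
    unfolding SR_def by (rule infsum_reindex_bij_witness[of _ "\<lambda>n. n - 1" "\<lambda>n. n + 1"]) (auto simp: eq f_def)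
  also have "\<dots> = - p / (a * w) * (\<Sum>\<^sub>\<infinity>n. a\<^sup>2 * (p powi (n\<^sup>2) * w powi n * thn n a)
      + th a * (p powi (n\<^sup>2) * (w / p\<^sup>2) powi n) + a * th a * (p powi (n\<^sup>2) * (w / p) powi n))"
    unfolding f_def by (rule infsum_cmult_right')
  also have "(\<Sum>\<^sub>\<infinity>n. a\<^sup>2 * (p powi (n\<^sup>2) * w powi n * thn n a)
      + th a * (p powi (n\<^sup>2) * (w / p\<^sup>2) powi n) + a * th a * (p powi (n\<^sup>2) * (w / p) powi n)) =
      a\<^sup>2 * SR w a + th a * tau (w / p\<^sup>2) + a * th a * tau (w / p)"
    unfolding SR_def tau_def using assms
    by (subst infsum_add, (intro summable_on_add summable_on_cmult_right summable_SR summable_tau; simp)+)+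
       (simp add: infsum_cmult_right')
  finally show ?thesis by (simp add: algebra_simps)
qed

lemma has_sum_tau: "w \<noteq> 0 \<Longrightarrow> ((\<lambda>n::int. p powi (n\<^sup>2) * w powi n) has_sum tau w) UNIV"
  unfolding tau_def by (intro has_sum_infsum summable_tau)

lemma has_sum_S:
  assumes "w \<noteq> 0" "a \<noteq> 0"
  shows "((\<lambda>n::int. p powi (n\<^sup>2) * w powi n / (1 - a * p powi n)) has_sum S w a) UNIV"
  unfolding S_def using assms by (intro has_sum_infsum summable_S)

text \<open>Termwise, p^n / (1 - a p^n) = (1 / (1 - a p^n) - 1) / a.\<close>

lemma S_mult_p:
  assumes "w \<noteq> 0" "a \<noteq> 0" "\<And>n. a * p powi n \<noteq> 1"
  shows "S (w * p) a = (S w a - tau w) / a"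
proof (unfold S_def[of "w * p"], rule infsumI)
  have "((\<lambda>n. 1 / a * (p powi (n\<^sup>2) * w powi n / (1 - a * p powi n) + - (p powi (n\<^sup>2) * w powi n))) has_sum (1 / a * (S w a + - tau w))) UNIV"
    by (intro has_sum_cmult_right has_sum_add has_sum_uminusI has_sum_S has_sum_tau assms)
  also have "(\<lambda>n. 1 / a * (p powi (n\<^sup>2) * w powi n / (1 - a * p powi n) + - (p powi (n\<^sup>2) * w powi n))) =
    (\<lambda>n. p powi (n\<^sup>2) * (w * p) powi n / (1 - a * p powi n))"
    using assms(2,3) by (auto simp: fun_eq_iff power_int_mult_distrib field_simps)
  also have "1 / a * (S w a + - tau w) = (S w a - tau w) / a" by simp
  finally show "((\<lambda>n. p powi (n\<^sup>2) * (w * p) powi n / (1 - a * p powi n)) has_sum (S w a - tau w) / a) UNIV" .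
qed

text \<open>At a = 1 both Lambert sums omit the term n = 0, but \<open>tau w\<close> contains it
  with value 1; hence the final + 1.\<close>

lemma S_mult_p_1:
  assumes "w \<noteq> 0"
  shows "S (w * p) 1 = S w 1 - tau w + 1"
proof (unfold S_def[of "w * p"], rule infsumI)
  have "((\<lambda>n::int. of_bool (n = 0) :: complex) has_sum 1) UNIV"
    by (rule has_sum_finite_neutralI[of "{0}"]) auto
  hence "((\<lambda>n. p powi (n\<^sup>2) * w powi n / (1 - 1 * p powi n) + - (p powi (n\<^sup>2) * w powi n) + of_bool (n = 0)) has_sum (S w 1 + - tau w + 1)) UNIV"
    by (intro has_sum_add has_sum_uminusI has_sum_S has_sum_tau assms) auto
  also have "(\<lambda>n. p powi (n\<^sup>2) * w powi n / (1 - 1 * p powi n) + - (p powi (n\<^sup>2) * w powi n) + of_bool (n = 0)) =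
    (\<lambda>n. p powi (n\<^sup>2) * (w * p) powi n / (1 - 1 * p powi n))"
  proof
    fix n :: int
    show "p powi (n\<^sup>2) * w powi n / (1 - 1 * p powi n) + - (p powi (n\<^sup>2) * w powi n) + of_bool (n = 0) =
      p powi (n\<^sup>2) * (w * p) powi n / (1 - 1 * p powi n)"
      using p_powi_eq_1_iff[of n] by (cases "n = 0") (auto simp: power_int_mult_distrib field_simps)
  qed
  finally show "((\<lambda>n. p powi (n\<^sup>2) * (w * p) powi n / (1 - 1 * p powi n)) has_sum S w 1 - tau w + 1) UNIV"
    by simp
qed

lemma S_reflect:
  assumes "w \<noteq> 0" "a \<noteq> 0"
  shows "S w a = - S (p / w) (1 / a) / a"
proof -
  have "S w a = (\<Sum>\<^sub>\<infinity>n. - 1 / a * (p powi (n\<^sup>2) * (p / w) powi n / (1 - 1 / a * p powi n)))"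
    unfolding S_def
    by (rule infsum_reindex_bij_witness[of _ uminus uminus])
       (use assms in \<open>auto simp: power_int_minus power_int_divide_distrib divide_simps\<close>, auto simp: algebra_simps)
  also have "\<dots> = - 1 / a * S (p / w) (1 / a)"
    unfolding S_def by (rule infsum_cmult_right')
  finally show ?thesis by simp
qed

text \<open>A pure change of summation index. Unlike in \<open>SR_p\<close> no theta series appears;
  instead w is moved along.\<close>

lemma S_p:
  assumes "w \<noteq> 0"
  shows "S w (p * a) = p / w * S (w / p\<^sup>2) a"
proof -
  have "S w (p * a) = (\<Sum>\<^sub>\<infinity>n. p / w * (p powi (n\<^sup>2) * (w / p\<^sup>2) powi n / (1 - a * p powi n)))"
    unfolding S_def
  proof (rule infsum_reindex_bij_witness[of _ "\<lambda>n. n - 1" "\<lambda>n. n + 1"])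
    fix n :: int
    have "(w / p\<^sup>2) powi (n+1) = w powi (n+1) / (p powi (n+1))\<^sup>2"
      by (simp add: power_int_divide_distrib p_square_powi)
    also have "\<dots> = w powi n * w / (p\<^sup>2 * (p powi n)\<^sup>2)"
      using assms by (simp add: power_int_add power_mult_distrib mult.commute)
    finally have *: "(w / p\<^sup>2) powi (n+1) = w powi n * w / (p\<^sup>2 * (p powi n)\<^sup>2)" .
    have **: "a * p powi (n + 1) = p * a * p powi n"
      by (simp add: power_int_add)
    show "p / w * (p powi ((n + 1)\<^sup>2) * (w / p\<^sup>2) powi (n + 1) / (1 - a * p powi (n + 1))) =
         p powi (n\<^sup>2) * w powi n / (1 - p * a * p powi n)"
      unfolding * ** p_powi_square_Suc using assms by (simp add: divide_simps power2_eq_square[of p])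
  qed auto
  also have "\<dots> = p / w * S (w / p\<^sup>2) a"
    unfolding S_def by (rule infsum_cmult_right')
  finally show ?thesis .
qed

section \<open>Quasiperiodic functions\<close>

text \<open>The functional equation propagates a bound from an annulus towards 0, so f extends to 0.
  There, comparing leading coefficients gives f = 0.\<close>

lemma quasiperiodic_degree_neg_eq_0:
  assumes rho: "\<rho> > 0" and hol: "f holomorphic_on ball 0 \<rho> - {0}"
    and per: "\<And>z. z \<noteq> 0 \<Longrightarrow> norm z < \<rho> \<Longrightarrow> f (p * z) = \<kappa> * z * f z"
    and z: "z \<noteq> 0" "norm z < \<rho>"
  shows "f z = 0"
proof -
  \<comment> \<open>With |\<kappa>| r at most 1 the multiplier does not increase |f| inside the disc
    of radius r, so the maximum over one fundamental annulus bounds f there.\<close>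
  define r where "r = min (\<rho> / 2) (1 / (norm \<kappa> + 1))"
  have r: "r > 0" "r < \<rho>" "norm \<kappa> * r \<le> 1"
    using rho by (auto simp: r_def min_def field_simps add_pos_nonneg)
  have "continuous_on (cball 0 r - ball 0 (norm p * r)) f"
    by (rule continuous_on_subset[OF holomorphic_on_imp_continuous_on[OF hol]]) (use r in \<open>auto simp: dist_norm\<close>)
  hence "compact (f ` (cball 0 r - ball 0 (norm p * r)))"
    by (intro compact_continuous_image compact_diff) auto
  then obtain M where M: "\<And>z. norm z \<le> r \<Longrightarrow> norm p * r \<le> norm z \<Longrightarrow> norm (f z) \<le> M"
    using compact_imp_bounded bounded_iff by (metis (no_types, lifting) DiffI imageI mem_ball_0 mem_cball_0 not_le)
  have bd: "norm (f z) \<le> M" if "norm z \<le> r" "norm p ^ Suc k * r \<le> norm z" for k z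
    using that
  proof (induction k arbitrary: z)
    case 0 thus ?case using M by simp
  next
    case (Suc k)
    show ?case
    proof (cases "norm p * r \<le> norm z")
      case False
      have "0 < norm p ^ Suc (Suc k) * r" using r by simp
      hence znz: "z \<noteq> 0" using Suc.prems(2) by (metis norm_zero not_less)
      have w: "norm (z / p) \<le> r" "norm p ^ Suc k * r \<le> norm (z / p)"
        using False Suc.prems by (simp_all add: norm_divide field_simps)
      have "f (p * (z / p)) = \<kappa> * (z / p) * f (z / p)"
        by (rule per) (use w r znz in auto)
      hence "norm (f z) = norm \<kappa> * norm (z / p) * norm (f (z / p))"
        by (simp add: norm_mult norm_divide)
      also have "\<dots> \<le> (norm \<kappa> * r) * norm (f (z / p))"
        using w(1) by (intro mult_right_mono mult_left_mono) auto
      also have "\<dots> \<le> 1 * norm (f (z / p))"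
        using r(3) by (intro mult_right_mono) auto
      also have "\<dots> \<le> M" using Suc.IH[OF w] by simp
      finally show ?thesis .
    qed (use M Suc.prems in auto)
  qed
  have bd': "norm (f z) \<le> M" if "norm z \<le> r" "z \<noteq> 0" for z
  proof -
    have "(\<lambda>k. norm p ^ Suc k * r) \<longlonglongrightarrow> 0 * r"
      by (intro tendsto_intros LIMSEQ_Suc LIMSEQ_power_zero) auto
    hence "eventually (\<lambda>k. norm p ^ Suc k * r < norm z) sequentially"
      using that by (intro order_tendstoD) auto
    then obtain k where "norm p ^ Suc k * r < norm z"
      by (auto simp: eventually_sequentially)
    thus ?thesis using bd[of z k] that by simp
  qed
  have "\<exists>g. g holomorphic_on ball 0 \<rho> \<and> (\<forall>z\<in>ball 0 \<rho> - {0}. g z = f z)"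
  proof (subst holomorphic_on_extend_bounded[OF hol])
    show "\<exists>B. \<forall>\<^sub>F z in at 0. norm (f z) \<le> B"
      using r(1) bd' by (intro exI[of _ M]) (auto simp: eventually_at dist_norm intro!: exI[of _ r])
  qed (use rho in auto)
  then obtain g where g: "g holomorphic_on ball 0 \<rho>" "\<And>z. z \<noteq> 0 \<Longrightarrow> norm z < \<rho> \<Longrightarrow> g z = f z"
    by auto
  have pz: "norm (p * z) < \<rho>" if "norm z < \<rho>" for z
  proof -
    have "norm (p * z) \<le> 1 * norm z"
      unfolding norm_mult by (intro mult_right_mono) (auto simp: less_imp_le)
    thus ?thesis using that by simp
  qed
  have gper: "g (p * z) = \<kappa> * z * g z" if "z \<noteq> 0" "norm z < \<rho>" for z
    using per[OF that] g(2)[OF that] g(2)[of "p * z"] that pz by simp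
  have cg: "isCont g z" if "norm z < \<rho>" for z
    using g(1) that by (metis continuous_on_eq_continuous_at holomorphic_on_imp_continuous_on mem_ball_0 open_ball)
  have ev: "eventually (\<lambda>z. z \<noteq> 0 \<and> norm z < d) (at 0)" if "d > 0" for d :: real
    using that by (auto simp: eventually_at dist_norm intro!: exI[of _ d])
  have lim: "((\<lambda>z. h (p * z)) \<longlongrightarrow> h 0) (at 0)" if "isCont h (0::complex)" for h :: "complex \<Rightarrow> complex"
  proof -
    have "((\<lambda>z::complex. p * z) \<longlongrightarrow> p * 0) (at 0)" by (intro tendsto_intros)
    from isCont_tendsto_compose[OF _ this] that show ?thesis by simp
  qed
  have g0: "g 0 = 0"
  proof (rule tendsto_unique[OF trivial_limit_at])
    have c: "isCont g 0" using cg[of 0] rho by simp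
    show "((\<lambda>z. g (p * z)) \<longlongrightarrow> g 0) (at 0)" using lim[OF c] .
    have "((\<lambda>z. \<kappa> * z * g z) \<longlongrightarrow> \<kappa> * 0 * g 0) (at 0)"
      using c by (intro tendsto_intros) (simp add: isCont_def)
    moreover have "eventually (\<lambda>z. g (p * z) = \<kappa> * z * g z) (at 0)"
      using ev[OF rho] by eventually_elim (use gper in auto)
    ultimately show "((\<lambda>z. g (p * z)) \<longlongrightarrow> 0) (at 0)"
      by (simp add: filterlim_cong)
  qed
  have "g constant_on ball 0 \<rho>"
  proof (rule ccontr)
    assume nc: "\<not> g constant_on ball 0 \<rho>"
    have zero: "(0::complex) \<in> ball 0 \<rho>" using rho by simp
    have "\<exists>h s n. 0 < n \<and> 0 < s \<and> ball (0::complex) s \<subseteq> ball 0 \<rho> \<and> h holomorphic_on ball 0 s \<and>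
       (\<forall>w\<in>ball 0 s. g w = (w - 0) ^ n * h w \<and> h w \<noteq> 0)"
    proof (rule holomorphic_factor_zero_nonconstant[OF g(1) open_ball connected_ball zero g0 nc], goal_cases)
      case (1 h s n)
      have X: "\<forall>w\<in>ball 0 s. g w = (w - 0) ^ n * h w \<and> h w \<noteq> 0" using 1(5,6) by blast
      show ?case by (rule exI[of _ h], rule exI[of _ s], rule exI[of _ n]) (intro conjI 1(1-4) X)
    qed
    then obtain h :: "complex \<Rightarrow> complex" and s n where h: "0 < n" "0 < s" "ball (0::complex) s \<subseteq> ball 0 \<rho>" "h holomorphic_on ball 0 s"
       "\<And>w. w \<in> ball 0 s \<Longrightarrow> g w = (w - 0) ^ n * h w" "\<And>w. w \<in> ball 0 s \<Longrightarrow> h w \<noteq> 0"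
      by blast
    have c: "isCont h 0"
      using h(4) h(2) by (metis continuous_on_eq_continuous_at holomorphic_on_imp_continuous_on centre_in_ball open_ball)
    \<comment> \<open>Here the positive power of z in the multiplier matters: after division by z^n
      the right-hand side of the functional equation still tends to 0.\<close>
    have "p ^ n * h 0 = 0"
    proof (rule tendsto_unique[OF trivial_limit_at])
      show "((\<lambda>z. p ^ n * h (p * z)) \<longlongrightarrow> p ^ n * h 0) (at 0)"
        using lim[OF c] by (intro tendsto_intros)
      have "((\<lambda>z. \<kappa> * z * h z) \<longlongrightarrow> \<kappa> * 0 * h 0) (at 0)"
        using c by (intro tendsto_intros) (simp add: isCont_def)
      moreover have "eventually (\<lambda>z. p ^ n * h (p * z) = \<kappa> * z * h z) (at 0)"
        using ev[OF h(2)]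
      proof eventually_elim
        case (elim z)
        have zs: "norm z < \<rho>" using elim h(3) by (auto simp: subset_iff)
        have "norm (p * z) \<le> 1 * norm z"
          unfolding norm_mult by (intro mult_right_mono) (auto simp: less_imp_le)
        hence "(p * z) ^ n * h (p * z) = \<kappa> * z * (z ^ n * h z)"
          using gper[of z] h(5)[of z] h(5)[of "p * z"] elim zs by auto
        hence "z ^ n * (p ^ n * h (p * z)) = z ^ n * (\<kappa> * z * h z)"
          by (simp add: power_mult_distrib mult_ac)
        thus ?case using elim by simp
      qed
      ultimately show "((\<lambda>z. p ^ n * h (p * z)) \<longlongrightarrow> 0) (at 0)"
        by (simp add: filterlim_cong)
    qed
    thus False using h(6)[of 0] h(2) by simp
  qed
  hence "g z = g 0"
    using z rho unfolding constant_on_def by (metis mem_ball_0 norm_zero)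
  thus ?thesis using g(2)[OF z] g0 by simp
qed

text \<open>The zeros of \<open>th\<close> are simple, so a zero of f at the same place can be
  divided out. The neighbourhood contains no further zero, which lets \<open>theta_divide\<close>
  recognise the local quotients as limits of f z / th (z / b).\<close>

lemma theta_zero_local:
  assumes b: "b \<noteq> 0" and f: "f holomorphic_on - {0}" "\<And>z. z \<noteq> 0 \<Longrightarrow> th (z / b) = 0 \<Longrightarrow> f z = 0"
    and z0: "z0 \<noteq> 0"
  shows "\<exists>U g. open U \<and> z0 \<in> U \<and> U \<subseteq> - {0} \<and> g holomorphic_on U \<and> (\<forall>z\<in>U. f z = th (z / b) * g z) \<and>
           (\<forall>z\<in>U - {z0}. th (z / b) \<noteq> 0)"
proof (cases "th (z0 / b) = 0")
  case False
  have c: "continuous_on (- {0}) (\<lambda>z. th (z / b))"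
    using b by (intro holomorphic_on_imp_continuous_on holomorphic_intros) auto
  define U where "U = {z \<in> - {0}. th (z / b) \<in> - {0}}"
  have "open U"
    unfolding U_def using continuous_open_preimage[OF c, of "- {0}"] by (simp add: vimage_def Int_def open_Compl)
  moreover have "(\<lambda>z. f z / th (z / b)) holomorphic_on U"
    using b by (intro holomorphic_intros holomorphic_on_subset[OF f(1)]) (auto simp: U_def)
  ultimately show ?thesis
    using False z0 by (intro exI[of _ U] exI[of _ "\<lambda>z. f z / th (z / b)"]) (auto simp: U_def)
next
  case True
  then obtain n where n: "z0 / b = p powi n"
    using th_eq_0_iff[of "z0 / b"] b z0 by auto
  \<comment> \<open>\<open>V\<close> is \<open>th (z / b)\<close> with the zero at z0 split off:
    \<open>th0\<close> times the multiplier of -n shifts. Its value at z0 is a nonzero multiple of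
    E^2.\<close>
  define V where "V z = (-1) powi (-n) * p powi (-n * (-n - 1) div 2) * (z / b) powi (-n) * th0 (z / z0)" for z
  have V: "th (z / b) = (1 - z / z0) * V z" if "z \<noteq> 0" for z
  proof -
    have "z / b * p powi (-n) = z / z0"
      using n b z0 by (simp add: power_int_minus field_simps)
    thus ?thesis
      using th_shift_int[of "z / b" "-n"] that b th_eq[of "z / z0"] unfolding V_def by (simp add: mult_ac)
  qed
  have Vhol: "V holomorphic_on - {0}"
    unfolding V_def[abs_def] using b z0 by (intro holomorphic_intros) auto
  have V0: "V z0 \<noteq> 0"
    unfolding V_def using b z0 by simp
  define U where "U = {z \<in> - {0}. V z \<in> - {0}}"
  have "open U"
    unfolding U_def using continuous_open_preimage[OF holomorphic_on_imp_continuous_on[OF Vhol], of "- {0}"] by (simp add: vimage_def Int_def open_Compl)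
  define F where "F = (\<lambda>z. if z = z0 then deriv f z0 else (f z - f z0) / (z - z0))"
  have F: "F holomorphic_on - {0}"
    unfolding F_def by (intro pole_lemma_open f) auto
  have fF: "f z = (z - z0) * F z" for z
    using f(2)[OF z0 True] by (auto simp: F_def)
  have "(\<lambda>z. - z0 * F z / V z) holomorphic_on U"
    by (intro holomorphic_intros holomorphic_on_subset[OF F] holomorphic_on_subset[OF Vhol]) (auto simp: U_def)
  moreover have "f z = th (z / b) * (- z0 * F z / V z)" if "z \<in> U" for z
  proof -
    have "z \<noteq> 0" "V z \<noteq> 0" using that by (auto simp: U_def)
    moreover have "z - z0 = - ((1 - z / z0) * z0)" using z0 by (simp add: field_simps)
    ultimately show ?thesis unfolding V[OF \<open>z \<noteq> 0\<close>] fF by (simp only:) simp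
  qed
  moreover have "th (z / b) \<noteq> 0" if "z \<in> U - {z0}" for z
    using that z0 V[of z] by (simp add: U_def)
  ultimately show ?thesis
    using \<open>open U\<close> z0 V0 by (intro exI[of _ U] exI[of _ "\<lambda>z. - z0 * F z / V z"]) (auto simp: U_def)
qed

text \<open>The functional equation spreads the zero at b to all b p^n, which are exactly the zeros
  of th (z / b). The divisor has a multiplier of degree -1, so the exponent of the quotient rises
  from k to k + 1: each known zero uses up one degree.\<close>

lemma theta_divide:
  assumes f: "f holomorphic_on - {0}" and per: "\<And>z. z \<noteq> 0 \<Longrightarrow> f (p * z) = \<kappa> * z powi k * f z"
    and b: "b \<noteq> 0" "f b = 0" "\<kappa> \<noteq> 0"
  obtains g \<mu> where "g holomorphic_on - {0}" "\<And>z. z \<noteq> 0 \<Longrightarrow> f z = th (z / b) * g z" "\<mu> \<noteq> 0"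
    "\<And>z. z \<noteq> 0 \<Longrightarrow> g (p * z) = \<mu> * z powi (k + 1) * g z"
proof -
  have fz: "f (b * p powi n) = 0" for n
  proof (induction n rule: int_induct[of _ 0])
    case (step1 i)
    have "f (b * p powi (i + 1)) = f (p * (b * p powi i))" by (simp add: power_int_add mult_ac)
    thus ?case using per[of "b * p powi i"] step1 b by simp
  next
    case (step2 i)
    have "f (b * p powi i) = f (p * (b * p powi (i - 1)))" by (simp add: power_int_diff)
    thus ?case using per[of "b * p powi (i - 1)"] step2 b by simp
  qed (use b in simp)
  have fz': "f z = 0" if "z \<noteq> 0" "th (z / b) = 0" for z
  proof -
    have "\<exists>n::int. z / b = p powi n" using that b th_eq_0_iff[of "z / b"] by simp
    then obtain n :: int where "z / b = p powi n" by blast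
    hence "z = b * p powi n" using b by (simp add: field_simps)
    thus ?thesis using fz by simp
  qed
  have loc: "\<exists>U g. open U \<and> z0 \<in> U \<and> U \<subseteq> - {0} \<and> g holomorphic_on U \<and> (\<forall>z\<in>U. f z = th (z / b) * g z) \<and>
           (\<forall>z\<in>U - {z0}. th (z / b) \<noteq> 0)" if "z0 \<noteq> 0" for z0
    by (rule theta_zero_local[OF b(1) f _ that]) (rule fz')
  \<comment> \<open>Defining the quotient as a limit glues the local quotients together. Its
    functional equation is shown off the zeros of \<open>th\<close> and extended by
    continuity.\<close>
  define g where "g = (\<lambda>z. Lim (at z) (\<lambda>z. f z / th (z / b)))"
  have geq: "g z = h z" if h: "open U" "h holomorphic_on U" "\<And>z. z \<in> U \<Longrightarrow> f z = th (z / b) * h z"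
    "\<And>z. z \<in> U - {z0} \<Longrightarrow> th (z / b) \<noteq> 0" and z: "z \<in> U" for U h z0 z
  proof -
    have c: "(h \<longlongrightarrow> h z) (at z)"
      using h(1,2) z by (metis at_within_open continuous_on holomorphic_on_imp_continuous_on)
    have "eventually (\<lambda>w. w \<in> U - {z}) (at z)"
      using h(1) z by (intro eventually_at_in_open) auto
    moreover have "eventually (\<lambda>w. w \<noteq> z0) (at z)"
      by (rule eventually_neq_at_within)
    ultimately have "eventually (\<lambda>w. h w = f w / th (w / b)) (at z)"
      by eventually_elim (use h(3,4) in force)
    hence "((\<lambda>w. f w / th (w / b)) \<longlongrightarrow> h z) (at z)"
      using c by (simp add: filterlim_cong)
    thus ?thesis unfolding g_def by (intro tendsto_Lim) auto
  qed
  have g1: "g field_differentiable at z0" "f z0 = th (z0 / b) * g z0" "eventually (\<lambda>z. z \<noteq> 0 \<and> th (z / b) \<noteq> 0) (at z0)" if z0: "z0 \<noteq> 0" for z0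
  proof -
    obtain U h where h: "open U" "z0 \<in> U" "U \<subseteq> - {0}" "h holomorphic_on U" "\<And>z. z \<in> U \<Longrightarrow> f z = th (z / b) * h z"
      "\<And>z. z \<in> U - {z0} \<Longrightarrow> th (z / b) \<noteq> 0"
      using loc[OF z0] by blast
    have e: "g z = h z" if "z \<in> U" for z
      using geq[OF h(1,4,5,6) that] .
    have "g holomorphic_on U"
      using h(4) by (rule holomorphic_transform) (use e in auto)
    thus "g field_differentiable at z0"
      using h(1,2) by (rule holomorphic_on_imp_differentiable_at)
    show "f z0 = th (z0 / b) * g z0" using h(5)[OF h(2)] e[OF h(2)] by simp
    have "eventually (\<lambda>w. w \<in> U - {z0}) (at z0)"
      using h(1,2) by (intro eventually_at_in_open) auto
    thus "eventually (\<lambda>z. z \<noteq> 0 \<and> th (z / b) \<noteq> 0) (at z0)"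
      by eventually_elim (use h(3,6) in auto)
  qed
  have ghol: "g holomorphic_on - {0}"
    unfolding holomorphic_on_def using g1(1) field_differentiable_at_within by blast
  have gp: "g (p * z) = - (\<kappa> / b) * z powi (k + 1) * g z" if "z \<noteq> 0" "th (z / b) \<noteq> 0" for z
  proof -
    have t: "th (p * z / b) = - th (z / b) / (z / b)"
      using th_p[of "z / b"] that b by simp
    have "th (p * z / b) * g (p * z) = \<kappa> * z powi k * (th (z / b) * g z)"
      using g1(2)[of "p * z"] g1(2)[of z] per[of z] that by simp
    hence "- (b / z) * th (z / b) * g (p * z) = \<kappa> * z powi k * (th (z / b) * g z)"
      unfolding t by (simp add: mult_ac)
    hence "- (z / b) * (- (b / z) * th (z / b) * g (p * z)) = - (z / b) * (\<kappa> * z powi k * (th (z / b) * g z))"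
      by (simp only:)
    hence "th (z / b) * g (p * z) = th (z / b) * (- (\<kappa> / b) * z powi (k + 1) * g z)"
      using that b by (simp add: power_int_add mult_ac)
    thus ?thesis by (simp only: mult_left_cancel[OF that(2)])
  qed
  have "g (p * z) = - (\<kappa> / b) * z powi (k + 1) * g z" if "z \<noteq> 0" for z
  proof (rule tendsto_unique[OF trivial_limit_at])
    have gc: "isCont g w" if "w \<noteq> 0" for w
      using g1(1)[OF that] field_differentiable_imp_continuous_at by blast
    show "((\<lambda>w. g (p * w)) \<longlongrightarrow> g (p * z)) (at z)"
      by (rule isCont_tendsto_compose[OF gc]) (use that in \<open>auto intro!: tendsto_intros\<close>)
    have "((\<lambda>w. - (\<kappa> / b) * w powi (k + 1) * g w) \<longlongrightarrow> - (\<kappa> / b) * z powi (k + 1) * g z) (at z)"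
      using gc[OF that] that by (intro tendsto_intros tendsto_power_int) (auto simp: isCont_def)
    moreover have "eventually (\<lambda>w. g (p * w) = - (\<kappa> / b) * w powi (k + 1) * g w) (at z)"
      using g1(3)[OF that] by eventually_elim (use gp in auto)
    ultimately show "((\<lambda>w. g (p * w)) \<longlongrightarrow> - (\<kappa> / b) * z powi (k + 1) * g z) (at z)"
      by (simp add: filterlim_cong)
  qed
  thus ?thesis using that[of g "- (\<kappa> / b)"] ghol g1(2) b by auto
qed

text \<open>Two divisions turn the exponent -1 into 1, where
  \<open>quasiperiodic_degree_neg_eq_0\<close> applies. The condition on c / b says that the two
  zeros are inequivalent modulo powers of p, so the second one survives the first division.\<close>

lemma theta_degree1_eq_0:
  assumes "f holomorphic_on - {0}" "\<And>z. z \<noteq> 0 \<Longrightarrow> f (p * z) = \<kappa> * z powi (-1) * f z" "\<kappa> \<noteq> 0"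
    and "b \<noteq> 0" "c \<noteq> 0" "f b = 0" "f c = 0" "th (c / b) \<noteq> 0" "z \<noteq> 0"
  shows "f z = 0"
proof -
  obtain g \<nu> where g: "g holomorphic_on - {0}" "\<And>z. z \<noteq> 0 \<Longrightarrow> f z = th (z / b) * g z" "\<nu> \<noteq> 0"
    "\<And>z. z \<noteq> 0 \<Longrightarrow> g (p * z) = \<nu> * z powi (-1 + 1) * g z"
    using theta_divide[OF assms(1,2,4,6,3)] by blast
  have "g c = 0" using g(2)[of c] assms by simp
  obtain h \<mu> where h: "h holomorphic_on - {0}" "\<And>z. z \<noteq> 0 \<Longrightarrow> g z = th (z / c) * h z" "\<mu> \<noteq> 0"
    "\<And>z. z \<noteq> 0 \<Longrightarrow> h (p * z) = \<mu> * z powi (-1 + 1 + 1) * h z"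
    using theta_divide[OF g(1,4) \<open>c \<noteq> 0\<close> \<open>g c = 0\<close> g(3)] by blast
  have "h z = 0"
    by (rule quasiperiodic_degree_neg_eq_0[of "norm z + 1" h \<mu>])
       (use h assms in \<open>auto intro: holomorphic_on_subset add_nonneg_pos\<close>)
  thus ?thesis using g(2) h(2) assms by simp
qed

lemma theta_degree2_eq_0:
  assumes "f holomorphic_on - {0}" "\<And>z. z \<noteq> 0 \<Longrightarrow> f (p * z) = \<kappa> * z powi (-2) * f z" "\<kappa> \<noteq> 0"
    and "b \<noteq> 0" "c \<noteq> 0" "d \<noteq> 0" "f b = 0" "f c = 0" "f d = 0"
    and "th (c / b) \<noteq> 0" "th (d / b) \<noteq> 0" "th (d / c) \<noteq> 0" "z \<noteq> 0"
  shows "f z = 0"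
proof -
  obtain g \<nu> where g: "g holomorphic_on - {0}" "\<And>z. z \<noteq> 0 \<Longrightarrow> f z = th (z / b) * g z" "\<nu> \<noteq> 0"
    "\<And>z. z \<noteq> 0 \<Longrightarrow> g (p * z) = \<nu> * z powi (-2 + 1) * g z"
    using theta_divide[OF assms(1,2,4,7,3)] by blast
  have gcd: "g c = 0" "g d = 0"
    using g(2)[OF assms(5)] g(2)[OF assms(6)] assms(8,9,10,11) by auto
  have g4: "g (p * z) = \<nu> * z powi (-1) * g z" if "z \<noteq> 0" for z
    using g(4)[OF that] by (simp only:) simp
  have "g z = 0"
    by (rule theta_degree1_eq_0[OF g(1) g4 g(3) assms(5,6) gcd assms(12,13)])
  thus ?thesis using g(2) assms by simp
qed

section \<open>Theta function identities\<close>

lemma th_swap: "a \<noteq> 0 \<Longrightarrow> b \<noteq> 0 \<Longrightarrow> th (a / b) = - (a / b) * th (b / a)"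
  using th_inverse[of "b / a"] by simp

lemma th_p_mult: "x \<noteq> 0 \<Longrightarrow> c \<noteq> 0 \<Longrightarrow> th (p * x * c) = - th (x * c) / (x * c)"
  and th_p_divide: "x \<noteq> 0 \<Longrightarrow> c \<noteq> 0 \<Longrightarrow> th (p * x / c) = - (c / x) * th (x / c)"
  using th_p[of "x * c"] th_p[of "x / c"] by (simp_all add: mult.assoc)

text \<open>As functions of x, all three products have the multiplier x^(-2), whatever the other
  parameter. At each of x = y, v, u one product vanishes and the other two cancel, which gives the
  three zeros.\<close>

lemma weierstrass_three_term:
  assumes nz: "x \<noteq> 0" "y \<noteq> 0" "u \<noteq> 0" "v \<noteq> 0" and th: "th (v / y) \<noteq> 0" "th (u / y) \<noteq> 0" "th (u / v) \<noteq> 0"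
  shows "th (x * y) * th (x / y) * th (u * v) * th (u / v) - th (x * v) * th (x / v) * th (u * y) * th (u / y) =
           u / y * (th (y * v) * th (y / v) * th (x * u) * th (x / u))"
proof -
  define F where "F = (\<lambda>x. th (x * y) * th (x / y) * (th (u * v) * th (u / v)) - th (x * v) * th (x / v) * (th (u * y) * th (u / y)) -
     u / y * (th (y * v) * th (y / v) * (th (x * u) * th (x / u))))"
  have "F x = 0"
  proof (rule theta_degree2_eq_0[where f = F and z = x and b = y and c = v and d = u and \<kappa> = 1])
    show "F holomorphic_on - {0}"
      unfolding F_def using nz by (intro holomorphic_intros) auto
    show "F (p * x) = 1 * x powi (-2) * F x" if "x \<noteq> 0" for x
    proof -
      have "th (p * x * c) * th (p * x / c) = x powi (-2) * (th (x * c) * th (x / c))" if "c \<noteq> 0" for c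
        unfolding th_p_mult[OF \<open>x \<noteq> 0\<close> that] th_p_divide[OF \<open>x \<noteq> 0\<close> that]
        using that \<open>x \<noteq> 0\<close> by (simp add: power_int_minus field_simps power2_eq_square)
      note per = this
      show ?thesis
        unfolding F_def per[OF nz(2)] per[OF nz(3)] per[OF nz(4)] using nz by (simp add: algebra_simps)
    qed
    show "F y = 0"
      unfolding F_def using nz th_swap[of y u] by (simp add: mult_ac)
    show "F v = 0"
      unfolding F_def using nz th_swap[of v y] th_swap[of v u] by (simp add: mult_ac)
    show "F u = 0"
      unfolding F_def using nz by (simp add: mult_ac)
  qed (use nz th in auto)
  thus ?thesis by (simp add: F_def mult_ac)
qed

text \<open>The Euler operator a d/da is used because the logarithmic derivative
  \<open>thd a / th a\<close> merely drops by 1 under a -> p a.\<close>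

definition thd :: "complex \<Rightarrow> complex" where "thd a = a * deriv th a"

lemma th_has_field_derivative: "a \<noteq> 0 \<Longrightarrow> (th has_field_derivative deriv th a) (at a)"
proof -
  have "th holomorphic_on - {0}" by (intro holomorphic_intros) auto
  thus "a \<noteq> 0 \<Longrightarrow> (th has_field_derivative deriv th a) (at a)"
    by (intro holomorphic_derivI[of th "- {0}"]) auto
qed

lemma holomorphic_thd' [holomorphic_intros]:
  assumes "f holomorphic_on A" "\<And>z. z \<in> A \<Longrightarrow> f z \<noteq> 0"
  shows "(\<lambda>z. thd (f z)) holomorphic_on A"
proof -
  have "deriv th holomorphic_on - {0}" by (intro holomorphic_deriv holomorphic_intros) auto
  hence "(\<lambda>z. deriv th (f z)) holomorphic_on A"
    using holomorphic_on_compose_gen[OF assms(1), of "deriv th" "- {0}"] assms(2) by (force simp: o_def)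
  thus ?thesis unfolding thd_def by (intro holomorphic_intros assms)
qed

lemma thd_p: "a \<noteq> 0 \<Longrightarrow> thd (p * a) = - (thd a - th a) / a"
proof -
  assume a: "a \<noteq> 0"
  have d1: "((\<lambda>a. th (p * a)) has_field_derivative deriv th (p * a) * (p)) (at a)"
    by (rule DERIV_chain2[OF th_has_field_derivative]) (use a in \<open>auto intro!: derivative_eq_intros\<close>)
  have d2: "((\<lambda>a. - th a / a) has_field_derivative - ((deriv th a * a - th a) / (a * a))) (at a)"
    using a by (auto intro!: derivative_eq_intros th_has_field_derivative)
  have "eventually (\<lambda>a. a \<in> - {0}) (nhds a)"
    using a by (intro eventually_nhds_in_open) auto
  hence ev: "eventually (\<lambda>a. th (p * a) = - th a / a) (nhds a)"
    by eventually_elim (simp add: th_p)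
  have "deriv th (p * a) * (p) = - ((deriv th a * a - th a) / (a * a))"
    by (rule DERIV_unique[OF d1]) (subst DERIV_cong_ev[OF refl ev refl], rule d2)
  thus ?thesis using a by (simp add: thd_def field_simps)
qed

lemma thd_inverse: "a \<noteq> 0 \<Longrightarrow> thd (1 / a) = - (th a - thd a) / a"
proof -
  assume a: "a \<noteq> 0"
  have d1: "((\<lambda>a. th (1 / a)) has_field_derivative deriv th (1 / a) * (- (1 / (a * a)))) (at a)"
    by (rule DERIV_chain2[OF th_has_field_derivative]) (use a in \<open>auto intro!: derivative_eq_intros\<close>)
  have d2: "((\<lambda>a. - th a / a) has_field_derivative - ((deriv th a * a - th a) / (a * a))) (at a)"
    using a by (auto intro!: derivative_eq_intros th_has_field_derivative)
  have "eventually (\<lambda>a. a \<in> - {0}) (nhds a)"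
    using a by (intro eventually_nhds_in_open) auto
  hence ev: "eventually (\<lambda>a. th (1 / a) = - th a / a) (nhds a)"
    by eventually_elim (simp add: th_inverse)
  have "deriv th (1 / a) * (- (1 / (a * a))) = - ((deriv th a * a - th a) / (a * a))"
    by (rule DERIV_unique[OF d1]) (subst DERIV_cong_ev[OF refl ev refl], rule d2)
  thus ?thesis using a by (simp add: thd_def field_simps)
qed

lemma th0_has_field_derivative: "a \<noteq> 0 \<Longrightarrow> (th0 has_field_derivative deriv th0 a) (at a)"
proof -
  have "th0 holomorphic_on - {0}" by (intro holomorphic_intros) auto
  thus "a \<noteq> 0 \<Longrightarrow> (th0 has_field_derivative deriv th0 a) (at a)"
    by (intro holomorphic_derivI[of th0 "- {0}"]) auto
qed

lemma thd_1 [simp]: "thd 1 = - E\<^sup>2"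
proof -
  have "((\<lambda>a. (1 - a) * th0 a) has_field_derivative - th0 1) (at 1)"
    by (auto intro!: derivative_eq_intros th0_has_field_derivative)
  hence "(th has_field_derivative - th0 1) (at 1)"
    unfolding th_eq[abs_def, symmetric] by simp
  thus ?thesis
    by (simp add: thd_def DERIV_imp_deriv)
qed

text \<open>\<open>th0\<close> is invariant under a -> 1 / a, so its derivative at the fixed point 1
  equals its own negative. This removes the derivative of the term split off in the degenerate
  Lambert relation.\<close>

lemma deriv_th0_1: "deriv th0 1 = 0"
proof -
  have inv: "(\<lambda>a. th0 (1 / a)) = th0"
    by (simp add: fun_eq_iff th0_def mult.commute)
  have "((\<lambda>a. th0 (1 / a)) has_field_derivative deriv th0 (1 / 1) * (- 1)) (at 1)"
    by (rule DERIV_chain2[OF th0_has_field_derivative]) (auto intro!: derivative_eq_intros)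
  hence "(th0 has_field_derivative - deriv th0 1) (at 1)"
    unfolding inv by simp
  hence "- deriv th0 1 = deriv th0 1"
    by (rule DERIV_unique) (rule th0_has_field_derivative[OF one_neq_zero])
  hence "deriv th0 1 + deriv th0 1 = 0"
    by (metis add.left_inverse)
  thus ?thesis by (simp flip: mult_2)
qed

text \<open>The multiplicative form of the classical formula expressing zeta(u) + zeta(v) + zeta(w)
  - zeta(u + v + w) by sigma functions, cleared of denominators. In u the multiplier is u^(-2) / (v
  w), and u = 1, 1 / v, 1 / (v w) are zeros.\<close>

lemma logderiv_four_term:
  assumes nz: "u \<noteq> 0" "v \<noteq> 0" "w \<noteq> 0" and th: "th v \<noteq> 0" "th w \<noteq> 0" "th (v * w) \<noteq> 0"
  shows "(thd u * th (u * v * w) - th u * thd (u * v * w)) * (th v * th w) +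
         (thd v * th w + th v * thd w - th v * th w) * (th u * th (u * v * w)) +
         E\<^sup>2 * (th (u * v) * th (v * w) * th (u * w)) = 0"
proof -
  define F where "F = (\<lambda>u. (thd u * th (u * (v * w)) - th u * thd (u * (v * w))) * (th v * th w) +
         (thd v * th w + th v * thd w - th v * th w) * (th u * th (u * (v * w))) +
         E\<^sup>2 * (th (u * v) * th (v * w) * th (u * w)))"
  have "F u = 0"
  proof (rule theta_degree2_eq_0[where f = F and z = u and b = 1 and c = "1 / v" and d = "1 / (v * w)" and \<kappa> = "1 / (v * w)"])
    show "F holomorphic_on - {0}"
      unfolding F_def using nz by (intro holomorphic_intros) auto
    show "F (p * u) = 1 / (v * w) * u powi (-2) * F u" if u: "u \<noteq> 0" for u
    proof -
      have e: "th (p * u) = - th u / u" "thd (p * u) = - (thd u - th u) / u"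
        using th_p thd_p u by auto
      have e': "th (p * u * c) = - th (u * c) / (u * c)" "thd (p * u * c) = - (thd (u * c) - th (u * c)) / (u * c)" if "c \<noteq> 0" for c
        using th_p[of "u * c"] thd_p[of "u * c"] that u by (simp_all add: mult.assoc)
      have vw: "v * w \<noteq> 0" using nz by simp
      show ?thesis
        unfolding F_def e e'[OF vw] e'[OF nz(2)] e'[OF nz(3)] using u nz
        by (simp add: power_int_minus divide_simps power2_eq_square) (simp add: algebra_simps)
    qed
    show "F 1 = 0" unfolding F_def by (simp add: algebra_simps)
    show "F (1 / v) = 0"
    proof -
      have "1 / v * (v * w) = w" "1 / v * v = 1"
        using nz by auto
      hence "F (1 / v) = (thd (1 / v) * th w - th (1 / v) * thd w) * (th v * th w) +
         (thd v * th w + th v * thd w - th v * th w) * (th (1 / v) * th w)"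
        unfolding F_def by simp
      also have "\<dots> = 0"
        unfolding thd_inverse[OF nz(2)] th_inverse[OF nz(2)] using nz
        by (simp add: divide_simps) (simp add: algebra_simps)
      finally show ?thesis .
    qed
    show "F (1 / (v * w)) = 0"
    proof -
      have "1 / (v * w) * (v * w) = 1" "1 / (v * w) * v = 1 / w" "1 / (v * w) * w = 1 / v"
        using nz by auto
      hence "F (1 / (v * w)) = th (1 / (v * w)) * E\<^sup>2 * (th v * th w) + E\<^sup>2 * (th (1 / w) * th (v * w) * th (1 / v))"
        unfolding F_def by simp
      also have "\<dots> = 0"
        using nz th_inverse[of "v * w"] by (simp add: th_inverse[OF nz(2)] th_inverse[OF nz(3)])
      finally show ?thesis .
    qed
    show "th (1 / v / 1) \<noteq> 0" "th (1 / (v * w) / 1) \<noteq> 0" "th (1 / (v * w) / (1 / v)) \<noteq> 0"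
      using nz th th_inverse[of v] th_inverse[of "v * w"] th_inverse[of w] by simp_all
  qed (use nz in auto)
  thus ?thesis by (simp add: F_def mult_ac)
qed

text \<open>Under a \<rightarrow> p a, the inhomogeneous terms of the three Lambert sums cancel
  precisely because of the choice of \<gamma>; the two sides also agree at a = t and a = 1/t.\<close>

lemma lambert_three_term_regularized:
  assumes r: "r * r = p" and t: "t \<noteq> 0" and a: "a \<noteq> 0" and t2: "th (t\<^sup>2) \<noteq> 0"
    and \<gamma>: "\<gamma> * tau r = t * tau (r * t\<^sup>2) + tau (r / t\<^sup>2)"
  shows "t * th (r * t) * (t * (th a * th (a / t)) * SR (r * t\<^sup>2) (a * t) + th a * th (a * t) * SR (r / t\<^sup>2) (a / t)
      - \<gamma> * (th (a * t) * th (a / t)) * SR r a) = a * E\<^sup>2 * (th t * th (t\<^sup>2) * th (a * r))"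
proof -
  have r0: "r \<noteq> 0" using r p_nz by auto
  have th_rt: "th (r / t) = th (r * t)"
    using th_reflect[of "r * t"] r0 t by (simp flip: r)
  define F where "F = (\<lambda>a. t * th (r * t) * (t * (th a * th (a / t)) * SR (r * t\<^sup>2) (a * t) + th a * th (a * t) * SR (r / t\<^sup>2) (a / t)
      - \<gamma> * (th (a * t) * th (a / t)) * SR r a) - a * E\<^sup>2 * (th t * th (t\<^sup>2) * th (a * r)))"
  have "F a = 0"
  proof (rule theta_degree1_eq_0[where f = F and z = a and b = t and c = "1 / t" and \<kappa> = "- r"])
    show "F holomorphic_on - {0}"
      unfolding F_def using t r0 by (intro holomorphic_intros) auto
    show "F (p * a) = - r * a powi (-1) * F a" if a: "a \<noteq> 0" for a
    proof -
      have e: "th (p * a) = - th a / a" "th (p * a / t) = - (t / a) * th (a / t)" "th (p * a * t) = - th (a * t) / (a * t)"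
          "th (p * a * r) = - th (a * r) / (a * r)"
        using th_p[OF a] th_p_mult[OF a t] th_p_divide[OF a t] th_p_mult[OF a r0] by auto
      \<comment> \<open>Because r^2 = p, shift and inversion bring every theta series arising from
        \<open>SR_p\<close> back to \<open>tau (r * t\<^sup>2)\<close>,
        \<open>tau (r / t\<^sup>2)\<close> and \<open>tau r\<close>.\<close>
      have t1: "tau (r * t\<^sup>2 / p\<^sup>2) = t\<^sup>2 / r * tau (r * t\<^sup>2)"
        using tau_shift[of "r * t\<^sup>2 / p\<^sup>2"] r0 t by (simp add: field_simps power2_eq_square flip: r)
      have t2: "tau (r / t\<^sup>2 / p\<^sup>2) = 1 / (r * t\<^sup>2) * tau (r / t\<^sup>2)"
        using tau_shift[of "r / t\<^sup>2 / p\<^sup>2"] r0 t by (simp add: field_simps power2_eq_square flip: r)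
      have t3: "tau (r / p\<^sup>2) = 1 / r * tau r"
        using tau_shift[of "r / p\<^sup>2"] r0 t by (simp add: field_simps power2_eq_square flip: r)
      have t4: "tau (r * t\<^sup>2 / p) = tau (r / t\<^sup>2)" "tau (r / t\<^sup>2 / p) = tau (r * t\<^sup>2)" "tau (r / p) = tau r"
        using tau_inverse[of "r / t\<^sup>2"] tau_inverse[of "r * t\<^sup>2"] tau_inverse[of r] r0 t by (simp_all add: field_simps flip: r)
      have S1: "SR (r * t\<^sup>2) (p * a * t) = - (r / (a * t ^ 3)) * (a\<^sup>2 * t\<^sup>2 * SR (r * t\<^sup>2) (a * t) + th (a * t) * (t\<^sup>2 / r * tau (r * t\<^sup>2) + a * t * tau (r / t\<^sup>2)))"
      proof -
        have "- p / (a * t * (r * t\<^sup>2)) = - (r / (a * t ^ 3))"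
          using r0 t a by (simp add: field_simps power2_eq_square power3_eq_cube flip: r)
        thus ?thesis using SR_p[of "r * t\<^sup>2" "a * t"] r0 t a unfolding t1 t4 by (simp add: mult.assoc power_mult_distrib)
      qed
      have S2: "SR (r / t\<^sup>2) (p * a / t) = - (r * t ^ 3 / a) * (a\<^sup>2 / t\<^sup>2 * SR (r / t\<^sup>2) (a / t) + th (a / t) * (1 / (r * t\<^sup>2) * tau (r / t\<^sup>2) + a / t * tau (r * t\<^sup>2)))"
      proof -
        have "- p / (a / t * (r / t\<^sup>2)) = - (r * t ^ 3 / a)"
          using r0 t a by (simp add: field_simps power2_eq_square power3_eq_cube flip: r)
        thus ?thesis using SR_p[of "r / t\<^sup>2" "a / t"] r0 t a unfolding t2 t4 by (simp add: power_divide)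
      qed
      have S3: "SR r (p * a) = - (r / a) * (a\<^sup>2 * SR r a + th a * (1 / r * tau r + a * tau r))"
      proof -
        have "- p / (a * r) = - (r / a)"
          using r0 a by (simp add: field_simps flip: r)
        thus ?thesis using SR_p[of r a] r0 a unfolding t3 t4 by simp
      qed
      have "F (p * a) - - r * a powi (-1) * F a = - (r / a ^ 3) * t * th (r * t) * (th a * th (a / t) * th (a * t)) * (1 / r + a) *
              (t * tau (r * t\<^sup>2) + tau (r / t\<^sup>2) - \<gamma> * tau r)"
      proof -
        define X where "X = th (r * t)"
        define K where "K = E\<^sup>2 * (th t * th (t\<^sup>2) * th (a * r))"
        have K1: "p * a * E\<^sup>2 * (th t * th (t\<^sup>2) * (- th (a * r) / (a * r))) = - r * K"
          using r0 a by (simp add: K_def field_simps flip: r)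
        have K2: "a * E\<^sup>2 * (th t * th (t\<^sup>2) * th (a * r)) = a * K"
          by (simp add: K_def)
        show ?thesis
          unfolding F_def e S1 S2 S3 K1 K2 X_def[symmetric] using r0 t a
          by (simp add: divide_simps power_int_minus power2_eq_square power3_eq_cube) (simp add: algebra_simps)
      qed
      hence "F (p * a) - - r * a powi (-1) * F a = 0" using \<gamma> by (simp only:) simp
      thus ?thesis by (simp only: right_minus_eq)
    qed
    have tt: "t / (1 / t) = t\<^sup>2" "t * t = t\<^sup>2" "1 / t / t = 1 / t\<^sup>2" "1 / t * t = 1" "1 / t * r = r / t"
      using t by (simp_all add: power2_eq_square)
    \<comment> \<open>At a = t and at a = 1 / t one theta factor kills two of the Lambert sums, and
      the surviving one is taken at 1, where it equals E^2.\<close>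
    show "F t = 0"
      unfolding F_def using t by (simp add: SR_1 mult_ac flip: power2_eq_square)
    show "F (1 / t) = 0"
    proof -
      have i2: "th (1 / t\<^sup>2) = - th (t\<^sup>2) / t\<^sup>2" using t th_inverse[of "t\<^sup>2"] by simp
      show ?thesis
        unfolding F_def tt th_rt th_inverse[OF t] SR_1 i2 using t
        by (simp add: field_simps power2_eq_square)
    qed
    show "th (1 / t / t) \<noteq> 0"
      using t t2 th_inverse[of "t\<^sup>2"] by (simp add: tt)
  qed (use t r0 a in auto)
  thus ?thesis by (simp add: F_def)
qed

text \<open>The case a = 1 of the three-term relation: \<open>th 1\<close> kills two of the Lambert
  sums, and the third is E^2. It expresses a quotient of theta series by products.\<close>

lemma tau_ratio:
  assumes r: "r * r = p" and t: "t \<noteq> 0" and th: "th t \<noteq> 0" "th (t\<^sup>2) \<noteq> 0"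
    and \<gamma>: "\<gamma> * tau r = t * tau (r * t\<^sup>2) + tau (r / t\<^sup>2)"
  shows "\<gamma> * (th t * th (r * t)) = th (t\<^sup>2) * th r"
proof -
  have "E\<^sup>2 * th t * (\<gamma> * (th t * th (r * t))) = E\<^sup>2 * th t * (th (t\<^sup>2) * th r)"
    using lambert_three_term_regularized[OF r t one_neq_zero th(2) \<gamma>] t
    by (simp add: SR_1 th_inverse field_simps)
  thus ?thesis using th by simp
qed

lemma lambert_three_term:
  assumes r: "r * r = p" and t: "t \<noteq> 0" and a: "a \<noteq> 0"
    and th: "th (t\<^sup>2) \<noteq> 0" "th (r * t) \<noteq> 0" "th a \<noteq> 0" "th (a * t) \<noteq> 0" "th (a / t) \<noteq> 0"
    and \<gamma>: "\<gamma> * tau r = t * tau (r * t\<^sup>2) + tau (r / t\<^sup>2)"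
  shows "t * S (r * t\<^sup>2) (a * t) + S (r / t\<^sup>2) (a / t) - \<gamma> * S r a =
     a / t * (E\<^sup>2 * (th t * th (t\<^sup>2) * th (a * r)) / (th (r * t) * th a * th (a * t) * th (a / t)))"
proof -
  define P where "P = t * th (r * t) * (th a * th (a * t) * th (a / t))"
  have P: "P \<noteq> 0" using t th by (simp add: P_def)
  have "P * (t * S (r * t\<^sup>2) (a * t) + S (r / t\<^sup>2) (a / t) - \<gamma> * S r a) = a * E\<^sup>2 * (th t * th (t\<^sup>2) * th (a * r))"
    using lambert_three_term_regularized[OF r t a th(1) \<gamma>] a t th
    by (simp add: SR_eq P_def algebra_simps)
  hence "t * S (r * t\<^sup>2) (a * t) + S (r / t\<^sup>2) (a / t) - \<gamma> * S r a = a * E\<^sup>2 * (th t * th (t\<^sup>2) * th (a * r)) / P"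
    using P by (simp add: field_simps)
  also have "\<dots> = a / t * (E\<^sup>2 * (th t * th (t\<^sup>2) * th (a * r)) / (th (r * t) * th a * th (a * t) * th (a / t)))"
    by (simp add: P_def mult_ac)
  finally show ?thesis .
qed

text \<open>The term n = 0 is the only one singular at s = 1. Split off, it contributes
  \<open>th0 s\<close> to \<open>SR w s\<close>, and the remaining sum is continuous at 1.\<close>

lemma punctured_S_continuous:
  assumes "w \<noteq> 0"
  shows "isCont (\<lambda>s. \<Sum>\<^sub>\<infinity>n\<in>UNIV-{0::int}. p powi (n\<^sup>2) * w powi n / (1 - s * p powi n)) 1"
    and "eventually (\<lambda>s. SR w s = th0 s + th s * (\<Sum>\<^sub>\<infinity>n\<in>UNIV-{0::int}. p powi (n\<^sup>2) * w powi n / (1 - s * p powi n))) (nhds 1)"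
proof -
  define c where "c = sqrt (norm p)"
  have c: "0 < c" "c < 1" "norm p = c * c"
    by (auto simp: c_def)
  \<comment> \<open>With c the square root of |p|, this annulus stays away from all powers of p
    other than 1: the denominators with n nonzero are bounded below by 1 - c.\<close>
  define A where "A = {s :: complex. c < norm s \<and> norm s < 1 / c}"
  have "open A"
    unfolding A_def by (intro open_Collect_conj open_Collect_less continuous_intros)
  have A1: "1 \<in> A" using c by (auto simp: A_def)
  have bound: "norm (1 - s * p powi n) \<ge> 1 - c" if "s \<in> A" "n \<noteq> 0" for s n
  proof (cases "n > 0")
    case True
    then obtain m where m: "n = int (Suc m)" by (metis gr0_implies_Suc zero_less_imp_eq_int)
    have "norm p ^ m \<le> 1" by (intro power_le_one) (auto simp: less_imp_le)
    hence "norm p * norm p ^ m \<le> norm p * 1" by (intro mult_left_mono) auto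
    hence "norm (s * p powi n) \<le> norm s * norm p"
      by (simp add: m norm_mult norm_power mult_left_mono del: of_nat_Suc)
    also have "\<dots> \<le> 1 / c * norm p" using that by (intro mult_right_mono) (auto simp: A_def)
    also have "\<dots> = c" using c by simp
    finally show ?thesis using norm_triangle_ineq2[of 1 "s * p powi n"] by simp
  next
    case False
    with that obtain m where m: "n = - int (Suc m)"
      by (metis gr0_implies_Suc linorder_neqE_linordered_idom neg_less_0_iff_less zero_less_imp_eq_int minus_minus)
    have "norm p ^ m \<le> 1" by (intro power_le_one) (auto simp: less_imp_le)
    hence "norm p * norm p ^ m \<le> norm p * 1" by (intro mult_left_mono) auto
    hence pm: "norm p ^ Suc m \<le> c * c" using c by simp
    have "1 / c = c / (c * c)" using c by simp
    also have "\<dots> \<le> norm s / norm p ^ Suc m"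
      using that c pm by (intro frac_le) (auto simp: A_def)
    also have "\<dots> = norm (s * p powi n)"
      by (simp add: m norm_mult norm_power power_int_minus norm_inverse divide_inverse del: of_nat_Suc)
    finally have "norm (s * p powi n) \<ge> 1 / c" .
    \<comment> \<open>Arithmetic and geometric mean: c + 1 / c is at least 2.\<close>
    moreover have "1 / c \<ge> 2 - c"
    proof -
      have "0 \<le> (1 - c) * (1 - c)" by simp
      thus ?thesis using c by (simp add: field_simps)
    qed
    ultimately show ?thesis using norm_triangle_ineq2[of "s * p powi n" 1] by (simp add: norm_minus_commute)
  qed
  hence nz: "1 - s * p powi n \<noteq> 0" if "s \<in> A" "n \<noteq> 0" for s n
    using bound[OF that] c by auto
  have "continuous_on A (\<lambda>s. \<Sum>\<^sub>\<infinity>n\<in>UNIV-{0::int}. p powi (n\<^sup>2) * w powi n / (1 - s * p powi n))"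
  proof (rule continuous_on_infsum)
    show "(\<lambda>n. norm (p powi (n\<^sup>2) * w powi n) * (1 / (1 - c))) summable_on UNIV - {0::int}"
      by (intro summable_on_cmult_left summable_on_subset_banach[OF abs_summable_tau[OF assms]]) auto
    show "continuous_on A (\<lambda>s. p powi (n\<^sup>2) * w powi n / (1 - s * p powi n))" if "n \<in> UNIV - {0}" for n :: int
      using nz that by (intro continuous_intros) auto
    show "norm (p powi (n\<^sup>2) * w powi n / (1 - s * p powi n)) \<le> norm (p powi (n\<^sup>2) * w powi n) * (1 / (1 - c))"
      if "n \<in> UNIV - {0}" "s \<in> A" for n :: int and s
      unfolding norm_divide using bound[of s n] that c
      by (simp add: divide_inverse mult_left_mono le_imp_inverse_le)
  qed
  thus "isCont (\<lambda>s. \<Sum>\<^sub>\<infinity>n\<in>UNIV-{0::int}. p powi (n\<^sup>2) * w powi n / (1 - s * p powi n)) 1"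
    using \<open>open A\<close> A1 continuous_on_eq_continuous_at by blast
  have "SR w s = th0 s + th s * (\<Sum>\<^sub>\<infinity>n\<in>UNIV-{0::int}. p powi (n\<^sup>2) * w powi n / (1 - s * p powi n))" if s: "s \<in> A" for s
  proof -
    have s0: "s \<noteq> 0" using s c by (auto simp: A_def)
    have "SR w s = (\<Sum>\<^sub>\<infinity>n\<in>insert 0 (UNIV-{0}). p powi (n\<^sup>2) * w powi n * thn n s)"
      unfolding SR_def by (rule infsum_cong_neutral) auto
    also have "\<dots> = th0 s + (\<Sum>\<^sub>\<infinity>n\<in>UNIV-{0}. p powi (n\<^sup>2) * w powi n * thn n s)"
      by (subst infsum_insert) (auto intro: summable_on_subset_banach[OF summable_SR[OF assms s0]])
    also have "(\<Sum>\<^sub>\<infinity>n\<in>UNIV-{0}. p powi (n\<^sup>2) * w powi n * thn n s) =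
      (\<Sum>\<^sub>\<infinity>n\<in>UNIV-{0}. th s * (p powi (n\<^sup>2) * w powi n / (1 - s * p powi n)))"
    proof (rule infsum_cong)
      fix n :: int assume "n \<in> UNIV - {0}"
      hence "thn n s = th s / (1 - s * p powi n)"
        using thn_mult[OF s0, of n] nz[OF s, of n] by (simp add: nonzero_eq_divide_eq mult.commute)
      thus "p powi (n\<^sup>2) * w powi n * thn n s = th s * (p powi (n\<^sup>2) * w powi n / (1 - s * p powi n))"
        by simp
    qed
    also have "\<dots> = th s * (\<Sum>\<^sub>\<infinity>n\<in>UNIV-{0}. p powi (n\<^sup>2) * w powi n / (1 - s * p powi n))"
      by (rule infsum_cmult_right')
    finally show ?thesis .
  qed
  moreover have "eventually (\<lambda>s. s \<in> A) (nhds 1)"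
    using \<open>open A\<close> A1 by (rule eventually_nhds_in_open)
  ultimately show "eventually (\<lambda>s. SR w s = th0 s + th s * (\<Sum>\<^sub>\<infinity>n\<in>UNIV-{0::int}. p powi (n\<^sup>2) * w powi n / (1 - s * p powi n))) (nhds 1)"
    by (auto elim: eventually_mono)
qed

text \<open>The limit a \<rightarrow> t of the three-term relation. Both sides of its regularized form
  vanish there, so derivatives are compared; S' is the Lambert sum without its singular term.\<close>

lemma lambert_three_term_degenerate:
  assumes r: "r * r = p" and t: "t \<noteq> 0" and th: "th t \<noteq> 0" "th (t\<^sup>2) \<noteq> 0" "th (r * t) \<noteq> 0"
    and \<gamma>: "\<gamma> * tau r = t * tau (r * t\<^sup>2) + tau (r / t\<^sup>2)"
  shows "t * S (r * t\<^sup>2) (t\<^sup>2) + S (r / t\<^sup>2) 1 - \<gamma> * S r t =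
     thd t / th t + thd (t\<^sup>2) / th (t\<^sup>2) - thd (r * t) / th (r * t) - 1"
proof -
  have r0: "r \<noteq> 0" using r p_nz by auto
  define w where "w = r / t\<^sup>2"
  have w: "w \<noteq> 0" using r0 t by (simp add: w_def)
  define S' where "S' = (\<lambda>s. \<Sum>\<^sub>\<infinity>n\<in>UNIV-{0::int}. p powi (n\<^sup>2) * w powi n / (1 - s * p powi n))"
  have S'1: "S' 1 = S w 1"
    unfolding S'_def S_def by (rule infsum_cong_neutral) auto
  define g where "g = (\<lambda>s. th (r * t) * (t * th (s * t) * SR (r * t\<^sup>2) (s * t\<^sup>2) + th (s * t) * th (s * t\<^sup>2) * S' s - \<gamma> * th (s * t\<^sup>2) * SR r (s * t)))"
  define \<Phi> where "\<Phi> = (\<lambda>s. th (r * t) * th (s * t) * th (s * t\<^sup>2) * th0 s - s * E\<^sup>2 * (th t * th (t\<^sup>2)) * th (s * (r * t)))"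
  have "eventually (\<lambda>s::complex. s \<in> - {0}) (nhds 1)"
    by (rule eventually_nhds_in_open) auto
  \<comment> \<open>\<open>g\<close> collects the Lambert sums and \<Phi> the elementary terms of
    the relation at a = s t; the wanted value is \<open>g 1\<close>.\<close>
  hence ev: "eventually (\<lambda>s. th s * g s = - \<Phi> s) (nhds 1)"
    using punctured_S_continuous(2)[OF w]
  proof eventually_elim
    case (elim s)
    hence s: "s \<noteq> 0" by simp
    have e: "s * t / t = s" "s * t * t = s * t\<^sup>2" "s * t * r = s * (r * t)"
      using t by (simp_all add: power2_eq_square mult_ac)
    have e2: "SR w s = th0 s + th s * S' s"
      using elim(2) by (simp only: S'_def)
    have "t * (th (r * t) * (t * (th (s * t) * th s) * SR (r * t\<^sup>2) (s * t\<^sup>2) + th (s * t) * th (s * t\<^sup>2) * (th0 s + th s * S' s)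
      - \<gamma> * (th (s * t\<^sup>2) * th s) * SR r (s * t))) = t * (s * E\<^sup>2 * (th t * th (t\<^sup>2) * th (s * (r * t))))"
      using lambert_three_term_regularized[OF r t _ th(2) \<gamma>, of "s * t"] s t
      unfolding e w_def[symmetric] e2 by (simp add: mult_ac)
    hence "th (r * t) * (t * (th (s * t) * th s) * SR (r * t\<^sup>2) (s * t\<^sup>2) + th (s * t) * th (s * t\<^sup>2) * (th0 s + th s * S' s)
      - \<gamma> * (th (s * t\<^sup>2) * th s) * SR r (s * t)) = s * E\<^sup>2 * (th t * th (t\<^sup>2) * th (s * (r * t)))"
      using t by simp
    thus ?case unfolding g_def \<Phi>_def by (simp add: algebra_simps)
  qed
  have cont: "isCont g 1"
  proof -
    have h: "isCont f 1" if "f holomorphic_on - {0}" for f :: "complex \<Rightarrow> complex"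
      using that by (metis ComplI continuous_on_eq_continuous_at holomorphic_on_imp_continuous_on open_Compl closed_singleton singletonD one_neq_zero)
    have "isCont (\<lambda>s. th (s * c)) 1" "isCont (\<lambda>s. SR v (s * c)) 1" if "c \<noteq> 0" "v \<noteq> 0" for c v
      using that by (intro h holomorphic_intros; auto)+
    moreover have "isCont S' 1"
      unfolding S'_def using punctured_S_continuous(1)[OF w] .
    ultimately show ?thesis
      unfolding g_def using t r0 by (intro continuous_intros) auto
  qed
  \<comment> \<open>For \<open>g\<close> only continuity at 1 has been established, so the product
    is differentiated through Caratheodory's form of the derivative of \<open>th\<close>, using that
    \<open>th 1\<close> is 0.\<close>
  have "(th has_field_derivative - E\<^sup>2) (at 1)"
    using th_has_field_derivative[of 1] thd_1 by (simp add: thd_def)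
  then obtain h where h: "\<And>z. th z - th 1 = h z * (z - 1)" "isCont h 1" "h 1 = - E\<^sup>2"
    unfolding CARAT_DERIV by blast
  have "((\<lambda>s. th s * g s) has_field_derivative - E\<^sup>2 * g 1) (at 1)"
    unfolding CARAT_DERIV using h cont by (intro exI[of _ "\<lambda>z. h z * g z"]) (auto simp: mult_ac)
  hence d1: "((\<lambda>s. - \<Phi> s) has_field_derivative - E\<^sup>2 * g 1) (at 1)"
    by (subst (asm) DERIV_cong_ev[OF refl ev refl])
  have dth: "((\<lambda>s. th (s * c)) has_field_derivative thd c) (at 1)" if "c \<noteq> 0" for c
    unfolding thd_def mult.commute[of c]
    by (rule DERIV_chain2[of th _ "\<lambda>s. s * c"]) (use that th_has_field_derivative[of c] in \<open>auto intro!: derivative_eq_intros\<close>)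
  have "((\<lambda>s. - \<Phi> s) has_field_derivative - (th (r * t) * (thd t * th (t\<^sup>2) + th t * thd (t\<^sup>2)) * E\<^sup>2 -
      (E\<^sup>2 * (th t * th (t\<^sup>2)) * th (r * t) + E\<^sup>2 * (th t * th (t\<^sup>2)) * thd (r * t)))) (at 1)"
    unfolding \<Phi>_def using t r0
    by (auto intro!: derivative_eq_intros dth th0_has_field_derivative simp: deriv_th0_1 algebra_simps)
  from DERIV_unique[OF d1 this]
  have "E\<^sup>2 * g 1 = E\<^sup>2 * (th (r * t) * (thd t * th (t\<^sup>2) + th t * thd (t\<^sup>2)) - (th t * th (t\<^sup>2)) * th (r * t) - (th t * th (t\<^sup>2)) * thd (r * t))"
    by (simp add: algebra_simps)
  hence "g 1 = th (r * t) * (thd t * th (t\<^sup>2) + th t * thd (t\<^sup>2)) - (th t * th (t\<^sup>2)) * th (r * t) - (th t * th (t\<^sup>2)) * thd (r * t)"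
    by simp
  moreover have "g 1 = th (r * t) * th t * th (t\<^sup>2) * (t * S (r * t\<^sup>2) (t\<^sup>2) + S w 1 - \<gamma> * S r t)"
    unfolding g_def S'1 using t th by (simp add: SR_eq algebra_simps)
  moreover have "th (r * t) * (thd t * th (t\<^sup>2) + th t * thd (t\<^sup>2)) - (th t * th (t\<^sup>2)) * th (r * t) - (th t * th (t\<^sup>2)) * thd (r * t) =
     th (r * t) * th t * th (t\<^sup>2) * (thd t / th t + thd (t\<^sup>2) / th (t\<^sup>2) - thd (r * t) / th (r * t) - 1)"
    using th by (simp add: field_simps)
  ultimately have "th (r * t) * th t * th (t\<^sup>2) * (t * S (r * t\<^sup>2) (t\<^sup>2) + S w 1 - \<gamma> * S r t) =
     th (r * t) * th t * th (t\<^sup>2) * (thd t / th t + thd (t\<^sup>2) / th (t\<^sup>2) - thd (r * t) / th (r * t) - 1)"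
    by (simp only:)
  thus ?thesis using th by (simp add: w_def)
qed

end

section \<open>The rank series as a Lambert sum\<close>

lemma sums_Suc_diff: "f sums s \<Longrightarrow> (\<lambda>n. f (Suc n)) sums (s - f 0)" for s :: complex
  by (subst sums_Suc_iff) simp

context nome
begin

text \<open>For p = q^2 and x = -q, dividing by rank_term x z 0 turns rank_term x z m into the generating
  function of the partitions with parts at most 2m, in which every part contributes 1/z.\<close>

definition rank_term :: "complex \<Rightarrow> complex \<Rightarrow> nat \<Rightarrow> complex" where
  "rank_term x z m = (\<Prod>k<m. 1 - x / z * p ^ k) * qp (p ^ Suc m / z) p"

text \<open>Two values of c matter: c = 1 obeys a closed difference equation in z but is summed only
  for |z| < 1, while c = p is the sum that the rank series needs on |z| = 1.\<close>

definition rank_sum :: "complex \<Rightarrow> complex \<Rightarrow> complex \<Rightarrow> complex" where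
  "rank_sum x c z = (\<Sum>\<^sub>\<infinity>m. (c * z) ^ m * rank_term x z m)"

lemma rank_term_bound:
  assumes "\<delta> > 0"
  shows "\<exists>B. \<forall>z m. \<delta> \<le> norm z \<longrightarrow> norm (rank_term x z m) \<le> B"
proof -
  have "compact ((\<lambda>a. qp a p) ` cball 0 (1 / \<delta>))"
    by (intro compact_continuous_image holomorphic_on_imp_continuous_on holomorphic_qp) auto
  then obtain T where T: "\<And>a. norm a \<le> 1 / \<delta> \<Longrightarrow> norm (qp a p) \<le> T"
    using compact_imp_bounded bounded_iff by (metis imageI mem_cball_0)
  have T0: "0 \<le> T" using T[of 0] assms norm_ge_zero[of "qp 0 p"] by (smt (verit) divide_nonneg_pos norm_zero)
  define c where "c = norm x / \<delta>"
  have c: "c \<ge> 0" using assms by (simp add: c_def)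
  have "norm (rank_term x z m) \<le> exp (c / (1 - norm p)) * T" if z: "\<delta> \<le> norm z" for z m
  proof -
    have "norm (x / z) \<le> c"
      unfolding c_def norm_divide using assms z by (intro frac_le) auto
    hence "norm (x / z) * norm p ^ k \<le> c * norm p ^ k" for k
      by (intro mult_right_mono) auto
    hence "norm (x / z * p ^ k) \<le> c * norm p ^ k" for k
      by (simp only: norm_mult norm_power)
    hence "norm (1 - x / z * p ^ k) \<le> 1 + c * norm p ^ k" for k
      using norm_triangle_ineq4[of 1 "x / z * p ^ k"] by (smt (verit, best) norm_one)
    hence "norm (\<Prod>k<m. 1 - x / z * p ^ k) \<le> (\<Prod>k<m. 1 + c * norm p ^ k)"
      unfolding prod_norm[symmetric] by (intro prod_mono) auto
    also have "\<dots> \<le> exp (\<Sum>k<m. c * norm p ^ k)"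
      using c by (intro prod_le_exp_sum) auto
    also have "(\<Sum>k<m. c * norm p ^ k) \<le> (\<Sum>k. c * norm p ^ k)"
      using c by (intro sum_le_suminf summable_mult summable_geometric) auto
    also have "(\<Sum>k. c * norm p ^ k) = c / (1 - norm p)"
      by (subst suminf_mult) (auto simp: suminf_geometric)
    finally have 1: "norm (\<Prod>k<m. 1 - x / z * p ^ k) \<le> exp (c / (1 - norm p))" by simp
    have "norm (p ^ Suc m / z) \<le> 1 / \<delta>"
      unfolding norm_divide norm_power using assms z
      by (intro frac_le power_le_one) (auto simp: less_imp_le)
    hence "norm (qp (p ^ Suc m / z) p) \<le> T" by (rule T)
    thus ?thesis unfolding rank_term_def norm_mult by (intro mult_mono 1) auto
  qed
  thus ?thesis by blast
qed

lemma summable_rank_sum: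
  assumes "z \<noteq> 0" "norm (c * z) < 1"
  shows "(\<lambda>m. (c * z) ^ m * rank_term x z m) summable_on UNIV"
proof -
  obtain B where B: "\<And>m. norm (rank_term x z m) \<le> B"
    using rank_term_bound[of "norm z"] assms by (metis order_refl zero_less_norm_iff)
  have "summable (\<lambda>m. norm (c * z) ^ m * B)"
    using assms by (intro summable_mult2 summable_geometric) auto
  hence "summable (\<lambda>m. norm ((c * z) ^ m * rank_term x z m))"
    by (rule summable_comparison_test'[where N = 0]) (auto simp: norm_mult norm_power intro!: mult_mono B)
  thus ?thesis by (rule norm_summable_imp_summable_on)
qed

lemma sums_rank_sum:
  assumes "z \<noteq> 0" "norm (c * z) < 1"
  shows "(\<lambda>m. (c * z) ^ m * rank_term x z m) sums rank_sum x c z"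
  unfolding rank_sum_def using summable_rank_sum[OF assms] by (intro has_sum_imp_sums has_sum_infsum)

lemma holomorphic_rank_sum:
  assumes "c \<noteq> 0"
  shows "rank_sum x c holomorphic_on (ball 0 (1 / norm c) - {0})"
  unfolding rank_sum_def[abs_def]
proof (rule holomorphic_on_infsum)
  show "open (ball 0 (1 / norm c) - {0::complex})" by (intro open_Diff) auto
  show "(\<lambda>z. (c * z) ^ m * rank_term x z m) holomorphic_on (ball 0 (1 / norm c) - {0})" for m
    unfolding rank_term_def by (intro holomorphic_intros) auto
next
  fix z :: complex assume "z \<in> ball 0 (1 / norm c) - {0}"
  hence z: "z \<noteq> 0" "norm z < 1 / norm c" by auto
  define d where "d = min (norm z / 2) ((1 / norm c - norm z) / 2)"
  have d: "d > 0" using z by (simp add: d_def)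
  define \<rho> where "\<rho> = norm c * (norm z + d)"
  have "norm z + d \<le> norm z + (1 / norm c - norm z) / 2"
    unfolding d_def by (intro add_left_mono min.cobounded2)
  also have "\<dots> < 1 / norm c" using z by (simp add: field_simps)
  finally have zd: "norm z + d < 1 / norm c" .
  have \<rho>: "0 \<le> \<rho>" "\<rho> < 1"
    using zd d assms by (auto simp: \<rho>_def field_simps)
  obtain B where B: "\<And>w m. norm z / 2 \<le> norm w \<Longrightarrow> norm (rank_term x w m) \<le> B"
    using rank_term_bound[of "norm z / 2" x] z by auto
  have w: "norm w \<le> norm z + d" "norm z / 2 \<le> norm w" if "w \<in> cball z d" for w
  proof -
    have "d \<le> norm z / 2" unfolding d_def by (rule min.cobounded1)
    thus "norm w \<le> norm z + d" "norm z / 2 \<le> norm w"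
      using that norm_triangle_ineq2[of z w] norm_triangle_ineq2[of w z]
      by (auto simp: dist_norm norm_minus_commute)
  qed
  have "cball z d \<subseteq> ball 0 (1 / norm c) - {0}"
    using w zd z by force
  moreover have "(\<lambda>m. \<rho> ^ m * B) summable_on UNIV"
    using \<rho> by (intro summable_on_cmult_left norm_summable_imp_summable_on) (simp add: power_abs[symmetric] summable_geometric)
  moreover have "norm ((c * w) ^ m * rank_term x w m) \<le> \<rho> ^ m * B" if "w \<in> cball z d" for w m
  proof -
    have "norm (c * w) \<le> \<rho>"
      unfolding \<rho>_def norm_mult using w[OF that] by (intro mult_left_mono) auto
    thus ?thesis
      unfolding norm_mult norm_power using \<rho> B[OF w(2)[OF that]] by (intro mult_mono power_mono) auto
  qed
  ultimately show "\<exists>d>0. \<exists>M. cball z d \<subseteq> ball 0 (1 / norm c) - {0} \<and> M summable_on UNIV \<and> (\<forall>m\<in>UNIV. \<forall>w\<in>cball z d. norm ((c * w) ^ m * rank_term x w m) \<le> M m)"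
    using d by (intro exI[of _ d] conjI exI[of _ "\<lambda>m. \<rho> ^ m * B"]) auto
qed

lemma rank_term_Suc: "rank_term x z (Suc m) * (1 - p ^ Suc m / z) = (1 - x / z * p ^ m) * rank_term x z m"
  unfolding rank_term_def using qp_head[of p "p ^ Suc m / z"] by (simp add: mult_ac)

lemma rank_term_0: "rank_term x z 0 = qp (p / z) p"
  by (simp add: rank_term_def)

text \<open>Since x^2 = p, replacing z by p z puts the new factor 1 - x / (p z) = 1 - 1 / (x z) in
  front of the finite product and shifts the other factors; raising the index by one absorbs the
  shift.\<close>

lemma rank_term_p: "x * x = p \<Longrightarrow> z \<noteq> 0 \<Longrightarrow> rank_term x (p * z) (Suc m) = (1 - 1 / (x * z)) * rank_term x z m"
proof -
  assume x: "x * x = p" and z: "z \<noteq> 0"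
  have x0: "x \<noteq> 0" using x p_nz by auto
  have "x / (p * z) * p ^ Suc k = x / z * p ^ k" for k by simp
  moreover have "x / (p * z) = 1 / (x * z)" using x0 z by (simp flip: x)
  ultimately show ?thesis
    unfolding rank_term_def by (simp add: prod.lessThan_Suc_shift del: prod.lessThan_Suc)
qed

text \<open>Multiply \<open>rank_term_Suc\<close> by z^(m+1) and sum over m. The relation trades the
  sum with c = p for the one with c = 1.\<close>

lemma rank_sum_relation:
  assumes "z \<noteq> 0" "norm z < 1"
  shows "(1 - x * z) * rank_sum x p z = (1 - z) * (z * rank_sum x 1 z + qp (p / z) p)"
proof -
  have pz: "norm (p * z) < 1"
    using assms mult_strict_mono'[of "norm p" 1 "norm z" 1] by (simp add: norm_mult)
  have H: "(\<lambda>m. z ^ m * rank_term x z m) sums rank_sum x 1 z"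
    using sums_rank_sum[of z 1 x] assms by simp
  have K: "(\<lambda>m. (p * z) ^ m * rank_term x z m) sums rank_sum x p z"
    using sums_rank_sum[of z p x] assms pz by simp
  have "(\<lambda>m. z ^ Suc m * rank_term x z (Suc m) - 1 / z * ((p * z) ^ Suc m * rank_term x z (Suc m))) sums ((rank_sum x 1 z - rank_term x z 0) - 1 / z * (rank_sum x p z - rank_term x z 0))"
    using sums_Suc_diff[OF H] sums_Suc_diff[OF K] by (intro sums_diff sums_mult) (simp_all only: power_0 mult_1)
  moreover have "(\<lambda>m. z * (z ^ m * rank_term x z m) - x * ((p * z) ^ m * rank_term x z m)) sums (z * rank_sum x 1 z - x * rank_sum x p z)"
    using H K by (intro sums_diff sums_mult)
  moreover have "z ^ Suc m * rank_term x z (Suc m) - 1 / z * ((p * z) ^ Suc m * rank_term x z (Suc m)) = z * (z ^ m * rank_term x z m) - x * ((p * z) ^ m * rank_term x z m)" for m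
  proof -
    have "z ^ Suc m * rank_term x z (Suc m) - 1 / z * ((p * z) ^ Suc m * rank_term x z (Suc m)) = z ^ Suc m * (rank_term x z (Suc m) * (1 - p ^ Suc m / z))"
      by (simp add: power_mult_distrib algebra_simps)
    also have "\<dots> = z ^ Suc m * ((1 - x / z * p ^ m) * rank_term x z m)"
      by (simp only: rank_term_Suc)
    also have "\<dots> = z * (z ^ m * rank_term x z m) - x * ((p * z) ^ m * rank_term x z m)"
      using assms by (simp add: power_mult_distrib field_simps)
    finally show ?thesis .
  qed
  ultimately have "(rank_sum x 1 z - rank_term x z 0) - 1 / z * (rank_sum x p z - rank_term x z 0) = z * rank_sum x 1 z - x * rank_sum x p z"
    by (simp add: sums_unique2)
  thus ?thesis using assms by (simp add: rank_term_0 field_simps)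
qed

text \<open>Passing to p z shifts the index by \<open>rank_term_p\<close> and turns c = 1 into c =
  p; \<open>rank_sum_relation\<close> leads back to c = 1. This is the first order difference
  equation.\<close>

lemma rank_sum_p:
  assumes x: "x * x = p" and z: "z \<noteq> 0" "norm z < 1"
  shows "rank_sum x 1 (p * z) = qp (1 / z) p * (1 + x * z) - x * z * (1 - z) * rank_sum x 1 z"
proof -
  have x0: "x \<noteq> 0" using x p_nz by auto
  have pz: "norm (p * z) < 1"
    using z mult_strict_mono'[of "norm p" 1 "norm z" 1] by (simp add: norm_mult)
  have "(\<lambda>m. (p * z) ^ m * rank_term x (p * z) m) sums rank_sum x 1 (p * z)"
    using sums_rank_sum[of "p * z" 1 x] z pz by simp
  hence "(\<lambda>m. (p * z) ^ Suc m * rank_term x (p * z) (Suc m)) sums (rank_sum x 1 (p * z) - qp (1 / z) p)"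
    using sums_Suc_diff[of "\<lambda>m. (p * z) ^ m * rank_term x (p * z) m" "rank_sum x 1 (p * z)"] by (simp only: power_0 mult_1 rank_term_0) simp
  moreover have "(\<lambda>m. p * z * (1 - 1 / (x * z)) * ((p * z) ^ m * rank_term x z m)) sums (p * z * (1 - 1 / (x * z)) * rank_sum x p z)"
    using sums_rank_sum[of z p x] z pz by (intro sums_mult)
  moreover have "(p * z) ^ Suc m * rank_term x (p * z) (Suc m) = p * z * (1 - 1 / (x * z)) * ((p * z) ^ m * rank_term x z m)" for m
    unfolding rank_term_p[OF x z(1), of m] by (simp add: mult_ac)
  ultimately have "rank_sum x 1 (p * z) - qp (1 / z) p = p * z * (1 - 1 / (x * z)) * rank_sum x p z"
    by (simp only: sums_unique2)
  also have "p * z * (1 - 1 / (x * z)) = - x * (1 - x * z)"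
    using x0 z by (simp add: field_simps flip: x)
  also have "- x * (1 - x * z) * rank_sum x p z = - x * ((1 - z) * (z * rank_sum x 1 z + qp (p / z) p))"
    using rank_sum_relation[OF z, of x] by (simp only: mult.assoc)
  also have "(1 - z) * (z * rank_sum x 1 z + qp (p / z) p) = z * (1 - z) * rank_sum x 1 z - z * qp (1 / z) p"
    using qp_head[of p "1 / z"] z by (simp add: field_simps)
  finally show ?thesis by (simp add: algebra_simps)
qed

lemma tau_half: "x * x = p \<Longrightarrow> tau (x / p) = tau x"
  and tau_half': "x * x = p \<Longrightarrow> tau (x / p\<^sup>2) = tau x / x"
proof -
  assume x: "x * x = p"
  hence x0: "x \<noteq> 0" using p_nz by auto
  show "tau (x / p) = tau x"
    using tau_inverse[of x] x0 by (simp flip: x)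
  show "tau (x / p\<^sup>2) = tau x / x"
    using tau_shift[of "x / p\<^sup>2"] x0 by (simp add: field_simps power2_eq_square flip: x)
qed

text \<open>Both sides obey the same inhomogeneous equation, so the difference obeys the homogeneous
  one. The factor \<open>qp z p\<close> is there to absorb the 1 - z of
  \<open>rank_sum_p\<close>.\<close>

lemma rank_sum_1_eq_SR:
  assumes x: "x * x = p" and z: "z \<noteq> 0" "norm z < 1"
  shows "qp z p * rank_sum x 1 z * tau x = SR x z"
proof -
  have x0: "x \<noteq> 0" using x p_nz by auto
  define F where "F = (\<lambda>z. qp z p * rank_sum x 1 z * tau x - SR x z)"
  have "F z = 0"
  proof (rule quasiperiodic_degree_neg_eq_0[where f = F and \<rho> = 1 and \<kappa> = "- x"])
    show "F holomorphic_on ball 0 1 - {0}"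
      unfolding F_def using holomorphic_rank_sum[of 1 x] x0 by (intro holomorphic_intros) auto
    show "F (p * z) = - x * z * F z" if z: "z \<noteq> 0" "norm z < 1" for z
    proof -
      have pz: "- p / (z * x) = - (x / z)" using x0 z by (simp flip: x)
      have SR: "SR x (p * z) = - (x / z) * (z\<^sup>2 * SR x z + th z * (tau x / x + z * tau x))"
        using SR_p[OF x0 z(1)] unfolding tau_half[OF x] tau_half'[OF x] pz .
      have "qp (p * z) p * rank_sum x 1 (p * z) = qp (p * z) p * qp (1 / z) p * (1 + x * z) - x * z * ((1 - z) * qp (p * z) p) * rank_sum x 1 z"
        unfolding rank_sum_p[OF x z] by (simp add: algebra_simps)
      also have "qp (p * z) p * qp (1 / z) p = - th z / z"
        using th_p[OF z(1)] z by (simp add: th_def)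
      also have "(1 - z) * qp (p * z) p = qp z p"
        using qp_head[of p z] by (simp add: mult.commute)
      finally have "F (p * z) = (- th z / z * (1 + x * z) - x * z * qp z p * rank_sum x 1 z) * tau x + (x / z) * (z\<^sup>2 * SR x z + th z * (tau x / x + z * tau x))"
        unfolding F_def SR by simp
      also have "\<dots> = - x * z * F z"
        unfolding F_def using z x0 by (simp add: field_simps power2_eq_square)
      finally show ?thesis .
    qed
  qed (use z in auto)
  thus ?thesis by (simp add: F_def)
qed

text \<open>Inside the disc this restates \<open>rank_sum_1_eq_SR\<close>. The point is the boundary
  |z| = 1, reached by continuity, since the sum with c = p is holomorphic for 0 < |z| < 1 /
  |p|.\<close>

lemma rank_sum_p_eq_SR:
  assumes x: "x * x = p" and z: "z \<noteq> 0" "norm z \<le> 1"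
  shows "(1 - x * z) * qp (p * z) p * tau x * rank_sum x p z = z * SR x z + tau x * th z"
proof -
  have x0: "x \<noteq> 0" using x p_nz by auto
  define F where "F = (\<lambda>z. (1 - x * z) * qp (p * z) p * tau x * rank_sum x p z - z * SR x z - tau x * th z)"
  have F0: "F z = 0" if z: "z \<noteq> 0" "norm z < 1" for z
  proof -
    have "(1 - x * z) * qp (p * z) p * tau x * rank_sum x p z = qp (p * z) p * tau x * ((1 - z) * (z * rank_sum x 1 z + qp (p / z) p))"
      using rank_sum_relation[OF z, of x] by (simp add: mult_ac)
    also have "\<dots> = ((1 - z) * qp (p * z) p) * tau x * (z * rank_sum x 1 z + qp (p / z) p)"
      by (simp add: mult_ac)
    also have "(1 - z) * qp (p * z) p = qp z p"
      using qp_head[of p z] by (simp add: mult.commute)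
    also have "qp z p * tau x * (z * rank_sum x 1 z + qp (p / z) p) = z * SR x z + tau x * th z"
      unfolding rank_sum_1_eq_SR[OF x z, symmetric] th_def by (simp add: algebra_simps)
    finally show ?thesis by (simp add: F_def)
  qed
  have dom: "norm w < 1 / norm p" if "norm w \<le> 1" for w :: complex
  proof -
    have "1 < 1 / norm p" by (simp add: field_simps)
    with that show ?thesis by (rule le_less_trans)
  qed
  have "F holomorphic_on ball 0 (1 / norm p) - {0}"
    unfolding F_def using holomorphic_rank_sum[of p x] x0 by (intro holomorphic_intros) auto
  hence "continuous_on (ball 0 (1 / norm p) - {0}) F" by (rule holomorphic_on_imp_continuous_on)
  moreover have "open (ball 0 (1 / norm p) - {0::complex})" by (intro open_Diff) auto
  moreover have "z \<in> ball 0 (1 / norm p) - {0}" using z dom by simp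
  ultimately have "isCont F z" using continuous_on_eq_continuous_at by blast
  \<comment> \<open>The factors 1/2, 2/3, 3/4, ... are neither 0 nor 1, so the points lie in the
    punctured open disc.\<close>
  moreover have "(\<lambda>n. (1 - 1 / of_nat (Suc (Suc n))) * z) \<longlonglongrightarrow> (1 - 0) * z"
    by (intro tendsto_intros LIMSEQ_Suc lim_1_over_n)
  ultimately have "(\<lambda>n. F ((1 - 1 / of_nat (Suc (Suc n))) * z)) \<longlonglongrightarrow> F z"
    using isCont_tendsto_compose[of z F] by simp
  moreover have "F ((1 - 1 / of_nat (Suc (Suc n))) * z) = 0" for n
  proof (rule F0)
    define c where "c = 1 - 1 / real (Suc (Suc n))"
    have c: "0 < c" "c < 1" by (auto simp: c_def)
    have e: "1 - 1 / of_nat (Suc (Suc n)) = complex_of_real c"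
      by (simp add: c_def)
    show "(1 - 1 / of_nat (Suc (Suc n))) * z \<noteq> 0"
      unfolding e using z c by simp
    have "norm (complex_of_real c * z) = c * norm z"
      unfolding norm_mult norm_of_real using c by simp
    also have "\<dots> \<le> c * 1"
      using z c by (intro mult_left_mono) auto
    finally show "norm ((1 - 1 / of_nat (Suc (Suc n))) * z) < 1"
      unfolding e using c by simp
  qed
  ultimately have "F z = 0" by (simp add: LIMSEQ_const_iff)
  thus ?thesis by (simp add: F_def diff_eq_eq add.commute)
qed

text \<open>At z = 1 the series telescopes: (1 - x) \<open>rank_sum x p 1\<close> is the limit
  \<open>qp x p\<close> of \<open>rank_term x 1 m\<close>, while \<open>rank_sum_p_eq_SR\<close>
  evaluates it through the value E^2 of \<open>SR x 1\<close>. The outcome is Gauss's product for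
  \<psi>.\<close>

lemma tau_half_eq:
  assumes x: "x * x = p"
  shows "tau x * qp x p = E"
proof -
  have x0: "x \<noteq> 0" using x p_nz by auto
  have K: "(\<lambda>m. p ^ m * rank_term x 1 m) sums rank_sum x p 1"
    using sums_rank_sum[of 1 p x] by simp
  have "(\<lambda>m. p ^ Suc m * rank_term x 1 (Suc m) - x * (p ^ m * rank_term x 1 m)) sums ((rank_sum x p 1 - rank_term x 1 0) - x * rank_sum x p 1)"
    using sums_Suc_diff[OF K] K by (intro sums_diff sums_mult) (simp_all only: power_0 mult_1)
  moreover have "p ^ Suc m * rank_term x 1 (Suc m) - x * (p ^ m * rank_term x 1 m) = rank_term x 1 (Suc m) - rank_term x 1 m" for m
    using rank_term_Suc[of x 1 m] by (simp add: algebra_simps)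
  ultimately have "(\<lambda>m. rank_term x 1 (Suc m) - rank_term x 1 m) sums ((rank_sum x p 1 - rank_term x 1 0) - x * rank_sum x p 1)"
    by (simp only:)
  hence s: "(\<lambda>m. rank_term x 1 (Suc m) - rank_term x 1 m) sums ((1 - x) * rank_sum x p 1 - rank_term x 1 0)"
    by (simp add: algebra_simps)
  have "isCont (\<lambda>a. qp a p) 0"
    using holomorphic_on_imp_continuous_on[OF holomorphic_qp[of p UNIV]] by (simp add: continuous_on_eq_continuous_at)
  moreover have "(\<lambda>m. p ^ Suc m / 1) \<longlonglongrightarrow> 0"
    using LIMSEQ_Suc[OF LIMSEQ_power_zero[of p]] by simp
  ultimately have "(\<lambda>m. qp (p ^ Suc m / 1) p) \<longlonglongrightarrow> qp 0 p"
    by (rule isCont_tendsto_compose)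
  moreover have "(\<lambda>m. \<Prod>k<m. 1 - x / 1 * p ^ k) \<longlonglongrightarrow> qp x p"
    using qp_tendsto[of p x] by simp
  ultimately have "(\<lambda>m. rank_term x 1 m) \<longlonglongrightarrow> qp x p * qp 0 p"
    unfolding rank_term_def by (intro tendsto_mult)
  moreover have "qp 0 p = 1" by (simp add: qp_def)
  ultimately have "(\<lambda>m. rank_term x 1 (Suc m) - rank_term x 1 m) sums (qp x p - rank_term x 1 0)"
    by (intro telescope_sums) simp
  with s have "(1 - x) * rank_sum x p 1 = qp x p"
    using sums_unique2 by fastforce
  moreover have "E * tau x * ((1 - x) * rank_sum x p 1) = E\<^sup>2"
    using rank_sum_p_eq_SR[OF x, of 1] by (simp add: SR_1 E_def mult_ac)
  ultimately have "E * (tau x * qp x p) = E * E"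
    by (simp add: power2_eq_square mult_ac)
  thus ?thesis by simp
qed

text \<open>The bracket is z times (1 + the rank series): the rank series F satisfies z F = K - 1 -
  x z K with K the quotient on the left, as found in
  \<open>rank_generating_function\<close>.\<close>

lemma rank_series_lambert:
  assumes x: "x * x = p" and z: "norm z = 1" "z \<noteq> 1"
  shows "tau x * ((1 - x * z) * (rank_sum x p z / qp (p / z) p) - 1 + z) = z * ((1 - z) * S x z)"
proof -
  have z0: "z \<noteq> 0" using z by auto
  have nz: "qp (p * z) p \<noteq> 0" "qp (p / z) p \<noteq> 0"
    using z by (intro qp_nonzero; simp add: norm_mult norm_divide)+
  have th: "th z = (1 - z) * (qp (p * z) p * qp (p / z) p)"
    by (simp add: th_eq th0_def)
  hence "th z \<noteq> 0" using nz z by auto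
  hence "(1 - x * z) * qp (p * z) p * tau x * rank_sum x p z = (z * S x z + tau x) * ((1 - z) * (qp (p * z) p * qp (p / z) p))"
    using rank_sum_p_eq_SR[OF x z0] z by (simp add: SR_eq[OF z0] th algebra_simps)
  hence "(1 - x * z) * tau x * rank_sum x p z = (z * S x z + tau x) * ((1 - z) * qp (p / z) p)"
    using nz by (simp add: mult_ac)
  hence "(1 - x * z) * (rank_sum x p z / qp (p / z) p) * tau x = (z * S x z + tau x) * (1 - z)"
    using nz by (simp add: field_simps)
  thus ?thesis by (simp add: algebra_simps)
qed

end

section \<open>Generating function of the rank\<close>

definition no_rep :: "nat multiset set" where
  "no_rep = {\<pi>. 0 \<notin># \<pi> \<and> (\<forall>i. odd i \<longrightarrow> count \<pi> i \<le> 1)}"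

definition no_rep_upto :: "nat \<Rightarrow> nat multiset set" where
  "no_rep_upto b = {\<pi> \<in> no_rep. \<forall>i\<in>#\<pi>. i \<le> b}"

text \<open>Polymorphic because it is used with complex values for the generating function and with
  real ones for the majorant. The exponent of w counts parts, so w = 1 / z accounts for the negative
  term of the rank.\<close>

definition wt :: "'a :: comm_semiring_1 \<Rightarrow> 'a \<Rightarrow> nat multiset \<Rightarrow> 'a" where
  "wt q w \<pi> = q ^ sum_mset \<pi> * w ^ size \<pi>"

definition part_factor :: "'a :: field \<Rightarrow> 'a \<Rightarrow> nat \<Rightarrow> 'a" where
  "part_factor q w i = (if odd i then 1 + w * q ^ i else 1 / (1 - w * q ^ i))"

lemma wt_empty [simp]: "wt q w {#} = 1"
  and wt_add [simp]: "wt q w (add_mset i \<pi>) = w * q ^ i * wt q w \<pi>"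
  and wt_union: "wt q w (\<pi> + \<rho>) = wt q w \<pi> * wt q w \<rho>"
  and wt_replicate: "wt q w (replicate_mset k i) = (w * q ^ i) ^ k"
  by (simp_all add: wt_def power_add mult_ac power_mult_distrib flip: power_mult)

lemma no_rep_upto_0: "no_rep_upto 0 = {{#}}"
  by (auto simp: no_rep_upto_def no_rep_def) (metis multiset_nonemptyE)

lemma no_rep_upto_odd:
  assumes "even b"
  shows "no_rep_upto (Suc b) = no_rep_upto b \<union> add_mset (Suc b) ` no_rep_upto b"
proof (intro equalityI subsetI)
  fix \<pi> assume \<pi>: "\<pi> \<in> no_rep_upto (Suc b)"
  show "\<pi> \<in> no_rep_upto b \<union> add_mset (Suc b) ` no_rep_upto b"
  proof (cases "Suc b \<in># \<pi>")
    case True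
    then obtain \<rho> where \<rho>: "\<pi> = add_mset (Suc b) \<rho>" by (metis multi_member_split)
    have "count \<pi> (Suc b) \<le> 1" using \<pi> assms by (auto simp: no_rep_upto_def no_rep_def)
    hence "Suc b \<notin># \<rho>" by (simp add: \<rho> count_eq_zero_iff)
    hence "\<forall>i\<in>#\<rho>. i \<le> b" using \<pi> unfolding \<rho> no_rep_upto_def by (auto simp: le_Suc_eq)
    moreover have "count \<rho> i \<le> count \<pi> i" for i by (simp add: \<rho>)
    hence "\<rho> \<in> no_rep" using \<pi> by (auto simp: no_rep_upto_def no_rep_def \<rho> intro: le_trans)
    ultimately show ?thesis by (auto simp: \<rho> no_rep_upto_def)
  next
    case False
    hence "\<forall>i\<in>#\<pi>. i \<le> b" using \<pi> unfolding no_rep_upto_def by (auto simp: le_Suc_eq)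
    thus ?thesis using \<pi> by (auto simp: no_rep_upto_def)
  qed
next
  fix \<pi> assume \<pi>: "\<pi> \<in> no_rep_upto b \<union> add_mset (Suc b) ` no_rep_upto b"
  have "Suc b \<notin># \<rho>" if "\<rho> \<in> no_rep_upto b" for \<rho> using that by (auto simp: no_rep_upto_def)
  thus "\<pi> \<in> no_rep_upto (Suc b)"
    using \<pi> by (auto simp: no_rep_upto_def no_rep_def count_eq_zero_iff intro: le_SucI)
qed

lemma no_rep_upto_even_bij:
  assumes "odd b"
  shows "bij_betw (\<lambda>(k, \<pi>). \<pi> + replicate_mset k (Suc b)) (UNIV \<times> no_rep_upto b) (no_rep_upto (Suc b))"
proof (rule bij_betw_byWitness[where f' = "\<lambda>\<pi>. (count \<pi> (Suc b), filter_mset (\<lambda>i. i \<noteq> Suc b) \<pi>)"])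
  have nin: "Suc b \<notin># \<pi>" if "\<pi> \<in> no_rep_upto b" for \<pi> using that by (auto simp: no_rep_upto_def)
  hence c0: "count \<pi> (Suc b) = 0" if "\<pi> \<in> no_rep_upto b" for \<pi> using that by (simp add: count_eq_zero_iff)
  show "\<forall>a\<in>UNIV \<times> no_rep_upto b. (count (case a of (k, \<pi>) \<Rightarrow> \<pi> + replicate_mset k (Suc b)) (Suc b), filter_mset (\<lambda>i. i \<noteq> Suc b) (case a of (k, \<pi>) \<Rightarrow> \<pi> + replicate_mset k (Suc b))) = a"
    using c0 by (auto simp: multiset_eq_iff)
  show "\<forall>\<pi>\<in>no_rep_upto (Suc b). (case (count \<pi> (Suc b), filter_mset (\<lambda>i. i \<noteq> Suc b) \<pi>) of (k, \<pi>) \<Rightarrow> \<pi> + replicate_mset k (Suc b)) = \<pi>"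
    by (auto simp: multiset_eq_iff)
  show "(\<lambda>(k, \<pi>). \<pi> + replicate_mset k (Suc b)) ` (UNIV \<times> no_rep_upto b) \<subseteq> no_rep_upto (Suc b)"
    using assms by (auto simp: no_rep_upto_def no_rep_def split: if_splits intro: le_SucI)
  show "(\<lambda>\<pi>. (count \<pi> (Suc b), filter_mset (\<lambda>i. i \<noteq> Suc b) \<pi>)) ` no_rep_upto (Suc b) \<subseteq> UNIV \<times> no_rep_upto b"
    by (auto simp: no_rep_upto_def no_rep_def le_Suc_eq; metis)
qed

text \<open>A new odd part occurs at most once, a new even part contributes a geometric series,
  whose ratio is below 1 because |w| is at most 1. Absolute summability is carried along since
  summing over pairs (multiplicity, rest) needs it.\<close>

lemma has_sum_no_rep_upto:
  fixes q w :: "'a :: {real_normed_field, banach}"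
  assumes q: "norm q < 1" and w: "norm w \<le> 1"
  shows "(wt q w has_sum (\<Prod>i=1..b. part_factor q w i)) (no_rep_upto b) \<and> (\<lambda>\<pi>. norm (wt q w \<pi>)) summable_on no_rep_upto b"
proof (induction b)
  case 0
  show ?case by (auto simp: no_rep_upto_0 intro!: has_sum_finiteI)
next
  case (Suc b)
  define a where "a = w * q ^ Suc b"
  show ?case
  proof (cases "even b")
    case True
    have inj: "inj_on (add_mset (Suc b)) (no_rep_upto b)" by (auto simp: inj_on_def)
    have disj: "no_rep_upto b \<inter> add_mset (Suc b) ` no_rep_upto b = {}" by (auto simp: no_rep_upto_def)
    have "(wt q w has_sum (a * (\<Prod>i=1..b. part_factor q w i))) (add_mset (Suc b) ` no_rep_upto b)"
      using Suc.IH by (subst has_sum_reindex[OF inj]) (auto simp: o_def a_def intro!: has_sum_cmult_right)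
    hence "(wt q w has_sum ((\<Prod>i=1..b. part_factor q w i) + a * (\<Prod>i=1..b. part_factor q w i))) (no_rep_upto (Suc b))"
      unfolding no_rep_upto_odd[OF True] using Suc.IH disj by (intro has_sum_Un_disjoint) auto
    moreover have "(\<lambda>\<pi>. norm (wt q w \<pi>)) summable_on add_mset (Suc b) ` no_rep_upto b"
      using Suc.IH by (subst summable_on_reindex[OF inj]) (auto simp: o_def norm_mult intro!: summable_on_cmult_right)
    hence "(\<lambda>\<pi>. norm (wt q w \<pi>)) summable_on no_rep_upto (Suc b)"
      unfolding no_rep_upto_odd[OF True] using Suc.IH disj by (intro summable_on_Un_disjoint) auto
    ultimately show ?thesis using True by (simp add: part_factor_def a_def algebra_simps)
  next
    case False
    hence odd: "odd b" by simp
    have "norm q ^ Suc b < 1" using q by (simp add: power_less_one_iff del: power_Suc)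
    moreover have "norm a \<le> 1 * norm q ^ Suc b"
      unfolding a_def norm_mult norm_power using w by (intro mult_right_mono) auto
    ultimately have a: "norm a < 1" by simp
    have wt: "wt q w (case x of (k, \<pi>) \<Rightarrow> \<pi> + replicate_mset k (Suc b)) = (case x of (k, \<pi>) \<Rightarrow> a ^ k * wt q w \<pi>)" for x
      by (auto simp: wt_union wt_replicate a_def mult_ac split: prod.splits)
    have geo: "((\<lambda>k. a ^ k) has_sum (1 / (1 - a))) UNIV"
      using a by (intro norm_summable_imp_has_sum geometric_sums) (auto simp: norm_power)
    have s: "(\<lambda>x. norm (case x of (k, \<pi>) \<Rightarrow> a ^ k * wt q w \<pi>)) summable_on UNIV \<times> no_rep_upto b"
    proof (rule summable_on_SigmaI)
      show "((\<lambda>\<pi>. norm (case (k, \<pi>) of (k, \<pi>) \<Rightarrow> a ^ k * wt q w \<pi>)) has_sum (norm a ^ k * infsum (\<lambda>\<pi>. norm (wt q w \<pi>)) (no_rep_upto b))) (no_rep_upto b)" for k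
        using Suc.IH by (auto simp: norm_mult norm_power intro!: has_sum_cmult_right)
      show "(\<lambda>k. norm a ^ k * infsum (\<lambda>\<pi>. norm (wt q w \<pi>)) (no_rep_upto b)) summable_on UNIV"
        using a by (intro summable_on_cmult_left norm_summable_imp_summable_on) (auto intro: summable_geometric)
    qed auto
    have "((\<lambda>x. case x of (k, \<pi>) \<Rightarrow> a ^ k * wt q w \<pi>) has_sum (1 / (1 - a) * (\<Prod>i=1..b. part_factor q w i))) (UNIV \<times> no_rep_upto b)"
    proof (rule has_sum_SigmaI)
      show "((\<lambda>\<pi>. case (k, \<pi>) of (k, \<pi>) \<Rightarrow> a ^ k * wt q w \<pi>) has_sum (a ^ k * (\<Prod>i=1..b. part_factor q w i))) (no_rep_upto b)" for k
        using Suc.IH by (auto intro!: has_sum_cmult_right)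
      show "((\<lambda>k. a ^ k * (\<Prod>i=1..b. part_factor q w i)) has_sum (1 / (1 - a) * (\<Prod>i=1..b. part_factor q w i))) UNIV"
        using geo by (intro has_sum_cmult_left)
      show "(\<lambda>x. case x of (k, \<pi>) \<Rightarrow> a ^ k * wt q w \<pi>) summable_on UNIV \<times> no_rep_upto b"
        using s by (rule abs_summable_summable)
    qed
    hence "((\<lambda>x. wt q w (case x of (k, \<pi>) \<Rightarrow> \<pi> + replicate_mset k (Suc b))) has_sum (1 / (1 - a) * (\<Prod>i=1..b. part_factor q w i))) (UNIV \<times> no_rep_upto b)"
      by (simp only: wt)
    hence "(wt q w has_sum (1 / (1 - a) * (\<Prod>i=1..b. part_factor q w i))) (no_rep_upto (Suc b))"
      by (subst (asm) has_sum_reindex_bij_betw[OF no_rep_upto_even_bij[OF odd]])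
    moreover have "(\<lambda>x. norm (wt q w (case x of (k, \<pi>) \<Rightarrow> \<pi> + replicate_mset k (Suc b)))) summable_on UNIV \<times> no_rep_upto b"
      using s by (simp only: wt)
    hence "(\<lambda>\<pi>. norm (wt q w \<pi>)) summable_on no_rep_upto (Suc b)"
      by (subst (asm) summable_on_reindex_bij_betw[OF no_rep_upto_even_bij[OF odd]])
    ultimately show ?thesis using odd by (simp add: part_factor_def a_def mult_ac)
  qed
qed

text \<open>Parts are paired as 2 k + 1 and 2 k + 2. The sign in -w q is what x = -q
  absorbs.\<close>

lemma prod_part_factor:
  fixes q w :: complex
  shows "(\<Prod>i=1..2*m. part_factor q w i) = (\<Prod>k<m. 1 - (- w * q) * (q\<^sup>2) ^ k) / (\<Prod>k<m. 1 - w * q\<^sup>2 * (q\<^sup>2) ^ k)"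
proof (induction m)
  case (Suc m)
  have "(\<Prod>i=1..2*Suc m. part_factor q w i) = (\<Prod>i=1..2*m. part_factor q w i) * part_factor q w (Suc (2*m)) * part_factor q w (Suc (Suc (2*m)))"
    by (simp add: mult.assoc)
  also have "part_factor q w (Suc (2*m)) = 1 - (- w * q) * (q\<^sup>2) ^ m"
    by (simp add: part_factor_def mult_ac flip: power_mult)
  also have "part_factor q w (Suc (Suc (2*m))) = 1 / (1 - w * q\<^sup>2 * (q\<^sup>2) ^ m)"
  proof -
    have "q ^ Suc (Suc (2*m)) = q ^ (2 + 2 * m)" by simp
    also have "\<dots> = q\<^sup>2 * (q\<^sup>2) ^ m" by (simp only: power_add power_mult)
    finally show ?thesis by (simp add: part_factor_def mult.assoc del: power_Suc)
  qed
  finally show ?case using Suc.IH by simp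
qed simp

text \<open>The weights are nonnegative, so bounded partial sums suffice: finitely many partitions
  have bounded parts, hence their sum lies below one of the finite products, and these converge. The
  detour through complex numbers is due to \<open>qp\<close> being complex.\<close>

lemma summable_no_rep:
  assumes q: "0 \<le> q" "q < (1 :: real)"
  shows "wt q 1 summable_on no_rep"
proof -
  have q2: "norm ((complex_of_real q)\<^sup>2) < 1"
    using q by (simp add: norm_power power_less_one_iff)
  have "(\<lambda>m. (\<Prod>k<m. 1 - (- 1 * complex_of_real q) * ((complex_of_real q)\<^sup>2) ^ k) / (\<Prod>k<m. 1 - 1 * (complex_of_real q)\<^sup>2 * ((complex_of_real q)\<^sup>2) ^ k))
      \<longlonglongrightarrow> qp (- 1 * complex_of_real q) ((complex_of_real q)\<^sup>2) / qp (1 * (complex_of_real q)\<^sup>2) ((complex_of_real q)\<^sup>2)"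
    using q2 by (intro tendsto_divide qp_tendsto qp_nonzero) auto
  hence "Bseq (\<lambda>m. \<Prod>i=1..2*m. part_factor (complex_of_real q) 1 i)"
    unfolding prod_part_factor by (rule convergent_imp_Bseq[OF convergentI])
  then obtain C where C: "\<And>m. norm (\<Prod>i=1..2*m. part_factor (complex_of_real q) 1 i) \<le> C"
    unfolding Bseq_def by blast
  have cr: "complex_of_real (part_factor q 1 i) = part_factor (complex_of_real q) 1 i" for i
    by (simp add: part_factor_def)
  have C': "(\<Prod>i=1..2*m. part_factor q 1 i) \<le> C" for m
  proof -
    have "(\<Prod>i=1..2*m. part_factor q 1 i) \<le> norm (complex_of_real (\<Prod>i=1..2*m. part_factor q 1 i))"
      by (simp only: norm_of_real abs_ge_self)
    also have "\<dots> \<le> C" using C[of m] by (simp add: cr)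
    finally show ?thesis .
  qed
  show ?thesis
  proof (rule nonneg_bdd_above_summable_on)
    show "wt q 1 \<pi> \<ge> 0" for \<pi> using q by (simp add: wt_def)
    show "bdd_above (sum (wt q 1) ` {F. F \<subseteq> no_rep \<and> finite F})"
    proof (rule bdd_aboveI2)
      fix F assume "F \<in> {F. F \<subseteq> no_rep \<and> finite F}"
      hence F: "F \<subseteq> no_rep" "finite F" by auto
      have "\<exists>m. \<forall>i\<in>\<Union>(set_mset ` F). i \<le> m"
        using F(2) by (intro finite_nat_set_iff_bounded_le[THEN iffD1]) auto
      then obtain m where m: "\<And>\<pi> i. \<pi> \<in> F \<Longrightarrow> i \<in># \<pi> \<Longrightarrow> i \<le> m" by auto
      have "F \<subseteq> no_rep_upto (2 * m)" using F m by (fastforce simp: no_rep_upto_def)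
      hence "sum (wt q 1) F \<le> (\<Prod>i=1..2*m. part_factor q 1 i)"
        using has_sum_no_rep_upto[of q 1 "2 * m"] q F
        by (intro finite_sum_le_has_sum[where A = "no_rep_upto (2 * m)"]) (auto simp: wt_def)
      also have "\<dots> \<le> C" by (rule C')
      finally show "sum (wt q 1) F \<le> C" .
    qed
  qed
qed

text \<open>Largest parts 2 m + 1 and 2 m + 2 have the same half, rounded up; therefore the layers
  are cut at even bounds.\<close>

lemma M2_rank_no_rep_upto_diff:
  assumes "\<pi> \<in> no_rep_upto (2 * Suc m) - no_rep_upto (2 * m)"
  shows "M2_rank \<pi> = int (Suc m) - int (size \<pi>)"
proof -
  have ne: "\<pi> \<noteq> {#}" using assms by (auto simp: no_rep_upto_def no_rep_def)
  have M: "Max (set_mset \<pi>) \<le> 2 * Suc m" using assms ne by (auto simp: no_rep_upto_def)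
  obtain i where "i \<in># \<pi>" "\<not> i \<le> 2 * m" using assms by (auto simp: no_rep_upto_def)
  hence "Max (set_mset \<pi>) > 2 * m" by (metis Max_ge finite_set_mset le_trans not_le)
  with M have "Max (set_mset \<pi>) = 2 * m + 1 \<or> Max (set_mset \<pi>) = 2 * m + 2"
    by (cases "Max (set_mset \<pi>) = 2 * m + 1") auto
  hence "\<lceil>real (Max (set_mset \<pi>)) / 2\<rceil> = int (Suc m)"
    by (elim disjE) (auto simp: ceiling_eq_iff)
  thus ?thesis by (simp add: M2_rank_def)
qed

lemma no_rep_decompose: "no_rep - {{#}} = (\<Union>m. no_rep_upto (2 * Suc m) - no_rep_upto (2 * m))"
proof (intro equalityI subsetI)
  fix \<pi> assume \<pi>: "\<pi> \<in> no_rep - {{#}}"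
  define M where "M = Max (set_mset \<pi>)"
  have M: "M \<in># \<pi>" "\<And>i. i \<in># \<pi> \<Longrightarrow> i \<le> M"
    using \<pi> by (auto simp: M_def)
  have "M > 0" using M(1) \<pi> by (auto simp: no_rep_def intro!: Nat.gr0I)
  define m where "m = (M - 1) div 2"
  have "2 * m < M" "M \<le> 2 * Suc m" using \<open>M > 0\<close> unfolding m_def by presburger+
  hence "\<pi> \<in> no_rep_upto (2 * Suc m) - no_rep_upto (2 * m)"
    using \<pi> M by (force simp: no_rep_upto_def)
  thus "\<pi> \<in> (\<Union>m. no_rep_upto (2 * Suc m) - no_rep_upto (2 * m))" by blast
qed (auto simp: no_rep_upto_def)

lemma no_rep_upto_mono: "b \<le> c \<Longrightarrow> no_rep_upto b \<subseteq> no_rep_upto c"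
  by (auto simp: no_rep_upto_def)

text \<open>One value F in two guises: a sum over partitions, for the arithmetic, and a series over
  layers of the largest part, for the q-series. On layer m the rank is m + 1 minus the number of
  parts, whence z^(m+1) and the weight 1 / z per part. |z| = 1 gives absolute convergence.\<close>

lemma rank_weight_has_sum:
  fixes q z :: complex
  assumes q: "norm q < 1" and z: "norm z = 1"
  obtains F where "((\<lambda>\<pi>. z powi M2_rank \<pi> * q ^ sum_mset \<pi>) has_sum F) (no_rep - {{#}})"
    "(\<lambda>m. z ^ Suc m * ((\<Prod>i=1..2*Suc m. part_factor q (1 / z) i) - (\<Prod>i=1..2*m. part_factor q (1 / z) i))) sums F"
proof -
  define f where "f = (\<lambda>\<pi>. z powi M2_rank \<pi> * q ^ sum_mset \<pi>)"
  define D where "D = (\<lambda>m. no_rep_upto (2 * Suc m) - no_rep_upto (2 * m))"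
  have "wt (norm q) 1 summable_on (no_rep - {{#}})"
    using summable_no_rep[of "norm q"] q by (auto intro: summable_on_subset_banach)
  hence "(\<lambda>\<pi>. norm (f \<pi>)) summable_on (no_rep - {{#}})"
    using z by (simp add: f_def norm_mult norm_power norm_power_int wt_def[abs_def])
  hence "f summable_on (no_rep - {{#}})" by (rule abs_summable_summable)
  then obtain F where F: "(f has_sum F) (no_rep - {{#}})" by (auto simp: summable_on_def)
  have bij: "bij_betw snd (Sigma UNIV D) (no_rep - {{#}})"
  proof (rule bij_betw_imageI)
    show "inj_on snd (Sigma UNIV D)"
    proof -
      have "m = n" if "\<pi> \<in> D m" "\<pi> \<in> D n" for m n \<pi>
        using that no_rep_upto_mono[of "2 * Suc m" "2 * n"] no_rep_upto_mono[of "2 * Suc n" "2 * m"]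
        by (cases m n rule: linorder_cases) (auto simp: D_def)
      thus ?thesis by (auto simp: inj_on_def)
    qed
    show "snd ` Sigma UNIV D = no_rep - {{#}}"
      unfolding no_rep_decompose D_def by force
  qed
  have "((\<lambda>x. f (snd x)) has_sum F) (Sigma UNIV D)"
    by (subst has_sum_reindex_bij_betw[OF bij]) (rule F)
  moreover have "(f has_sum (z ^ Suc m * ((\<Prod>i=1..2*Suc m. part_factor q (1 / z) i) - (\<Prod>i=1..2*m. part_factor q (1 / z) i)))) (D m)" for m
  proof -
    have "(wt q (1 / z) has_sum ((\<Prod>i=1..2*Suc m. part_factor q (1 / z) i) - (\<Prod>i=1..2*m. part_factor q (1 / z) i))) (D m)"
      unfolding D_def
    proof (rule has_sum_Diff)
      show "(wt q (1 / z) has_sum (\<Prod>i=1..2*Suc m. part_factor q (1 / z) i)) (no_rep_upto (2 * Suc m))"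
        using has_sum_no_rep_upto[of q "1 / z" "2 * Suc m"] q z by (simp add: norm_divide)
      show "(wt q (1 / z) has_sum (\<Prod>i=1..2*m. part_factor q (1 / z) i)) (no_rep_upto (2 * m))"
        using has_sum_no_rep_upto[of q "1 / z" "2 * m"] q z by (simp add: norm_divide)
      show "no_rep_upto (2 * m) \<subseteq> no_rep_upto (2 * Suc m)" by (rule no_rep_upto_mono) simp
    qed
    hence "((\<lambda>\<pi>. z ^ Suc m * wt q (1 / z) \<pi>) has_sum (z ^ Suc m * ((\<Prod>i=1..2*Suc m. part_factor q (1 / z) i) - (\<Prod>i=1..2*m. part_factor q (1 / z) i)))) (D m)"
      by (rule has_sum_cmult_right)
    also have "?this \<longleftrightarrow> ?thesis"
    proof (rule has_sum_cong)
      fix \<pi> assume "\<pi> \<in> D m"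
      hence r: "M2_rank \<pi> = int (Suc m) - int (size \<pi>)" unfolding D_def by (rule M2_rank_no_rep_upto_diff)
      have "z \<noteq> 0" using z by auto
      hence "z powi M2_rank \<pi> = z ^ Suc m * (1 / z) ^ size \<pi>"
        unfolding r by (simp add: power_int_diff power_divide del: of_nat_Suc)
      thus "z ^ Suc m * wt q (1 / z) \<pi> = f \<pi>"
        by (simp add: f_def wt_def mult_ac)
    qed
    finally show ?thesis .
  qed
  ultimately have "((\<lambda>m. z ^ Suc m * ((\<Prod>i=1..2*Suc m. part_factor q (1 / z) i) - (\<Prod>i=1..2*m. part_factor q (1 / z) i))) has_sum F) UNIV"
    by (intro has_sum_SigmaD[where f = "\<lambda>x. f (snd x)" and A = UNIV and B = D]) auto
  from has_sum_imp_sums[OF this] F show ?thesis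
    using that by (simp add: f_def)
qed

section \<open>From weighted partitions to the rank counts\<close>

lemma partitions_no_rep_odd_eq: "partitions_no_rep_odd n = {\<pi> \<in> no_rep. sum_mset \<pi> = n}"
  by (auto simp: partitions_no_rep_odd_def no_rep_def)

lemma size_le_sum_mset: "0 \<notin># \<pi> \<Longrightarrow> size \<pi> \<le> sum_mset (\<pi> :: nat multiset)"
  by (induction \<pi>) auto

lemma finite_partitions_no_rep_odd: "finite (partitions_no_rep_odd n)"
proof (rule finite_subset)
  show "partitions_no_rep_odd n \<subseteq> mset ` {xs. set xs \<subseteq> {..n} \<and> length xs \<le> n}"
  proof
    fix \<pi> assume \<pi>: "\<pi> \<in> partitions_no_rep_odd n"
    obtain xs where xs: "mset xs = \<pi>" using ex_mset by blast
    have "length xs \<le> n"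
      using \<pi> size_le_sum_mset[of \<pi>] by (auto simp: partitions_no_rep_odd_def simp flip: xs)
    moreover have "x \<le> n" if "x \<in> set xs" for x
    proof -
      have "x \<in># \<pi>" using that xs by auto
      then obtain \<rho> where "\<pi> = add_mset x \<rho>" by (metis multi_member_split)
      thus ?thesis using \<pi> by (auto simp: partitions_no_rep_odd_def)
    qed
    ultimately show "\<pi> \<in> mset ` {xs. set xs \<subseteq> {..n} \<and> length xs \<le> n}"
      using xs by (intro image_eqI[of _ _ xs]) auto
  qed
  show "finite (mset ` {xs. set xs \<subseteq> {..n} \<and> length xs \<le> n})"
    by (intro finite_imageI finite_lists_length_le) auto
qed

text \<open>Only the finitely many ranks attained by partitions of n contribute, and grouping by
  rank counts each partition once. For n = 0 the count on the right would include the empty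
  partition.\<close>

lemma N2_mod_eq:
  assumes "n > 0"
  shows "N2_mod s l n = card {\<pi> \<in> partitions_no_rep_odd n. [M2_rank \<pi> = s] (mod int l)}"
proof -
  define P where "P = {\<pi> \<in> partitions_no_rep_odd n. [M2_rank \<pi> = s] (mod int l)}"
  have fin: "finite P" unfolding P_def using finite_partitions_no_rep_odd by auto
  have "N2_mod s l n = (\<Sum>\<^sub>\<infinity>m\<in>M2_rank ` P. card {\<pi> \<in> P. M2_rank \<pi> = m})"
    unfolding N2_mod_def
  proof (rule infsum_cong_neutral)
    fix m assume "m \<in> {m. [m = s] (mod int l)} - M2_rank ` P"
    hence "{\<pi> \<in> partitions_no_rep_odd n. M2_rank \<pi> = m} = {}" by (auto simp: P_def)
    thus "N2 m n = 0" unfolding N2_def by (metis card.empty)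
  next
    fix m assume "m \<in> {m. [m = s] (mod int l)} \<inter> M2_rank ` P"
    hence "{\<pi> \<in> partitions_no_rep_odd n. M2_rank \<pi> = m} = {\<pi> \<in> P. M2_rank \<pi> = m}" by (auto simp: P_def)
    thus "N2 m n = card {\<pi> \<in> P. M2_rank \<pi> = m}" using assms by (simp add: N2_def)
  qed (auto simp: P_def)
  also have "\<dots> = (\<Sum>m\<in>M2_rank ` P. card {\<pi> \<in> P. M2_rank \<pi> = m})"
    using fin by (intro infsum_finite) auto
  also have "\<dots> = card P"
    using sum.group[of P "M2_rank ` P" M2_rank "\<lambda>_. 1 :: nat"] fin by simp
  finally show ?thesis by (simp add: P_def)
qed

lemma N2_mod_0: "N2_mod s l 0 = 0"
  by (simp add: N2_mod_def N2_def)

lemma sum_root_of_unity_rank: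
  assumes "z ^ 5 = (1 :: complex)" "n > 0"
  shows "(\<Sum>\<pi>\<in>partitions_no_rep_odd n. z powi M2_rank \<pi>) = (\<Sum>s<5. of_nat (N2_mod (int s) 5 n) * z ^ s)"
proof -
  define P where "P = partitions_no_rep_odd n"
  have z: "z \<noteq> 0" using assms by auto
  have fin: "finite P" unfolding P_def by (rule finite_partitions_no_rep_odd)
  have pw: "z powi r = z ^ nat (r mod 5)" for r :: int
  proof -
    have "z powi r = z powi (5 * (r div 5) + r mod 5)" by simp
    also have "\<dots> = (z ^ 5) powi (r div 5) * z powi (r mod 5)"
      by (subst power_int_add) (use z in \<open>auto simp: power_int_mult\<close>)
    also have "\<dots> = z ^ nat (r mod 5)"
      using assms by (simp add: power_int_nonneg_exp)
    finally show ?thesis .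
  qed
  have "(\<Sum>\<pi>\<in>P. z powi M2_rank \<pi>) = (\<Sum>s<5. \<Sum>\<pi>\<in>{\<pi> \<in> P. nat (M2_rank \<pi> mod 5) = s}. z powi M2_rank \<pi>)"
    using fin by (intro sum.group[symmetric]) auto
  also have "\<dots> = (\<Sum>s<5. of_nat (N2_mod (int s) 5 n) * z ^ s)"
  proof (rule sum.cong)
    fix s :: nat assume s: "s \<in> {..<5}"
    have "{\<pi> \<in> P. nat (M2_rank \<pi> mod 5) = s} = {\<pi> \<in> P. [M2_rank \<pi> = int s] (mod int 5)}"
      using s by (auto simp: cong_def)
    hence "card {\<pi> \<in> P. nat (M2_rank \<pi> mod 5) = s} = N2_mod (int s) 5 n"
      using assms(2) by (simp add: N2_mod_eq P_def)
    moreover have "(\<Sum>\<pi>\<in>{\<pi> \<in> P. nat (M2_rank \<pi> mod 5) = s}. z powi M2_rank \<pi>) = (\<Sum>\<pi>\<in>{\<pi> \<in> P. nat (M2_rank \<pi> mod 5) = s}. z ^ s)"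
      by (intro sum.cong) (auto simp: pw)
    ultimately show "(\<Sum>\<pi>\<in>{\<pi> \<in> P. nat (M2_rank \<pi> mod 5) = s}. z powi M2_rank \<pi>) = of_nat (N2_mod (int s) 5 n) * z ^ s"
      by simp
  qed auto
  finally show ?thesis by (simp add: P_def)
qed

lemma has_sum_by_size:
  fixes f :: "nat multiset \<Rightarrow> 'a :: {topological_comm_monoid_add, t3_space}"
  assumes "(f has_sum F) (no_rep - {{#}})"
  shows "((\<lambda>n. \<Sum>\<pi>\<in>partitions_no_rep_odd n - {{#}}. f \<pi>) has_sum F) UNIV"
proof -
  have bij: "bij_betw snd (Sigma UNIV (\<lambda>n. partitions_no_rep_odd n - {{#}})) (no_rep - {{#}})"
    by (rule bij_betw_byWitness[where f' = "\<lambda>\<pi>. (sum_mset \<pi>, \<pi>)"]) (auto simp: partitions_no_rep_odd_eq)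
  have "((\<lambda>x. f (snd x)) has_sum F) (Sigma UNIV (\<lambda>n. partitions_no_rep_odd n - {{#}}))"
    by (subst has_sum_reindex_bij_betw[OF bij]) (rule assms)
  thus ?thesis
    by (rule has_sum_SigmaD) (use finite_partitions_no_rep_odd in \<open>auto intro!: has_sum_finiteI\<close>)
qed

lemma summable_N2_mod:
  assumes q: "norm q < 1"
  shows "summable (\<lambda>n. norm (of_nat (N2_mod s 5 n) * q ^ n :: complex))"
proof -
  have "wt (norm q) 1 summable_on (no_rep - {{#}})"
    using summable_no_rep[of "norm q"] q by (auto intro: summable_on_subset_banach)
  then obtain F where "(wt (norm q) 1 has_sum F) (no_rep - {{#}})" by (auto simp: summable_on_def)
  from has_sum_imp_sums[OF has_sum_by_size[OF this]]
  have "summable (\<lambda>n. \<Sum>\<pi>\<in>partitions_no_rep_odd n - {{#}}. wt (norm q) 1 \<pi>)" by (rule sums_summable)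
  thus ?thesis
  proof (rule summable_comparison_test'[where N = 0])
    fix n
    show "norm (norm (of_nat (N2_mod s 5 n) * q ^ n :: complex)) \<le> (\<Sum>\<pi>\<in>partitions_no_rep_odd n - {{#}}. wt (norm q) 1 \<pi>)"
    proof (cases "n = 0")
      case True thus ?thesis by (simp add: N2_mod_0 sum_nonneg wt_def)
    next
      case False
      have "(\<Sum>\<pi>\<in>partitions_no_rep_odd n - {{#}}. wt (norm q) 1 \<pi>) = (\<Sum>\<pi>\<in>partitions_no_rep_odd n - {{#}}. norm q ^ n)"
        by (intro sum.cong) (auto simp: wt_def partitions_no_rep_odd_eq)
      also have "\<dots> = real (card (partitions_no_rep_odd n - {{#}})) * norm q ^ n" by simp
      also have "card (partitions_no_rep_odd n - {{#}}) = card (partitions_no_rep_odd n)"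
        using False by (intro arg_cong[of _ _ card]) (auto simp: partitions_no_rep_odd_eq)
      finally have e: "(\<Sum>\<pi>\<in>partitions_no_rep_odd n - {{#}}. wt (norm q) 1 \<pi>) = real (card (partitions_no_rep_odd n)) * norm q ^ n" .
      have "N2_mod s 5 n \<le> card (partitions_no_rep_odd n)"
        using False finite_partitions_no_rep_odd by (subst N2_mod_eq) (auto intro!: card_mono)
      thus ?thesis unfolding e by (simp add: norm_mult norm_power mult_right_mono)
    qed
  qed
qed

lemma rank_generating_function:
  fixes q z :: complex
  assumes q: "0 < norm q" "norm q < 1" and z: "z ^ 5 = 1" "z \<noteq> 1"
  shows "nome.tau (q\<^sup>2) (- q) * (1 + (\<Sum>s<5. (\<Sum>n. of_nat (N2_mod (int s) 5 n) * q ^ n) * z ^ s)) =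
           (1 - z) * nome.S (q\<^sup>2) (- q) z"
proof -
  interpret nome "q\<^sup>2"
    using q by unfold_locales (auto simp: norm_power power_less_one_iff)
  define x where "x = - q"
  have x: "x * x = q\<^sup>2" by (simp add: x_def power2_eq_square)
  have zn: "norm z = 1"
  proof -
    have "norm z ^ 5 = 1" using z by (metis norm_one norm_power)
    thus ?thesis by (metis norm_ge_zero power_eq_1_iff zero_neq_numeral abs_of_nonneg real_norm_def)
  qed
  have z0: "z \<noteq> 0" using zn by auto
  define Q where "Q = qp (q\<^sup>2 / z) (q\<^sup>2)"
  have Q: "Q \<noteq> 0" unfolding Q_def using q zn by (intro qp_nonzero) (auto simp: norm_divide norm_power power_less_one_iff)
  obtain F where F: "((\<lambda>\<pi>. z powi M2_rank \<pi> * q ^ sum_mset \<pi>) has_sum F) (no_rep - {{#}})"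
    "(\<lambda>m. z ^ Suc m * ((\<Prod>i=1..2*Suc m. part_factor q (1 / z) i) - (\<Prod>i=1..2*m. part_factor q (1 / z) i))) sums F"
    using rank_weight_has_sum[OF q(2) zn] by blast
  have P: "(\<Prod>i=1..2*m. part_factor q (1 / z) i) = rank_term x z m / Q" for m
  proof -
    have "Q = (\<Prod>k<m. 1 - q\<^sup>2 / z * (q\<^sup>2) ^ k) * qp (q\<^sup>2 / z * (q\<^sup>2) ^ m) (q\<^sup>2)"
      unfolding Q_def by (rule qp_split_head) simp
    moreover have "q\<^sup>2 / z * (q\<^sup>2) ^ m = (q\<^sup>2) ^ Suc m / z" by simp
    ultimately have "Q = (\<Prod>k<m. 1 - 1 / z * q\<^sup>2 * (q\<^sup>2) ^ k) * qp ((q\<^sup>2) ^ Suc m / z) (q\<^sup>2)" by simp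
    thus ?thesis
      unfolding prod_part_factor rank_term_def using Q by (simp add: x_def)
  qed
  define K where "K = rank_sum x (q\<^sup>2) z / Q"
  have q2z: "norm (q\<^sup>2 * z) < 1" using q zn by (simp add: norm_mult norm_power power_less_one_iff)
  \<comment> \<open>By \<open>rank_term_Suc\<close> the difference of consecutive terms gains a
    power of p, which compensates |z| = 1. So the layer series becomes a combination of the sum with
    c = p and its shift.\<close>
  have "(\<lambda>m. (1 / z * ((q\<^sup>2 * z) ^ Suc m * rank_term x z (Suc m)) - x * ((q\<^sup>2 * z) ^ m * rank_term x z m)) / Q) sums ((1 / z * (rank_sum x (q\<^sup>2) z - Q) - x * rank_sum x (q\<^sup>2) z) / Q)"
    using sums_rank_sum[OF z0 q2z, of x] sums_Suc_diff[OF sums_rank_sum[OF z0 q2z, of x]]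
    by (intro sums_divide sums_diff sums_mult) (simp_all only: power_0 mult_1 rank_term_0 Q_def)
  moreover have "(1 / z * ((q\<^sup>2 * z) ^ Suc m * rank_term x z (Suc m)) - x * ((q\<^sup>2 * z) ^ m * rank_term x z m)) / Q =
     z ^ Suc m * ((\<Prod>i=1..2*Suc m. part_factor q (1 / z) i) - (\<Prod>i=1..2*m. part_factor q (1 / z) i))" for m
  proof -
    have "rank_term x z (Suc m) - rank_term x z m = (q\<^sup>2) ^ Suc m / z * rank_term x z (Suc m) - x / z * (q\<^sup>2) ^ m * rank_term x z m"
      using rank_term_Suc[of x z m] by (simp add: algebra_simps)
    hence "z ^ Suc m * (rank_term x z (Suc m) - rank_term x z m) = z ^ Suc m * ((q\<^sup>2) ^ Suc m / z * rank_term x z (Suc m) - x / z * (q\<^sup>2) ^ m * rank_term x z m)"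
      by (simp only:)
    also have "\<dots> = 1 / z * ((q\<^sup>2 * z) ^ Suc m * rank_term x z (Suc m)) - x * ((q\<^sup>2 * z) ^ m * rank_term x z m)"
      using z0 by (simp add: power_mult_distrib right_diff_distrib mult_ac)
    finally show ?thesis unfolding P by (simp only: diff_divide_distrib[symmetric] times_divide_eq_right)
  qed
  ultimately have "F = (1 / z * (rank_sum x (q\<^sup>2) z - Q) - x * rank_sum x (q\<^sup>2) z) / Q"
    using F(2) by (simp only: sums_unique2)
  hence "z * F = (rank_sum x (q\<^sup>2) z - Q) / Q - x * z * (rank_sum x (q\<^sup>2) z / Q)"
    using z0 by (simp add: diff_divide_distrib right_diff_distrib mult_ac)
  hence FK: "z * F = K - 1 - x * z * K"
    using Q by (simp add: K_def diff_divide_distrib)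
  have "((\<lambda>n. (\<Sum>s<5. of_nat (N2_mod (int s) 5 n) * q ^ n * z ^ s)) has_sum F) UNIV"
  proof -
    have "(\<Sum>\<pi>\<in>partitions_no_rep_odd n - {{#}}. z powi M2_rank \<pi> * q ^ sum_mset \<pi>) = (\<Sum>s<5. of_nat (N2_mod (int s) 5 n) * q ^ n * z ^ s)" for n
    proof (cases "n = 0")
      case True
      have e: "partitions_no_rep_odd 0 - {{#}} = {}"
        by (auto simp: partitions_no_rep_odd_eq no_rep_def) (metis multiset_nonemptyE)
      show ?thesis unfolding True e by (simp add: N2_mod_0)
    next
      case False
      have "partitions_no_rep_odd n - {{#}} = partitions_no_rep_odd n"
        using False by (auto simp: partitions_no_rep_odd_eq)
      hence "(\<Sum>\<pi>\<in>partitions_no_rep_odd n - {{#}}. z powi M2_rank \<pi> * q ^ sum_mset \<pi>) = (\<Sum>\<pi>\<in>partitions_no_rep_odd n. z powi M2_rank \<pi>) * q ^ n"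
        unfolding sum_distrib_right by (intro sum.cong) (auto simp: partitions_no_rep_odd_eq)
      thus ?thesis using False sum_root_of_unity_rank[OF z(1), of n] by (simp add: sum_distrib_left mult_ac)
    qed
    thus ?thesis using has_sum_by_size[OF F(1)] by simp
  qed
  from has_sum_imp_sums[OF this] have "(\<lambda>n. (\<Sum>s<5. of_nat (N2_mod (int s) 5 n) * q ^ n * z ^ s)) sums F" .
  moreover have "(\<lambda>n. (\<Sum>s<5. of_nat (N2_mod (int s) 5 n) * q ^ n * z ^ s)) sums (\<Sum>s<5. (\<Sum>n. of_nat (N2_mod (int s) 5 n) * q ^ n) * z ^ s)"
    using summable_norm_cancel[OF summable_N2_mod[OF q(2)]] by (intro sums_sum sums_mult2) (rule summable_sums)
  ultimately have F': "F = (\<Sum>s<5. (\<Sum>n. of_nat (N2_mod (int s) 5 n) * q ^ n) * z ^ s)"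
    by (rule sums_unique2)
  have "z * (tau x * (1 + F)) = tau x * ((1 - x * z) * (rank_sum x (q\<^sup>2) z / qp (q\<^sup>2 / z) (q\<^sup>2)) - 1 + z)"
  proof -
    have "z * (tau x * (1 + F)) = tau x * (z + z * F)" by (simp add: algebra_simps)
    also have "\<dots> = tau x * ((1 - x * z) * K - 1 + z)" unfolding FK by (simp add: algebra_simps)
    finally show ?thesis by (simp only: K_def Q_def)
  qed
  also have "\<dots> = z * ((1 - z) * S x z)"
    by (rule rank_series_lambert[OF x zn z(2)])
  finally show ?thesis using z0 by (simp add: F' x_def)
qed

section \<open>Relations at level ten\<close>

context nome
begin

lemma thd_reflect: "v \<noteq> 0 \<Longrightarrow> thd (p / v) = - thd v"
  using thd_p[of "1 / v"] by (simp add: thd_inverse th_inverse field_simps)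

lemma logderiv_four_term_quotient:
  assumes nz: "a \<noteq> 0" "v \<noteq> 0" "w \<noteq> 0"
    and th: "th a \<noteq> 0" "th v \<noteq> 0" "th w \<noteq> 0" "th (v * w) \<noteq> 0" "th (a * v * w) \<noteq> 0"
  shows "thd a / th a + thd v / th v + thd w / th w - thd (a * v * w) / th (a * v * w) - 1 =
     - E\<^sup>2 * (th (a * v) * th (v * w) * th (a * w)) / (th a * th v * th w * th (a * v * w))"
proof -
  define P where "P = th a * th v * th w * th (a * v * w)"
  have P: "P \<noteq> 0" using th by (simp add: P_def)
  have "P * (thd a / th a + thd v / th v + thd w / th w - thd (a * v * w) / th (a * v * w) - 1) =
     (thd a * th (a * v * w) - th a * thd (a * v * w)) * (th v * th w) +
     (thd v * th w + th v * thd w - th v * th w) * (th a * th (a * v * w))"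
    using th by (simp add: P_def field_simps)
  also have "\<dots> = - E\<^sup>2 * (th (a * v) * th (v * w) * th (a * w))"
    using logderiv_four_term[OF nz th(2-4)] by (simp add: add_eq_0_iff)
  finally show ?thesis using P unfolding P_def[symmetric] by (simp add: field_simps)
qed

end

text \<open>In the application p = q^10 and y = -q.\<close>

locale level10 = nome +
  fixes y :: complex
  assumes y10: "y ^ 10 = p"
begin

text \<open>A wrapper for powers of y: with the rules below, simplification adds exponents, so that
  \<open>th\<close>, \<open>tau\<close> and \<open>S\<close> are always seen with a canonical
  argument.\<close>

definition Y :: "int \<Rightarrow> complex" where "Y n = y powi n"

lemma y_nz [simp]: "y \<noteq> 0" using y10 p_nz by auto

lemma norm_y: "0 < norm y" "norm y < 1"
proof -
  have "norm y ^ 10 < 1" using y10 p_lt_1 by (metis norm_power)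
  thus "norm y < 1" by (simp add: power_less_one_iff)
qed simp

lemma Y_nz [simp]: "Y n \<noteq> 0" by (simp add: Y_def)

lemma Y_0 [simp]: "Y 0 = 1" by (simp add: Y_def)

lemma Y_mult [simp]: "Y m * Y n = Y (m + n)" by (simp add: Y_def power_int_add)

lemma Y_mult' [simp]: "Y m * (Y n * z) = Y (m + n) * z" by (simp add: mult.assoc[symmetric])

lemma Y_divide [simp]: "Y m / Y n = Y (m - n)" by (simp add: Y_def power_int_diff)

lemma Y_inverse: "1 / Y n = Y (- n)" by (simp add: Y_def power_int_minus divide_inverse)

lemma Y_power [simp]: "Y m ^ k = Y (m * int k)" by (simp add: Y_def power_int_power')

lemma p_eq_Y: "p = Y 10" by (simp add: Y_def flip: y10)

lemma y_eq_Y: "y = Y 1" by (simp add: Y_def)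

lemma th_Y_nz: "n mod 10 \<noteq> 0 \<Longrightarrow> th (Y n) \<noteq> 0"
proof
  assume n: "n mod 10 \<noteq> 0" and "th (Y n) = 0"
  then obtain k :: int where "Y n = p powi k" using th_eq_0_iff[of "Y n"] by auto
  also have "\<dots> = Y (10 * k)" by (simp add: p_eq_Y Y_def power_int_mult)
  finally have "norm y powi n = norm y powi (10 * k)"
    unfolding Y_def by (metis norm_power_int)
  hence "n = 10 * k"
    using norm_y power_int_strict_decreasing[of n "10 * k" "norm y"] power_int_strict_decreasing[of "10 * k" n "norm y"]
    by (cases n "10 * k" rule: linorder_cases) auto
  thus False using n by simp
qed

lemma Y_p_powi_neq_1: "n mod 10 \<noteq> 0 \<Longrightarrow> Y n * p powi m \<noteq> 1"
  using th_Y_nz[of n] th_p_powi[of "Y n" m] by auto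

lemma th_Y_reflect: "th (Y (10 - n)) = th (Y n)"
  using th_reflect[of "Y n"] by (simp add: p_eq_Y)

lemma thd_Y_reflect: "thd (Y (10 - n)) = - thd (Y n)"
  using thd_reflect[of "Y n"] by (simp add: p_eq_Y)

lemmas th_Y = th_Y_reflect[of 1, simplified] th_Y_reflect[of 2, simplified] th_Y_reflect[of 3, simplified] th_Y_reflect[of 4, simplified]
lemmas thd_Y = thd_Y_reflect[of 1, simplified] thd_Y_reflect[of 2, simplified] thd_Y_reflect[of 3, simplified] thd_Y_reflect[of 4, simplified]

lemma th_Y_minus: "th (Y (- n)) = - Y (- n) * th (Y n)"
  using th_inverse[of "Y n"] by (simp add: Y_inverse[symmetric])

lemma thd_Y_5: "thd (Y 5) = 0"
proof -
  have "thd (Y 5) + thd (Y 5) = 0"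
    using thd_Y_reflect[of 5] by simp
  thus ?thesis by (simp flip: mult_2)
qed

lemma S_Y_reflect: "S (Y e) (Y i) = - Y (- i) * S (Y (10 - e)) (Y (- i))"
  using S_reflect[of "Y e" "Y i"] by (simp add: p_eq_Y Y_inverse[symmetric])

lemma S_Y_shift: "S (Y e) (Y i) = Y (10 - e) * S (Y (e - 20)) (Y (i - 10))"
  using S_p[of "Y e" "Y (i - 10)"] by (simp add: p_eq_Y)

lemma S_Y_mult: "i mod 10 \<noteq> 0 \<Longrightarrow> S (Y (e + 10)) (Y i) = Y (- i) * (S (Y e) (Y i) - tau (Y e))"
proof -
  assume "i mod 10 \<noteq> 0"
  hence "S (Y e * p) (Y i) = (S (Y e) (Y i) - tau (Y e)) / Y i"
    by (intro S_mult_p Y_p_powi_neq_1) auto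
  moreover have "Y e * p = Y (e + 10)" by (simp add: p_eq_Y)
  ultimately show ?thesis by (simp add: Y_inverse[symmetric])
qed

lemma S_Y_mult_1: "S (Y (e + 10)) 1 = S (Y e) 1 - tau (Y e) + 1"
  using S_mult_p_1[of "Y e"] by (simp add: p_eq_Y)

lemma tau_Y_minus: "tau (Y (- e)) = tau (Y e)"
  using tau_inverse[of "Y e"] by (simp add: Y_inverse)

lemma tau_Y_shift: "tau (Y e) = Y (10 + e) * tau (Y (20 + e))"
  using tau_shift[of "Y e"] by (simp add: p_eq_Y)

text \<open>For y = -q this is the product (-q^5; q^10).\<close>

definition e5 :: complex where "e5 = qp (Y 5) p"
text \<open>\<open>A\<close>, \<open>B\<close> and \<open>C\<close> are the components of \<psi>
  with exponents 0, 1 and 3 modulo 5, freed of the factors 1, x and x^3; see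
  \<open>psi_dissection\<close>.\<close>

definition C :: complex where "C = tau (Y 5)"
definition A :: complex where "A = tau (Y 1) + Y 2 * tau (Y 9)"
definition B :: complex where "B = tau (Y (-3)) + Y 4 * tau (Y 13)"

lemma e5_square: "e5\<^sup>2 = th (Y 5)"
proof -
  have "p / Y 5 = Y 5" by (simp add: p_eq_Y)
  thus ?thesis by (simp add: e5_def th_def power2_eq_square)
qed

lemma e5_nz [simp]: "e5 \<noteq> 0"
  using e5_square th_Y_nz[of 5] by auto

lemma C_eq: "C = E / e5"
  using tau_half_eq[of "Y 5"] by (simp add: p_eq_Y[symmetric] C_def e5_def[symmetric] field_simps)

lemma C_nz [simp]: "C \<noteq> 0" by (simp add: C_eq)

abbreviation "\<theta>1 \<equiv> th (Y 1)"
abbreviation "\<theta>2 \<equiv> th (Y 2)"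
abbreviation "\<theta>3 \<equiv> th (Y 3)"
abbreviation "\<theta>4 \<equiv> th (Y 4)"

lemma th_nz [simp]: "\<theta>1 \<noteq> 0" "\<theta>2 \<noteq> 0" "\<theta>3 \<noteq> 0" "\<theta>4 \<noteq> 0" "th (Y 5) \<noteq> 0"
  by (simp_all add: th_Y_nz)

lemma r_square: "Y 5 * Y 5 = p" by (simp add: p_eq_Y)

text \<open>\<open>A\<close> and \<open>B\<close> have just the shape required of the right-hand
  side in the condition on \<gamma>, with r = Y 5 and t = Y 2 or t = Y 4. Thus the components of
  \<psi> supply the constants of the three-term relations.\<close>

lemma A_ratio: "A / C * tau (Y 5) = Y 2 * tau (Y 5 * (Y 2)\<^sup>2) + tau (Y 5 / (Y 2)\<^sup>2)"
  using C_nz by (simp add: A_def C_def)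

lemma B_ratio: "B / C * tau (Y 5) = Y 4 * tau (Y 5 * (Y 4)\<^sup>2) + tau (Y 5 / (Y 4)\<^sup>2)"
  using C_nz by (simp add: B_def C_def)

lemma A_eq: "A = E * e5 * \<theta>4 / (\<theta>2 * \<theta>3)"
proof -
  have "A / C * (\<theta>2 * \<theta>3) = \<theta>4 * e5\<^sup>2"
    using tau_ratio[OF r_square _ _ _ A_ratio] by (simp add: th_Y e5_square)
  thus ?thesis by (simp add: C_eq field_simps power2_eq_square)
qed

lemma B_eq: "B = E * e5 * \<theta>2 / (\<theta>1 * \<theta>4)"
proof -
  have "B / C * (\<theta>4 * \<theta>1) = \<theta>2 * e5\<^sup>2"
    using tau_ratio[OF r_square _ _ _ B_ratio] by (simp add: th_Y e5_square)
  thus ?thesis by (simp add: C_eq field_simps power2_eq_square)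
qed

lemma theta_relation_1: "e5\<^sup>2 * \<theta>2\<^sup>2 * \<theta>3 = \<theta>1 * \<theta>4\<^sup>2 * \<theta>3 + Y 1 * \<theta>1\<^sup>2 * \<theta>2 * \<theta>4"
proof -
  \<comment> \<open>The exponents for (x, y, u, v) of \<open>weierstrass_three_term\<close> are (4,
    1, 2, 0): all sums and differences lie in 1, ..., 6 and reduce to the five basic theta values by
    reflection.\<close>
  have "th (Y 4 * Y 1) * th (Y 4 / Y 1) * th (Y 2 * Y 0) * th (Y 2 / Y 0) - th (Y 4 * Y 0) * th (Y 4 / Y 0) * th (Y 2 * Y 1) * th (Y 2 / Y 1) =
           Y 2 / Y 1 * (th (Y 1 * Y 0) * th (Y 1 / Y 0) * th (Y 4 * Y 2) * th (Y 4 / Y 2))"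
    by (rule weierstrass_three_term) (simp_all only: Y_divide Y_nz th_Y_nz, simp_all add: th_Y_nz)
  hence "th (Y 5) * \<theta>3 * \<theta>2 * \<theta>2 - \<theta>4 * \<theta>4 * \<theta>3 * \<theta>1 = Y 1 * (\<theta>1 * \<theta>1 * \<theta>4 * \<theta>2)"
    by (simp add: th_Y)
  thus ?thesis unfolding e5_square by (simp add: power2_eq_square algebra_simps)
qed

lemma theta_relation_2: "\<theta>3\<^sup>2 * \<theta>2 * \<theta>4 = e5\<^sup>2 * \<theta>1 * \<theta>4\<^sup>2 + Y 1 * \<theta>1 * \<theta>2\<^sup>2 * \<theta>3"
proof -
  \<comment> \<open>Now the exponents are (5, 2, 3, 1). The two relations together yield
    \<open>theta_quotients\<close>.\<close>
  have "th (Y 5 * Y 2) * th (Y 5 / Y 2) * th (Y 3 * Y 1) * th (Y 3 / Y 1) - th (Y 5 * Y 1) * th (Y 5 / Y 1) * th (Y 3 * Y 2) * th (Y 3 / Y 2) =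
           Y 3 / Y 2 * (th (Y 2 * Y 1) * th (Y 2 / Y 1) * th (Y 5 * Y 3) * th (Y 5 / Y 3))"
    by (rule weierstrass_three_term) (simp_all only: Y_divide Y_nz th_Y_nz, simp_all add: th_Y_nz)
  hence "\<theta>3 * \<theta>3 * \<theta>4 * \<theta>2 - \<theta>4 * \<theta>4 * th (Y 5) * \<theta>1 = Y 1 * (\<theta>3 * \<theta>1 * \<theta>2 * \<theta>2)"
    by (simp add: th_Y)
  thus ?thesis unfolding e5_square by (simp add: power2_eq_square algebra_simps)
qed

section \<open>Logarithmic derivatives of theta at powers of y\<close>

definition D :: "int \<Rightarrow> complex" where "D k = thd (Y k) / th (Y k)"

lemma D_reflect: "D (10 - k) = - D k"
  by (simp add: D_def th_Y_reflect thd_Y_reflect)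

lemma D_minus: "k mod 10 \<noteq> 0 \<Longrightarrow> D (- k) = 1 - D k"
proof -
  assume k: "k mod 10 \<noteq> 0"
  have "th (Y (- k)) = - th (Y k) / Y k" "thd (Y (- k)) = - (th (Y k) - thd (Y k)) / Y k"
    using th_inverse[of "Y k"] thd_inverse[of "Y k"] by (simp_all add: Y_inverse)
  thus ?thesis unfolding D_def using th_Y_nz[OF k] by (simp only:) (simp add: field_simps)
qed

lemma D_four_term:
  assumes "i mod 10 \<noteq> 0" "j mod 10 \<noteq> 0" "k mod 10 \<noteq> 0" "(j + k) mod 10 \<noteq> 0" "(i + j + k) mod 10 \<noteq> 0"
  shows "D i + D j + D k - D (i + j + k) - 1 =
     - E\<^sup>2 * (th (Y (i + j)) * th (Y (j + k)) * th (Y (i + k))) / (th (Y i) * th (Y j) * th (Y k) * th (Y (i + j + k)))"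
  using logderiv_four_term_quotient[of "Y i" "Y j" "Y k"] th_Y_nz assms by (simp add: D_def)

text \<open>The four-term relation is applied here and in the next three lemmas with exponents (1,
  2, 3), (3, 6, -1), (2, 5, 4) and (3, 4, -2). Reflection brings every value back to D 1, ..., D 4,
  and D 5 = 0. The products on the right are those occurring in \<open>residue_0\<close>.\<close>

lemma D_relation_1: "1 - D 1 - D 2 - D 3 - D 4 = E\<^sup>2 * e5\<^sup>2 / (\<theta>1 * \<theta>2)"
proof -
  have "D 6 = - D 4" using D_reflect[of 4] by simp
  hence "D 1 + D 2 + D 3 + D 4 - 1 = - E\<^sup>2 * (\<theta>3 * th (Y 5) * \<theta>4) / (\<theta>1 * \<theta>2 * \<theta>3 * \<theta>4)"
    using D_four_term[of 1 2 3] by (simp add: th_Y)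
  thus ?thesis by (simp add: e5_square field_simps)
qed

lemma D_relation_2: "D 2 + D 3 - D 1 - D 4 = Y 1 * (E\<^sup>2 * e5\<^sup>2 / (\<theta>3 * \<theta>4))"
proof -
  have "D 6 = - D 4" "D 8 = - D 2" "D (-1) = 1 - D 1"
    using D_reflect[of 4] D_reflect[of 2] D_minus[of 1] by simp_all
  hence "D 2 + D 3 - D 1 - D 4 = D 3 + D 6 + D (-1) - D 8 - 1" by simp
  also have "\<dots> = - E\<^sup>2 * (th (Y 9) * th (Y 5) * th (Y 2)) / (th (Y 3) * th (Y 6) * th (Y (-1)) * th (Y 8))"
    using D_four_term[of 3 6 "-1"] by simp
  also have "th (Y (-1)) = - \<theta>1 / Y 1"
    using th_inverse[of "Y 1"] by (simp add: Y_inverse)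
  also have "- E\<^sup>2 * (th (Y 9) * th (Y 5) * th (Y 2)) / (th (Y 3) * th (Y 6) * (- \<theta>1 / Y 1) * th (Y 8)) = Y 1 * (E\<^sup>2 * e5\<^sup>2 / (\<theta>3 * \<theta>4))"
    by (simp add: e5_square th_Y field_simps)
  finally show ?thesis .
qed

lemma D_relation_3: "D 2 + D 4 - D 1 = Y 1 * (E\<^sup>2 * \<theta>3 / (\<theta>2 * e5\<^sup>2))"
proof -
  have "D 11 = D 1 - 1"
    using D_reflect[of "-1"] D_minus[of 1] by simp
  moreover have "D 5 = 0" by (simp add: D_def thd_Y_5)
  ultimately have "D 2 + D 4 - D 1 = D 2 + D 5 + D 4 - D 11 - 1" by simp
  also have "\<dots> = - E\<^sup>2 * (th (Y 7) * th (Y 9) * th (Y 6)) / (th (Y 2) * th (Y 5) * th (Y 4) * th (Y 11))"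
    using D_four_term[of 2 5 4] by simp
  also have "th (Y 11) = - \<theta>1 / Y 1"
    using th_p[of "Y 1"] by (simp add: p_eq_Y)
  also have "- E\<^sup>2 * (th (Y 7) * th (Y 9) * th (Y 6)) / (th (Y 2) * th (Y 5) * th (Y 4) * (- \<theta>1 / Y 1)) = Y 1 * (E\<^sup>2 * \<theta>3 / (\<theta>2 * e5\<^sup>2))"
    by (simp add: e5_square th_Y field_simps)
  finally show ?thesis .
qed

lemma D_relation_4: "D 3 + D 4 - D 2 = Y 2 * (E\<^sup>2 * \<theta>1 / (\<theta>4 * e5\<^sup>2))"
proof -
  have "D (-2) = 1 - D 2"
    using D_minus[of 2] by simp
  moreover have "D 5 = 0" by (simp add: D_def thd_Y_5)
  ultimately have "D 3 + D 4 - D 2 = D 3 + D 4 + D (-2) - D 5 - 1" by simp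
  also have "\<dots> = - E\<^sup>2 * (th (Y 7) * th (Y 2) * th (Y 1)) / (th (Y 3) * th (Y 4) * th (Y (-2)) * th (Y 5))"
    using D_four_term[of 3 4 "-2"] by simp
  also have "th (Y (-2)) = - \<theta>2 / Y 2"
    using th_inverse[of "Y 2"] by (simp add: Y_inverse)
  also have "- E\<^sup>2 * (th (Y 7) * th (Y 2) * th (Y 1)) / (th (Y 3) * th (Y 4) * (- \<theta>2 / Y 2) * th (Y 5)) = Y 2 * (E\<^sup>2 * \<theta>1 / (\<theta>4 * e5\<^sup>2))"
    by (simp add: e5_square th_Y field_simps)
  finally show ?thesis .
qed

text \<open>The three-term relation with a = Y 2, t = Y 4, rewritten with the Lambert sums that the
  dissection modulo five produces. It serves the exponents 1 modulo 5.\<close>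

lemma lambert_1: "B / C * S (Y 5) (Y 2) + Y 2 * S (Y 13) (Y 2) + Y 5 * S (Y 17) (Y 4) = E\<^sup>2 * \<theta>3 / (\<theta>1 * \<theta>2)"
proof -
  have "Y 4 * S (Y 5 * (Y 4)\<^sup>2) (Y 2 * Y 4) + S (Y 5 / (Y 4)\<^sup>2) (Y 2 / Y 4) - B / C * S (Y 5) (Y 2) =
     Y 2 / Y 4 * (E\<^sup>2 * (th (Y 4) * th ((Y 4)\<^sup>2) * th (Y 2 * Y 5)) / (th (Y 5 * Y 4) * th (Y 2) * th (Y 2 * Y 4) * th (Y 2 / Y 4)))"
    by (rule lambert_three_term[OF r_square]) (use B_ratio in \<open>simp_all add: th_Y_nz\<close>)
  hence "Y 4 * S (Y 13) (Y 6) + S (Y (-3)) (Y (-2)) - B / C * S (Y 5) (Y 2) =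
     Y (-2) * (E\<^sup>2 * (\<theta>4 * \<theta>2 * \<theta>3) / (\<theta>1 * \<theta>2 * \<theta>4 * th (Y (-2))))"
    by (simp add: th_Y)
  moreover have "S (Y 13) (Y 6) = - Y 1 * S (Y 17) (Y 4)"
    using S_Y_reflect[of 13 6] S_Y_shift[of 17 4] by simp
  moreover have "S (Y (-3)) (Y (-2)) = - Y 2 * S (Y 13) (Y 2)"
    using S_Y_reflect[of "-3" "-2"] by simp
  moreover have "Y (-2) * (E\<^sup>2 * (\<theta>4 * \<theta>2 * \<theta>3) / (\<theta>1 * \<theta>2 * \<theta>4 * th (Y (-2)))) = - (E\<^sup>2 * \<theta>3 / (\<theta>1 * \<theta>2))"
    using th_Y_minus[of 2] by (simp add: field_simps)
  ultimately show ?thesis by (simp add: algebra_simps)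
qed

text \<open>The three-term relation with a = Y 4, t = Y 2. Moving the sums to the parameters of the
  dissection leaves theta series behind, which cancel because those from the two outer sums add up
  to \<open>A\<close>.\<close>

lemma lambert_4: "Y 3 * (A / C) * S (Y 15) (Y 4) - Y 1 * S (Y 11) (Y 2) + Y 2 * S (Y 11) (Y 4) = - Y 1 * (E\<^sup>2 * \<theta>1 / (\<theta>3 * \<theta>4))"
proof -
  have "Y 2 * S (Y 5 * (Y 2)\<^sup>2) (Y 4 * Y 2) + S (Y 5 / (Y 2)\<^sup>2) (Y 4 / Y 2) - A / C * S (Y 5) (Y 4) =
     Y 4 / Y 2 * (E\<^sup>2 * (th (Y 2) * th ((Y 2)\<^sup>2) * th (Y 4 * Y 5)) / (th (Y 5 * Y 2) * th (Y 4) * th (Y 4 * Y 2) * th (Y 4 / Y 2)))"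
    by (rule lambert_three_term[OF r_square]) (use A_ratio in \<open>simp_all add: th_Y_nz\<close>)
  hence 1: "Y 2 * S (Y 9) (Y 6) + S (Y 1) (Y 2) - A / C * S (Y 5) (Y 4) = Y 2 * (E\<^sup>2 * \<theta>1 / (\<theta>3 * \<theta>4))"
    by (simp add: th_Y field_simps)
  have "S (Y 9) (Y 6) = - Y 5 * S (Y 21) (Y 4)"
    using S_Y_reflect[of 9 6] S_Y_shift[of 21 4] by simp
  moreover have "S (Y 21) (Y 4) = Y (-4) * (S (Y 11) (Y 4) - tau (Y 11))"
    using S_Y_mult[of 4 11] by simp
  ultimately have 2: "Y 2 * S (Y 9) (Y 6) = - Y 3 * (S (Y 11) (Y 4) - tau (Y 11))" by simp
  have 3: "S (Y 1) (Y 2) = Y 2 * S (Y 11) (Y 2) + tau (Y 1)"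
  proof -
    have "Y 2 * S (Y 11) (Y 2) = S (Y 1) (Y 2) - tau (Y 1)" using S_Y_mult[of 2 1] by simp
    thus ?thesis by simp
  qed
  have 4: "S (Y 5) (Y 4) = Y 4 * S (Y 15) (Y 4) + C"
  proof -
    have "Y 4 * S (Y 15) (Y 4) = S (Y 5) (Y 4) - C" using S_Y_mult[of 4 5] by (simp add: C_def)
    thus ?thesis by simp
  qed
  have "tau (Y 9) = Y 1 * tau (Y 11)"
    using tau_Y_shift[of "-9"] tau_Y_minus[of 9] by simp
  hence 5: "tau (Y 1) + Y 3 * tau (Y 11) - A = 0" by (simp add: A_def)
  have "- Y 3 * (S (Y 11) (Y 4) - tau (Y 11)) + (Y 2 * S (Y 11) (Y 2) + tau (Y 1)) - A / C * (Y 4 * S (Y 15) (Y 4)) - A = Y 2 * (E\<^sup>2 * \<theta>1 / (\<theta>3 * \<theta>4))"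
    using 1 unfolding 2 3 4 by (simp add: algebra_simps)
  hence "- Y 3 * S (Y 11) (Y 4) + Y 2 * S (Y 11) (Y 2) - A / C * (Y 4 * S (Y 15) (Y 4)) + (tau (Y 1) + Y 3 * tau (Y 11) - A) = Y 2 * (E\<^sup>2 * \<theta>1 / (\<theta>3 * \<theta>4))"
    by (simp add: algebra_simps)
  hence "- Y 3 * S (Y 11) (Y 4) + Y 2 * S (Y 11) (Y 2) - A / C * (Y 4 * S (Y 15) (Y 4)) = Y 2 * (E\<^sup>2 * \<theta>1 / (\<theta>3 * \<theta>4))"
    by (simp only: 5 add_0_right)
  hence "- Y 1 * (Y 3 * (A / C) * S (Y 15) (Y 4) - Y 1 * S (Y 11) (Y 2) + Y 2 * S (Y 11) (Y 4)) = - Y 1 * (- Y 1 * (E\<^sup>2 * \<theta>1 / (\<theta>3 * \<theta>4)))"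
    by (simp add: algebra_simps)
  thus ?thesis by (simp only: mult_left_cancel[of "- Y 1"] neg_equal_0_iff_equal Y_nz simp_thms)
qed

text \<open>Exponents divisible by 5 involve \<open>S (Y 1) 1\<close>, a Lambert sum without its
  singular term; this calls for the degenerate relation, here with t = Y 2, and brings in
  logarithmic derivatives.\<close>

lemma lambert_0: "A / C * S (Y 5) (Y 2) - S (Y 1) 1 - Y 2 * S (Y 9) (Y 4) = 1 - D 2 - D 3 - D 4"
proof -
  have "Y 2 * S (Y 5 * (Y 2)\<^sup>2) ((Y 2)\<^sup>2) + S (Y 5 / (Y 2)\<^sup>2) 1 - A / C * S (Y 5) (Y 2) =
     thd (Y 2) / th (Y 2) + thd ((Y 2)\<^sup>2) / th ((Y 2)\<^sup>2) - thd (Y 5 * Y 2) / th (Y 5 * Y 2) - 1"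
    by (rule lambert_three_term_degenerate[OF r_square]) (use A_ratio in \<open>simp_all add: th_Y_nz\<close>)
  hence "Y 2 * S (Y 9) (Y 4) + S (Y 1) 1 - A / C * S (Y 5) (Y 2) = D 2 + D 4 + D 3 - 1"
    by (simp add: D_def th_Y thd_Y)
  thus ?thesis by (simp add: algebra_simps)
qed

text \<open>The degenerate relation with t = Y 4. The theta series left over by the shifts add up to
  \<open>B\<close>, and the 1 of \<open>S_Y_mult_1\<close> cancels the one on the right.\<close>

lemma lambert_0': "Y 4 * (B / C) * S (Y 15) (Y 4) + S (Y 3) 1 + Y 1 * S (Y 7) (Y 2) = D 2 - D 4 - D 1"
proof -
  have "Y 4 * S (Y 5 * (Y 4)\<^sup>2) ((Y 4)\<^sup>2) + S (Y 5 / (Y 4)\<^sup>2) 1 - B / C * S (Y 5) (Y 4) =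
     thd (Y 4) / th (Y 4) + thd ((Y 4)\<^sup>2) / th ((Y 4)\<^sup>2) - thd (Y 5 * Y 4) / th (Y 5 * Y 4) - 1"
    by (rule lambert_three_term_degenerate[OF r_square]) (use B_ratio in \<open>simp_all add: th_Y_nz\<close>)
  hence 1: "Y 4 * S (Y 13) (Y 8) + S (Y (-3)) 1 - B / C * S (Y 5) (Y 4) = D 4 - D 2 + D 1 - 1"
    by (simp add: D_def th_Y thd_Y)
  have "S (Y 13) (Y 8) = - Y (-1) * S (Y 17) (Y 2)"
    using S_Y_shift[of 13 8] S_Y_reflect[of "-7" "-2"] by simp
  moreover have "S (Y 17) (Y 2) = Y (-2) * (S (Y 7) (Y 2) - tau (Y 7))"
    using S_Y_mult[of 2 7] by simp
  ultimately have 2: "Y 4 * S (Y 13) (Y 8) = - Y 1 * (S (Y 7) (Y 2) - tau (Y 7))" by simp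
  have 3: "S (Y (-3)) 1 = - (S (Y 3) 1 - tau (Y 3) + 1)"
    using S_Y_reflect[of "-3" 0] S_Y_mult_1[of 3] by simp
  have 4: "S (Y 5) (Y 4) = Y 4 * S (Y 15) (Y 4) + C"
  proof -
    have "Y 4 * S (Y 15) (Y 4) = S (Y 5) (Y 4) - C" using S_Y_mult[of 4 5] by (simp add: C_def)
    thus ?thesis by simp
  qed
  have "tau (Y 7) = Y 3 * tau (Y 13)"
    using tau_Y_shift[of "-7"] tau_Y_minus[of 7] by simp
  hence 5: "B = tau (Y 3) + Y 1 * tau (Y 7)"
    using tau_Y_minus[of 3] by (simp add: B_def)
  have "- Y 1 * (S (Y 7) (Y 2) - tau (Y 7)) - (S (Y 3) 1 - tau (Y 3) + 1) - B / C * (Y 4 * S (Y 15) (Y 4)) - B = D 4 - D 2 + D 1 - 1"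
    using 1 unfolding 2 3 4 by (simp add: algebra_simps)
  thus ?thesis unfolding 5 by (simp add: algebra_simps)
qed

text \<open>For z a primitive fifth root of unity and c = z + 1/z, these are the components of the rank series
  by exponent modulo 5, up to sign and the empty partition, which is counted in R0.\<close>

definition "R0 c = (2 - c) * S (Y 5) (Y 2) / C - (1 - c) * (E * e5 * \<theta>3 / (\<theta>1 * \<theta>4))"
definition "R1 = E * e5 / \<theta>2"
definition "R2 c = E * \<theta>3 / (e5 * \<theta>2) - c * Y 1 * (E * \<theta>1 / (e5 * \<theta>4))"
definition "R3 c = c * (E * e5 / \<theta>4)"
definition "R4 c = - (1 + 2 * c) * Y 3 * S (Y 15) (Y 4) / C + (1 + c) * (E * e5 * \<theta>1 / (\<theta>2 * \<theta>3))"

text \<open>Exponents 0 modulo 5 of \<psi> times the component sum; x * x^4 and x^3 * x^2 give x^5 =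
  Y 1. The four products are logarithmic derivatives in disguise and cancel against those of the two
  degenerate relations, leaving the constant 1.\<close>

lemma residue_0:
  "A * R0 c + Y 1 * B * R4 c + Y 1 * C * R2 c =
     1 + (2 - c) * (S (Y 1) 1 + Y 2 * S (Y 9) (Y 4)) + (1 + 2 * c) * (S (Y 3) 1 + Y 1 * S (Y 7) (Y 2))"
proof -
  have 1: "A * (E * e5 * \<theta>3 / (\<theta>1 * \<theta>4)) = 1 - D 1 - D 2 - D 3 - D 4"
    unfolding A_eq D_relation_1 by (simp add: field_simps power2_eq_square)
  have 2: "Y 1 * B * (E * e5 * \<theta>1 / (\<theta>2 * \<theta>3)) = D 2 + D 3 - D 1 - D 4"
    unfolding B_eq D_relation_2 by (simp add: field_simps power2_eq_square)
  have 3: "Y 1 * C * (E * \<theta>3 / (e5 * \<theta>2)) = D 2 + D 4 - D 1"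
    unfolding C_eq D_relation_3 by (simp add: field_simps power2_eq_square)
  have 4: "Y 2 * C * (E * \<theta>1 / (e5 * \<theta>4)) = D 3 + D 4 - D 2"
    unfolding C_eq D_relation_4 by (simp add: field_simps power2_eq_square)
  have 5: "A / C * S (Y 5) (Y 2) = S (Y 1) 1 + Y 2 * S (Y 9) (Y 4) + 1 - D 2 - D 3 - D 4"
    using lambert_0 by (simp add: algebra_simps)
  have 6: "Y 4 * (B / C) * S (Y 15) (Y 4) = - S (Y 3) 1 - Y 1 * S (Y 7) (Y 2) + D 2 - D 4 - D 1"
    using lambert_0' by (simp add: algebra_simps)
  have "A * R0 c + Y 1 * B * R4 c + Y 1 * C * R2 c =
      (2 - c) * (A / C * S (Y 5) (Y 2)) - (1 - c) * (A * (E * e5 * \<theta>3 / (\<theta>1 * \<theta>4)))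
      - (1 + 2 * c) * (Y 4 * (B / C) * S (Y 15) (Y 4)) + (1 + c) * (Y 1 * B * (E * e5 * \<theta>1 / (\<theta>2 * \<theta>3)))
      + Y 1 * C * (E * \<theta>3 / (e5 * \<theta>2)) - c * (Y 2 * C * (E * \<theta>1 / (e5 * \<theta>4)))"
    unfolding R0_def R4_def R2_def by (simp add: algebra_simps add_divide_distrib diff_divide_distrib)
  also have "\<dots> = 1 + (2 - c) * (S (Y 1) 1 + Y 2 * S (Y 9) (Y 4)) + (1 + 2 * c) * (S (Y 3) 1 + Y 1 * S (Y 7) (Y 2))"
    unfolding 1 2 3 4 5 6 by (simp add: algebra_simps)
  finally show ?thesis .
qed

text \<open>These shapes arise in the residues once \<open>A\<close>, \<open>B\<close>,
  \<open>C\<close> are replaced by products. Eliminating e5^2 by \<open>theta_relation_1\<close> in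
  the first three and by \<open>theta_relation_2\<close> in the last three leaves polynomial
  identities.\<close>

lemma theta_quotients:
  "\<theta>4 / \<theta>2\<^sup>2 - e5\<^sup>2 / (\<theta>1 * \<theta>4) + Y 1 * \<theta>1 / (\<theta>2 * \<theta>3) = 0"
  "e5\<^sup>2 * \<theta>2 * \<theta>3 / (\<theta>1\<^sup>2 * \<theta>4\<^sup>2) - Y 1 / \<theta>4 = \<theta>3 / (\<theta>1 * \<theta>2)"
  "1 / \<theta>2 - e5\<^sup>2 * \<theta>2 / (\<theta>1 * \<theta>4\<^sup>2) = - Y 1 * \<theta>1 / (\<theta>3 * \<theta>4)"
  "e5\<^sup>2 * \<theta>4 / (\<theta>2\<^sup>2 * \<theta>3) = \<theta>3 / (\<theta>1 * \<theta>2) - Y 1 / \<theta>4"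
  "e5\<^sup>2 / (\<theta>2 * \<theta>3) + Y 1 * \<theta>2 / \<theta>4\<^sup>2 = \<theta>3 / (\<theta>1 * \<theta>4)"
  "e5\<^sup>2 * \<theta>1 * \<theta>4 / (\<theta>2\<^sup>2 * \<theta>3\<^sup>2) - 1 / \<theta>2 = - Y 1 * \<theta>1 / (\<theta>3 * \<theta>4)"
proof -
  \<comment> \<open>\<open>Y 1\<close> has to remain an atom for the field arithmetic, instead of
    its powers being merged into \<open>Y 2\<close>.\<close>
  note [simp del] = Y_mult Y_mult'
  show "\<theta>4 / \<theta>2\<^sup>2 - e5\<^sup>2 / (\<theta>1 * \<theta>4) + Y 1 * \<theta>1 / (\<theta>2 * \<theta>3) = 0"
  "e5\<^sup>2 * \<theta>2 * \<theta>3 / (\<theta>1\<^sup>2 * \<theta>4\<^sup>2) - Y 1 / \<theta>4 = \<theta>3 / (\<theta>1 * \<theta>2)"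
  "1 / \<theta>2 - e5\<^sup>2 * \<theta>2 / (\<theta>1 * \<theta>4\<^sup>2) = - Y 1 * \<theta>1 / (\<theta>3 * \<theta>4)"
  proof -
    have e: "e5\<^sup>2 = (\<theta>1 * \<theta>4\<^sup>2 * \<theta>3 + Y 1 * \<theta>1\<^sup>2 * \<theta>2 * \<theta>4) / (\<theta>2\<^sup>2 * \<theta>3)"
      using theta_relation_1 by (simp add: field_simps)
    show "\<theta>4 / \<theta>2\<^sup>2 - e5\<^sup>2 / (\<theta>1 * \<theta>4) + Y 1 * \<theta>1 / (\<theta>2 * \<theta>3) = 0"
      unfolding e by (simp add: divide_simps) (simp add: power2_eq_square algebra_simps)
    show "e5\<^sup>2 * \<theta>2 * \<theta>3 / (\<theta>1\<^sup>2 * \<theta>4\<^sup>2) - Y 1 / \<theta>4 = \<theta>3 / (\<theta>1 * \<theta>2)"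
      unfolding e by (simp add: divide_simps) (simp add: power2_eq_square algebra_simps)
    show "1 / \<theta>2 - e5\<^sup>2 * \<theta>2 / (\<theta>1 * \<theta>4\<^sup>2) = - Y 1 * \<theta>1 / (\<theta>3 * \<theta>4)"
      unfolding e by (simp add: divide_simps) (simp add: power2_eq_square algebra_simps)
  qed
  show "e5\<^sup>2 * \<theta>4 / (\<theta>2\<^sup>2 * \<theta>3) = \<theta>3 / (\<theta>1 * \<theta>2) - Y 1 / \<theta>4"
  "e5\<^sup>2 / (\<theta>2 * \<theta>3) + Y 1 * \<theta>2 / \<theta>4\<^sup>2 = \<theta>3 / (\<theta>1 * \<theta>4)"
  "e5\<^sup>2 * \<theta>1 * \<theta>4 / (\<theta>2\<^sup>2 * \<theta>3\<^sup>2) - 1 / \<theta>2 = - Y 1 * \<theta>1 / (\<theta>3 * \<theta>4)"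
  proof -
    have e: "e5\<^sup>2 = (\<theta>3\<^sup>2 * \<theta>2 * \<theta>4 - Y 1 * \<theta>1 * \<theta>2\<^sup>2 * \<theta>3) / (\<theta>1 * \<theta>4\<^sup>2)"
      using theta_relation_2 by (simp add: field_simps)
    show "e5\<^sup>2 * \<theta>4 / (\<theta>2\<^sup>2 * \<theta>3) = \<theta>3 / (\<theta>1 * \<theta>2) - Y 1 / \<theta>4"
      unfolding e by (simp add: divide_simps) (simp add: power2_eq_square algebra_simps)
    show "e5\<^sup>2 / (\<theta>2 * \<theta>3) + Y 1 * \<theta>2 / \<theta>4\<^sup>2 = \<theta>3 / (\<theta>1 * \<theta>4)"
      unfolding e by (simp add: divide_simps) (simp add: power2_eq_square algebra_simps)
    show "e5\<^sup>2 * \<theta>1 * \<theta>4 / (\<theta>2\<^sup>2 * \<theta>3\<^sup>2) - 1 / \<theta>2 = - Y 1 * \<theta>1 / (\<theta>3 * \<theta>4)"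
      unfolding e by (simp add: divide_simps) (simp add: power2_eq_square algebra_simps)
  qed
qed

text \<open>Exponents 1 modulo 5, with x^3 * x^3 = x * Y 1. All products are combinations of
  \<Theta>, the product side of \<open>lambert_1\<close>, and W; both cancel in the end.\<close>

lemma residue_1:
  "- A * R1 + B * R0 c - Y 1 * C * R3 c = (2 - c) * (- Y 2 * S (Y 13) (Y 2) - Y 5 * S (Y 17) (Y 4))"
proof -
  define \<Theta> where "\<Theta> = E\<^sup>2 * (\<theta>3 / (\<theta>1 * \<theta>2))"
  define W where "W = E\<^sup>2 * (Y 1 / \<theta>4)"
  have 1: "A * R1 = \<Theta> - W"
  proof -
    have "A * R1 = E\<^sup>2 * (e5\<^sup>2 * \<theta>4 / (\<theta>2\<^sup>2 * \<theta>3))"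
      unfolding A_eq R1_def by (simp add: power2_eq_square field_simps)
    thus ?thesis unfolding theta_quotients(4) \<Theta>_def W_def by (simp add: algebra_simps)
  qed
  have 2: "B * (E * e5 * \<theta>3 / (\<theta>1 * \<theta>4)) = \<Theta> + W"
  proof -
    have "B * (E * e5 * \<theta>3 / (\<theta>1 * \<theta>4)) = E\<^sup>2 * (e5\<^sup>2 * \<theta>2 * \<theta>3 / (\<theta>1\<^sup>2 * \<theta>4\<^sup>2))"
      unfolding B_eq by (simp add: power2_eq_square field_simps)
    also have "e5\<^sup>2 * \<theta>2 * \<theta>3 / (\<theta>1\<^sup>2 * \<theta>4\<^sup>2) = \<theta>3 / (\<theta>1 * \<theta>2) + Y 1 / \<theta>4"
      using theta_quotients(2) by (simp only: diff_eq_eq)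
    finally show ?thesis unfolding \<Theta>_def W_def by (simp add: algebra_simps)
  qed
  have 3: "Y 1 * C * R3 c = c * W"
    unfolding C_eq R3_def W_def by (simp add: power2_eq_square field_simps)
  have 4: "B / C * S (Y 5) (Y 2) = \<Theta> - Y 2 * S (Y 13) (Y 2) - Y 5 * S (Y 17) (Y 4)"
    using lambert_1 by (simp add: \<Theta>_def algebra_simps)
  have "B * R0 c = (2 - c) * (B / C * S (Y 5) (Y 2)) - (1 - c) * (B * (E * e5 * \<theta>3 / (\<theta>1 * \<theta>4)))"
    unfolding R0_def by (simp add: algebra_simps add_divide_distrib diff_divide_distrib)
  also have "\<dots> = (2 - c) * (\<Theta> - Y 2 * S (Y 13) (Y 2) - Y 5 * S (Y 17) (Y 4)) - (1 - c) * (\<Theta> + W)"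
    unfolding 2 4 ..
  finally have 5: "B * R0 c = (2 - c) * (\<Theta> - Y 2 * S (Y 13) (Y 2) - Y 5 * S (Y 17) (Y 4)) - (1 - c) * (\<Theta> + W)" .
  have "- A * R1 + B * R0 c - Y 1 * C * R3 c = - (\<Theta> - W) + B * R0 c - c * W"
    unfolding 1[symmetric] 3 by simp
  thus ?thesis unfolding 5 by (simp add: algebra_simps)
qed

text \<open>Here and in \<open>residue_3\<close> the same Lambert sum stands on both sides, since
  the factor \<open>C\<close> cancels the denominator of \<open>R4\<close> or \<open>R0\<close>; the
  rest is a matter of theta quotients.\<close>

lemma residue_2: "A * R2 c - B * R1 + Y 1 * C * R4 c = - (1 + 2 * c) * Y 4 * S (Y 15) (Y 4)"
proof -
  have 1: "A * (E * \<theta>3 / (e5 * \<theta>2)) - B * R1 + Y 1 * C * (E * e5 * \<theta>1 / (\<theta>2 * \<theta>3)) = 0"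
  proof -
    have "A * (E * \<theta>3 / (e5 * \<theta>2)) - B * R1 + Y 1 * C * (E * e5 * \<theta>1 / (\<theta>2 * \<theta>3)) =
       E\<^sup>2 * (\<theta>4 / \<theta>2\<^sup>2 - e5\<^sup>2 / (\<theta>1 * \<theta>4) + Y 1 * \<theta>1 / (\<theta>2 * \<theta>3))"
      unfolding A_eq B_eq C_eq R1_def by (simp add: power2_eq_square field_simps)
    thus ?thesis unfolding theta_quotients(1) by simp
  qed
  have 2: "A * (E * \<theta>1 / (e5 * \<theta>4)) = C * (E * e5 * \<theta>1 / (\<theta>2 * \<theta>3))"
    unfolding A_eq C_eq by (simp add: power2_eq_square field_simps)
  have 3: "Y 1 * C * (Y 3 * S (Y 15) (Y 4) / C) = Y 4 * S (Y 15) (Y 4)"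
    by (simp add: field_simps)
  have "A * R2 c - B * R1 + Y 1 * C * R4 c =
    (A * (E * \<theta>3 / (e5 * \<theta>2)) - B * R1 + Y 1 * C * (E * e5 * \<theta>1 / (\<theta>2 * \<theta>3)))
     - c * Y 1 * (A * (E * \<theta>1 / (e5 * \<theta>4))) + c * Y 1 * (C * (E * e5 * \<theta>1 / (\<theta>2 * \<theta>3)))
     - (1 + 2 * c) * (Y 1 * C * (Y 3 * S (Y 15) (Y 4) / C))"
    unfolding R2_def R4_def by (simp add: algebra_simps add_divide_distrib diff_divide_distrib)
  thus ?thesis unfolding 1 2 3 by (simp add: algebra_simps)
qed

lemma residue_3: "- A * R3 c + B * R2 c + C * R0 c = (2 - c) * S (Y 5) (Y 2)"
proof -
  have 1: "A * (E * e5 / \<theta>4) + Y 1 * (B * (E * \<theta>1 / (e5 * \<theta>4))) = C * (E * e5 * \<theta>3 / (\<theta>1 * \<theta>4))"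
  proof -
    have "A * (E * e5 / \<theta>4) + Y 1 * (B * (E * \<theta>1 / (e5 * \<theta>4))) = E\<^sup>2 * (e5\<^sup>2 / (\<theta>2 * \<theta>3) + Y 1 * \<theta>2 / \<theta>4\<^sup>2)"
      unfolding A_eq B_eq by (simp add: power2_eq_square field_simps)
    also have "\<dots> = C * (E * e5 * \<theta>3 / (\<theta>1 * \<theta>4))"
      unfolding theta_quotients(5) C_eq by (simp add: power2_eq_square field_simps)
    finally show ?thesis .
  qed
  have 2: "B * (E * \<theta>3 / (e5 * \<theta>2)) = C * (E * e5 * \<theta>3 / (\<theta>1 * \<theta>4))"
    unfolding B_eq C_eq by (simp add: power2_eq_square field_simps)
  have 3: "C * (S (Y 5) (Y 2) / C) = S (Y 5) (Y 2)" by simp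
  have "- A * R3 c + B * R2 c + C * R0 c = (2 - c) * (C * (S (Y 5) (Y 2) / C))
     - c * (A * (E * e5 / \<theta>4) + Y 1 * (B * (E * \<theta>1 / (e5 * \<theta>4)))) + B * (E * \<theta>3 / (e5 * \<theta>2)) - (1 - c) * (C * (E * e5 * \<theta>3 / (\<theta>1 * \<theta>4)))"
    unfolding R0_def R2_def R3_def by (simp add: algebra_simps add_divide_distrib diff_divide_distrib)
  thus ?thesis unfolding 1 2 3 by (simp add: algebra_simps add_divide_distrib diff_divide_distrib)
qed

text \<open>Both combinations of products equal the product side of \<open>lambert_4\<close>; so
  everything collapses to a multiple of 1 + 2 c.\<close>

lemma residue_4: "A * R4 c - B * R3 c - C * R1 = (1 + 2 * c) * (- Y 1 * S (Y 11) (Y 2) + Y 2 * S (Y 11) (Y 4))"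
proof -
  define \<Theta> where "\<Theta> = E\<^sup>2 * (- Y 1 * \<theta>1 / (\<theta>3 * \<theta>4))"
  have 1: "A * (E * e5 * \<theta>1 / (\<theta>2 * \<theta>3)) - C * R1 = \<Theta>"
    unfolding A_eq C_eq R1_def \<Theta>_def theta_quotients(6)[symmetric] by (simp add: power2_eq_square field_simps)
  have 2: "C * R1 - B * (E * e5 / \<theta>4) = \<Theta>"
    unfolding B_eq C_eq R1_def \<Theta>_def theta_quotients(3)[symmetric] by (simp add: power2_eq_square field_simps)
  have 3: "Y 3 * (A / C) * S (Y 15) (Y 4) = \<Theta> + Y 1 * S (Y 11) (Y 2) - Y 2 * S (Y 11) (Y 4)"
    using lambert_4 by (simp add: \<Theta>_def algebra_simps)
  have "A * R4 c - B * R3 c - C * R1 = (1 + 2 * c) * (A * (E * e5 * \<theta>1 / (\<theta>2 * \<theta>3)) - C * R1) + c * ((C * R1 - B * (E * e5 / \<theta>4)) - (A * (E * e5 * \<theta>1 / (\<theta>2 * \<theta>3)) - C * R1)) - (1 + 2 * c) * (Y 3 * (A / C) * S (Y 15) (Y 4))"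
    unfolding R4_def R3_def by (simp add: algebra_simps add_divide_distrib diff_divide_distrib)
  thus ?thesis unfolding 1 2 3 by (simp add: algebra_simps)
qed

end

section \<open>Dissection modulo five\<close>

text \<open>The representatives are symmetric around 0, which keeps the exponents small and lets
  reflection relate the classes j and -j.\<close>

lemma has_sum_mod_5:
  fixes f :: "int \<Rightarrow> complex"
  assumes "\<And>j. j \<in> {-2..2} \<Longrightarrow> ((\<lambda>k. f (5 * k + j)) has_sum s j) UNIV"
  shows "(f has_sum (s (-2) + s (-1) + s 0 + s 1 + s 2)) UNIV"
proof -
  have "(f has_sum (\<Sum>j\<in>{-2..2}. s j)) (\<Union>j\<in>{-2..2}. range (\<lambda>k. 5 * k + j))"
  proof (rule sum_has_sum)
    fix j :: int assume j: "j \<in> {-2..2}"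
    show "(f has_sum s j) (range (\<lambda>k. 5 * k + j))"
      using assms[OF j] by (subst has_sum_reindex) (auto simp: inj_on_def o_def)
  next
    fix i j :: int assume "i \<in> {-2..2}" "j \<in> {-2..2}" "i \<noteq> j"
    hence "j - i \<noteq> 0" "- 4 \<le> j - i" "j - i \<le> 4" by auto
    moreover have "d = 0" if "5 * m = d" "- 4 \<le> d" "d \<le> 4" for m d :: int
      using that by presburger
    ultimately have "5 * (k - l) \<noteq> j - i" for k l by metis
    moreover have "5 * (k - l) = j - i" if "5 * k + i = 5 * l + j" for k l using that by simp
    ultimately show "range (\<lambda>k. 5 * k + i) \<inter> range (\<lambda>k. 5 * k + j) = {}"
      by blast
  qed auto
  moreover have "(\<Union>j\<in>{-2..2}. range (\<lambda>k. 5 * k + j)) = (UNIV :: int set)"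
  proof (intro equalityI subsetI)
    fix n :: int
    have "n = 5 * ((n + 2) div 5) + ((n + 2) mod 5 - 2)" by presburger
    moreover have "(n + 2) mod 5 - 2 \<in> {-2..2}" by auto
    ultimately show "n \<in> (\<Union>j\<in>{-2..2}. range (\<lambda>k. 5 * k + j))" by blast
  qed auto
  moreover have "{-2..2} = {-2, -1, 0, 1, 2 :: int}" by auto
  ultimately show ?thesis by (simp add: add_ac)
qed

lemma coeffs_eq_0_of_fifth_roots:
  fixes c :: "nat \<Rightarrow> complex"
  assumes "\<And>z. z ^ 5 = 1 \<Longrightarrow> (\<Sum>d\<le>4. c d * z ^ d) = 0" "d \<le> 4"
  shows "c d = 0"
proof (rule ccontr)
  assume "c d \<noteq> 0"
  hence "finite {z. (\<Sum>d\<le>4. c d * z ^ d) = 0}" "card {z. (\<Sum>d\<le>4. c d * z ^ d) = 0} \<le> 4"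
    using Transcendental.polyfun_rootbound[of c d 4] assms(2) by auto
  moreover have "{z. z ^ 5 = 1} \<subseteq> {z. (\<Sum>d\<le>4. c d * z ^ d) = 0}" using assms(1) by auto
  ultimately have "card {z :: complex. z ^ 5 = 1} \<le> 4" by (meson card_mono le_trans)
  thus False using card_roots_unity_eq[of 5] by simp
qed

text \<open>The four primitive roots determine a polynomial of degree 4 only up to a multiple of 1 +
  z + ... + z^4. Subtracting c 4 times this polynomial leaves degree 3, too small for four
  zeros.\<close>

lemma coeffs_eq_of_primitive_fifth_roots:
  fixes c :: "nat \<Rightarrow> complex"
  assumes "\<And>z. z ^ 5 = 1 \<Longrightarrow> z \<noteq> 1 \<Longrightarrow> (\<Sum>d\<le>4. c d * z ^ d) = 0" "d \<le> 4"
  shows "c d = c 4"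
proof (rule ccontr)
  assume "c d \<noteq> c 4"
  hence d: "d \<le> 3" "c d - c 4 \<noteq> 0" using assms(2) by (auto simp: le_Suc_eq numeral_eq_Suc)
  hence "finite {z. (\<Sum>d\<le>3. (c d - c 4) * z ^ d) = 0}" "card {z. (\<Sum>d\<le>3. (c d - c 4) * z ^ d) = 0} \<le> 3"
    using Transcendental.polyfun_rootbound[of "\<lambda>d. c d - c 4" d 3] by auto
  moreover have "{z. z ^ 5 = 1} - {1} \<subseteq> {z. (\<Sum>d\<le>3. (c d - c 4) * z ^ d) = 0}"
  proof
    fix z :: complex assume "z \<in> {z. z ^ 5 = 1} - {1}"
    hence z: "z ^ 5 = 1" "z \<noteq> 1" by auto
    have "(1 - z) * (1 + z + z ^ 2 + z ^ 3 + z ^ 4) = 1 - z ^ 5"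
      by (simp add: algebra_simps power_numeral_reduce)
    hence "1 + z + z ^ 2 + z ^ 3 + z ^ 4 = 0" using z by simp
    moreover have "(\<Sum>d\<le>4. c d * z ^ d) = (\<Sum>d\<le>3. (c d - c 4) * z ^ d) + c 4 * (1 + z + z ^ 2 + z ^ 3 + z ^ 4)"
      by (simp add: numeral_eq_Suc algebra_simps)
    ultimately show "z \<in> {z. (\<Sum>d\<le>3. (c d - c 4) * z ^ d) = 0}" using assms(1)[OF z] by simp
  qed
  ultimately have "card ({z :: complex. z ^ 5 = 1} - {1}) \<le> 3" by (meson card_mono le_trans)
  moreover have "card ({z :: complex. z ^ 5 = 1} - {1}) = 4"
    using card_roots_unity_eq[of 5] by (subst card_Diff_singleton) auto
  ultimately show False by simp
qed

context level10
begin

context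
  fixes x :: complex
  assumes x5: "x ^ 5 = y"
begin

lemma x_nz: "x \<noteq> 0" using x5 y_nz by auto

lemma norm_x: "norm x < 1"
proof -
  have "norm x ^ 5 < 1" using x5 norm_y by (metis norm_power)
  thus ?thesis by (simp add: power_less_one_iff)
qed

lemma x_powi_5: "x powi (5 * n) = Y n"
proof -
  have "Y n = (x ^ 5) powi n" by (simp only: Y_def x5)
  thus ?thesis by (simp add: power_int_power)
qed

lemma x_powi_add_5: "x powi (n + 5 * m) = x powi n * Y m"
  using x_nz by (simp add: power_int_add x_powi_5)

lemma nome_x2: "nome (x\<^sup>2)"
  using x_nz norm_x by unfold_locales (auto simp: norm_power power_less_one_iff)

interpretation N: nome "x\<^sup>2" by (rule nome_x2)

lemma theta_term: "(x\<^sup>2) powi (n\<^sup>2) * x powi n = x powi (2 * n\<^sup>2 + n)"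
  using x_nz by (simp add: power_int_power power_int_add)

lemma p_powi_Y: "p powi n = Y (10 * n)"
  by (simp add: p_eq_Y Y_def power_int_mult)

lemma Y_powi: "Y m powi n = Y (m * n)"
  by (simp add: Y_def power_int_mult)

lemma theta_exponent: "x powi (2 * (5 * k + j)\<^sup>2 + (5 * k + j)) = x powi (2 * j\<^sup>2 + j) * (p powi (k\<^sup>2) * Y (4 * j + 1) powi k)"
proof -
  have "2 * (5 * k + j)\<^sup>2 + (5 * k + j) = (2 * j\<^sup>2 + j) + 5 * (10 * k\<^sup>2 + (4 * j + 1) * k)"
    by (simp add: power2_eq_square algebra_simps)
  thus ?thesis by (simp only: x_powi_add_5 p_powi_Y Y_powi Y_mult)
qed

text \<open>For n = -2, ..., 2 the exponent 2 n^2 + n is 6, 1, 0, 3, 10, so the classes 2 and 4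
  modulo 5 are empty and two pairs of theta series merge into \<open>A\<close> and
  \<open>B\<close>.\<close>

lemma psi_dissection: "N.tau x = A + x * B + x ^ 3 * C"
proof -
  have "((\<lambda>n. x powi (2 * n\<^sup>2 + n)) has_sum N.tau x) UNIV"
    using N.has_sum_tau[OF x_nz] by (simp only: theta_term)
  moreover have "((\<lambda>k. x powi (2 * (5 * k + j)\<^sup>2 + (5 * k + j))) has_sum (x powi (2 * j\<^sup>2 + j) * tau (Y (4 * j + 1)))) UNIV" for j
    unfolding theta_exponent by (intro has_sum_cmult_right has_sum_tau) simp
  from has_sum_mod_5[OF this]
  have "((\<lambda>n. x powi (2 * n\<^sup>2 + n)) has_sum (x ^ 6 * tau (Y (-7)) + x * tau (Y (-3)) + tau (Y 1) + x ^ 3 * tau (Y 5) + x ^ 10 * tau (Y 9))) UNIV"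
    by simp
  ultimately have "N.tau x = x ^ 6 * tau (Y (-7)) + x * tau (Y (-3)) + tau (Y 1) + x ^ 3 * tau (Y 5) + x ^ 10 * tau (Y 9)"
    by (rule has_sum_unique)
  moreover have "tau (Y (-7)) = Y 3 * tau (Y 13)" using tau_Y_shift[of "-7"] by simp
  moreover have "x ^ 6 = x * Y 1" "x ^ 10 = Y 2"
    using x_powi_add_5[of 1 1] x_powi_5[of 2] by simp_all
  ultimately show ?thesis by (simp add: A_def B_def C_def algebra_simps)
qed

lemma x_powi_10_neq_1: "n \<noteq> 0 \<Longrightarrow> x powi (10 * n) \<noteq> 1"
  using N.p_powi_eq_1_iff[of "5 * n"] by (simp add: power_int_power)

text \<open>Such sums arise from expanding 1 / (1 - z v) with v = x^(2 n) and z^5 = 1; b is the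
  power of v. The term n = 0 has denominator 0 and counts as 0. The classes -1 and -2 are reflected,
  which produces the minus signs.\<close>

lemma lambert_has_sum:
  fixes b :: int
  shows "((\<lambda>n. x powi (2 * n\<^sup>2 + n + 2 * n * b) / (1 - x powi (10 * n))) has_sum
    (- (x powi (6 - 4 * b)) * Y 4 * S (Y (17 - 2 * b)) (Y 4) - x powi (1 - 2 * b) * Y 2 * S (Y (13 - 2 * b)) (Y 2) + S (Y (1 + 2 * b)) 1
     + x powi (3 + 2 * b) * S (Y (5 + 2 * b)) (Y 2) + x powi (10 + 4 * b) * S (Y (9 + 2 * b)) (Y 4))) UNIV"
proof -
  have "((\<lambda>k. x powi (2 * (5 * k + j)\<^sup>2 + (5 * k + j) + 2 * (5 * k + j) * b) / (1 - x powi (10 * (5 * k + j)))) has_sum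
          (x powi (2 * j\<^sup>2 + j + 2 * j * b) * S (Y (4 * j + 1 + 2 * b)) (Y (2 * j)))) UNIV" for j
  proof -
    have e: "x powi (2 * (5 * k + j)\<^sup>2 + (5 * k + j) + 2 * (5 * k + j) * b) = x powi (2 * j\<^sup>2 + j + 2 * j * b) * (p powi (k\<^sup>2) * Y (4 * j + 1 + 2 * b) powi k)" for k
    proof -
      have "2 * (5 * k + j)\<^sup>2 + (5 * k + j) + 2 * (5 * k + j) * b = (2 * j\<^sup>2 + j + 2 * j * b) + 5 * (10 * k\<^sup>2 + (4 * j + 1 + 2 * b) * k)"
        by (simp add: power2_eq_square algebra_simps)
      thus ?thesis by (simp only: x_powi_add_5 p_powi_Y Y_powi Y_mult)
    qed
    have e': "x powi (10 * (5 * k + j)) = Y (2 * j) * p powi k" for k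
    proof -
      have "10 * (5 * k + j) = 5 * (2 * j + 10 * k)" by simp
      thus ?thesis by (simp only: x_powi_5 p_powi_Y Y_mult)
    qed
    have "((\<lambda>k. x powi (2 * j\<^sup>2 + j + 2 * j * b) * (p powi (k\<^sup>2) * Y (4 * j + 1 + 2 * b) powi k / (1 - Y (2 * j) * p powi k))) has_sum
          (x powi (2 * j\<^sup>2 + j + 2 * j * b) * S (Y (4 * j + 1 + 2 * b)) (Y (2 * j)))) UNIV"
      by (intro has_sum_cmult_right has_sum_S) auto
    thus ?thesis by (simp only: e e' times_divide_eq_right)
  qed
  from has_sum_mod_5[OF this]
  show ?thesis
    using S_Y_reflect[of "-7 + 2 * b" "-4"] S_Y_reflect[of "-3 + 2 * b" "-2"] by (simp add: algebra_simps)
qed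

lemma lambert_dissection:
  assumes z: "z ^ 5 = 1" "z \<noteq> 1"
  shows "(1 - z) * N.S x z = 1 + (2 - (z + z ^ 4)) * (S (Y 1) 1 + Y 2 * S (Y 9) (Y 4) + x ^ 3 * S (Y 5) (Y 2) - x * Y 2 * S (Y 13) (Y 2) - x * Y 5 * S (Y 17) (Y 4))
     + (1 + 2 * (z + z ^ 4)) * (S (Y 3) 1 + Y 1 * S (Y 7) (Y 2) - x ^ 4 * Y 1 * S (Y 11) (Y 2) + x ^ 4 * Y 2 * S (Y 11) (Y 4) - x ^ 2 * Y 4 * S (Y 15) (Y 4))"
proof -
  have z0: "z \<noteq> 0" using z by auto
  have "(1 - z) * (1 + z + z ^ 2 + z ^ 3 + z ^ 4) = 1 - z ^ 5"
    by (simp add: algebra_simps power_numeral_reduce)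
  hence cyc: "1 + z + z ^ 2 + z ^ 3 + z ^ 4 = 0" using z by simp
  \<comment> \<open>As z^5 = 1, the fraction 1 / (1 - z v) is the sum of z^b v^b / (1 - v^5) over b
    = 0, ..., 4; \<open>g b\<close> is the part belonging to v^b.\<close>
  define g where "g = (\<lambda>(b::nat) n. x powi (2 * n\<^sup>2 + n + 2 * n * int b) / (1 - x powi (10 * n)))"
  define s where "s = (\<lambda>b::nat. - (x powi (6 - 4 * int b)) * Y 4 * S (Y (17 - 2 * int b)) (Y 4) - x powi (1 - 2 * int b) * Y 2 * S (Y (13 - 2 * int b)) (Y 2) + S (Y (1 + 2 * int b)) 1
     + x powi (3 + 2 * int b) * S (Y (5 + 2 * int b)) (Y 2) + x powi (10 + 4 * int b) * S (Y (9 + 2 * int b)) (Y 4))"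
  have g: "(g b has_sum s b) UNIV" for b
    unfolding g_def s_def using lambert_has_sum[of "int b"] .
  \<comment> \<open>The term n = 0 is 0 in every \<open>g b\<close>, whereas its true value is (1 -
    z) / (1 - z) = 1; the indicator restores it.\<close>
  have "((\<lambda>n::int. of_bool (n = 0) :: complex) has_sum 1) UNIV"
    by (rule has_sum_finite_neutralI[of "{0}"]) auto
  hence "((\<lambda>n. of_bool (n = 0) + (1 - z) * (z ^ 0 * g 0 n + z ^ 1 * g 1 n + z ^ 2 * g 2 n + z ^ 3 * g 3 n + z ^ 4 * g 4 n)) has_sum
      (1 + (1 - z) * (z ^ 0 * s 0 + z ^ 1 * s 1 + z ^ 2 * s 2 + z ^ 3 * s 3 + z ^ 4 * s 4))) UNIV"
    by (intro has_sum_add has_sum_cmult_right g)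
  moreover have "of_bool (n = 0) + (1 - z) * (z ^ 0 * g 0 n + z ^ 1 * g 1 n + z ^ 2 * g 2 n + z ^ 3 * g 3 n + z ^ 4 * g 4 n) =
     (1 - z) * ((x\<^sup>2) powi (n\<^sup>2) * x powi n / (1 - z * (x\<^sup>2) powi n))" for n
  proof (cases "n = 0")
    case True
    thus ?thesis using z by (simp add: g_def)
  next
    case False
    define v where "v = x powi (2 * n)"
    have v: "(x\<^sup>2) powi n = v" by (simp add: v_def power_int_power)
    have v5: "x powi (10 * n) = v ^ 5"
      using power_int_power'[of x "2 * n" 5] by (simp add: v_def mult.commute)
    have "v ^ 5 \<noteq> 1" using x_powi_10_neq_1[OF False] v5 by simp
    hence nz: "1 - v ^ 5 \<noteq> 0" by simp
    have fac: "(1 - z * v) * (1 + z * v + z ^ 2 * v ^ 2 + z ^ 3 * v ^ 3 + z ^ 4 * v ^ 4) = 1 - v ^ 5"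
    proof -
      have "(1 - z * v) * (1 + z * v + z ^ 2 * v ^ 2 + z ^ 3 * v ^ 3 + z ^ 4 * v ^ 4) = 1 - z ^ 5 * v ^ 5"
        by (simp add: algebra_simps power_numeral_reduce)
      thus ?thesis using z by simp
    qed
    hence nz': "1 - z * v \<noteq> 0" using nz by auto
    have gb: "g b n = x powi (2 * n\<^sup>2 + n) * v ^ b / (1 - v ^ 5)" for b
      unfolding g_def v5 v_def using x_nz by (simp add: power_int_add power_int_power')
    have "z ^ 0 * g 0 n + z ^ 1 * g 1 n + z ^ 2 * g 2 n + z ^ 3 * g 3 n + z ^ 4 * g 4 n =
       x powi (2 * n\<^sup>2 + n) * (1 + z * v + z ^ 2 * v ^ 2 + z ^ 3 * v ^ 3 + z ^ 4 * v ^ 4) / (1 - v ^ 5)"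
      unfolding gb by (simp add: algebra_simps add_divide_distrib)
    also have "\<dots> = x powi (2 * n\<^sup>2 + n) / (1 - z * v)"
    proof -
      have "a * b / d = a / e" if "e * b = d" "d \<noteq> 0" for a b d e :: complex
        using that by auto
      from this[OF fac nz] show ?thesis .
    qed
    finally show ?thesis using False by (simp add: theta_term v)
  qed
  ultimately have "((\<lambda>n. (1 - z) * ((x\<^sup>2) powi (n\<^sup>2) * x powi n / (1 - z * (x\<^sup>2) powi n))) has_sum
      (1 + (1 - z) * (z ^ 0 * s 0 + z ^ 1 * s 1 + z ^ 2 * s 2 + z ^ 3 * s 3 + z ^ 4 * s 4))) UNIV"
    by (simp only:)
  moreover have "((\<lambda>n. (1 - z) * ((x\<^sup>2) powi (n\<^sup>2) * x powi n / (1 - z * (x\<^sup>2) powi n))) has_sum ((1 - z) * N.S x z)) UNIV"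
    using N.has_sum_S[OF x_nz z0] by (rule has_sum_cmult_right)
  ultimately have "(1 - z) * N.S x z = 1 + (1 - z) * (z ^ 0 * s 0 + z ^ 1 * s 1 + z ^ 2 * s 2 + z ^ 3 * s 3 + z ^ 4 * s 4)"
    by (rule has_sum_unique[symmetric])
  \<comment> \<open>The substitution n -> -n turns b into 4 - b with a minus sign: s 4 = - s 0, s 3
    = - s 1 and s 2 = 0, so only two of the five sums remain.\<close>
  moreover have "z ^ 0 * s 0 + z ^ 1 * s 1 + z ^ 2 * s 2 + z ^ 3 * s 3 + z ^ 4 * s 4 =
     (1 - z ^ 4) * (S (Y 1) 1 + Y 2 * S (Y 9) (Y 4) + x ^ 3 * S (Y 5) (Y 2) - x * Y 2 * S (Y 13) (Y 2) - x * Y 5 * S (Y 17) (Y 4))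
     + (z - z ^ 3) * (S (Y 3) 1 + Y 1 * S (Y 7) (Y 2) - x ^ 4 * Y 1 * S (Y 11) (Y 2) + x ^ 4 * Y 2 * S (Y 11) (Y 4) - x ^ 2 * Y 4 * S (Y 15) (Y 4))"
  proof -
    have xp: "x powi 6 = x * Y 1" "x powi 2 = x ^ 2" "x powi (-2) = x ^ 3 * Y (-1)" "x powi (-6) = x ^ 4 * Y (-2)" "x powi (-10) = Y (-2)"
      "x powi 1 = x" "x powi (-1) = x ^ 4 * Y (-1)" "x powi (-3) = x ^ 2 * Y (-1)" "x powi (-5) = Y (-1)" "x powi (-7) = x ^ 3 * Y (-2)"
      "x powi 3 = x ^ 3" "x powi 5 = Y 1" "x powi 7 = x ^ 2 * Y 1" "x powi 9 = x ^ 4 * Y 1" "x powi 11 = x * Y 2"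
      "x powi 10 = Y 2" "x powi 14 = x ^ 4 * Y 2" "x powi 18 = x ^ 3 * Y 3" "x powi 22 = x ^ 2 * Y 4" "x powi 26 = x * Y 5"
      using x_powi_add_5[of 1 1] x_powi_add_5[of 3 "-1"] x_powi_add_5[of 4 "-2"] x_powi_5[of "-2"] x_powi_add_5[of 4 "-1"] x_powi_add_5[of 2 "-1"]
         x_powi_5[of "-1"] x_powi_add_5[of 3 "-2"] x_powi_5[of 1] x_powi_add_5[of 2 1] x_powi_add_5[of 4 1] x_powi_add_5[of 1 2] x_powi_5[of 2]
         x_powi_add_5[of 4 2] x_powi_add_5[of 3 3] x_powi_add_5[of 2 4] x_powi_add_5[of 1 5] by simp_all
    have T9: "S (Y 9) 1 = - S (Y 1) 1" using S_Y_reflect[of 9 0] by simp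
    have T7: "S (Y 7) 1 = - S (Y 3) 1" using S_Y_reflect[of 7 0] by simp
    have T5: "S (Y 5) 1 = 0"
    proof -
      have "S (Y 5) 1 + S (Y 5) 1 = 0" using S_Y_reflect[of 5 0] by simp
      thus ?thesis by (simp flip: mult_2)
    qed
    have s0: "s 0 = - x * Y 5 * S (Y 17) (Y 4) - x * Y 2 * S (Y 13) (Y 2) + S (Y 1) 1 + x ^ 3 * S (Y 5) (Y 2) + Y 2 * S (Y 9) (Y 4)"
      unfolding s_def by (simp add: xp mult.assoc del: power_int_numeral power_int_minus1_right)
    have s1: "s 1 = - (x ^ 2) * Y 4 * S (Y 15) (Y 4) - x ^ 4 * Y 1 * S (Y 11) (Y 2) + S (Y 3) 1 + Y 1 * S (Y 7) (Y 2) + x ^ 4 * Y 2 * S (Y 11) (Y 4)"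
      unfolding s_def by (simp add: xp mult.assoc del: power_int_numeral power_int_minus1_right)
    have s2: "s 2 = - (x ^ 3) * Y 3 * S (Y 13) (Y 4) - x ^ 2 * Y 1 * S (Y 9) (Y 2) + x ^ 2 * Y 1 * S (Y 9) (Y 2) + x ^ 3 * Y 3 * S (Y 13) (Y 4)"
      unfolding s_def by (simp add: xp mult.assoc T5 del: power_int_numeral power_int_minus1_right)
    have s3: "s 3 = - (x ^ 4) * Y 2 * S (Y 11) (Y 4) - Y 1 * S (Y 7) (Y 2) - S (Y 3) 1 + x ^ 4 * Y 1 * S (Y 11) (Y 2) + x ^ 2 * Y 4 * S (Y 15) (Y 4)"
      unfolding s_def by (simp add: xp mult.assoc T7 del: power_int_numeral power_int_minus1_right)
    have s4: "s 4 = - Y 2 * S (Y 9) (Y 4) - x ^ 3 * S (Y 5) (Y 2) - S (Y 1) 1 + x * Y 2 * S (Y 13) (Y 2) + x * Y 5 * S (Y 17) (Y 4)"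
      unfolding s_def by (simp add: xp mult.assoc T9 del: power_int_numeral power_int_minus1_right)
    show ?thesis unfolding s0 s1 s2 s3 s4 by (simp add: algebra_simps)
  qed
  moreover have "(1 - z) * (1 - z ^ 4) = 2 - (z + z ^ 4)"
    using z(1) by (simp add: algebra_simps power_numeral_reduce)
  moreover have "(1 - z) * (z - z ^ 3) = 1 + 2 * (z + z ^ 4)"
  proof -
    have "(1 - z) * (z - z ^ 3) = 1 + 2 * (z + z ^ 4) - (1 + z + z ^ 2 + z ^ 3 + z ^ 4)"
      by (simp add: algebra_simps power_numeral_reduce)
    thus ?thesis using cyc by simp
  qed
  ultimately show ?thesis
    by (simp only: distrib_left mult.assoc[symmetric] add.assoc[symmetric])
qed

text \<open>The alternating signs are those of q^d = (-x)^d. The right-hand side times \<psi> is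
  compared with the dissected Lambert sum, one power of x at a time.\<close>

lemma rank_series_eq:
  assumes z: "z ^ 5 = 1" "z \<noteq> 1"
  shows "1 + (\<Sum>s<5. (\<Sum>n. of_nat (N2_mod (int s) 5 n) * (- x) ^ n) * z ^ s) =
    R0 (z + z ^ 4) - x * R1 + x ^ 2 * R2 (z + z ^ 4) - x ^ 3 * R3 (z + z ^ 4) + x ^ 4 * R4 (z + z ^ 4)"
proof -
  define c where "c = z + z ^ 4"
  define F where "F = R0 c - x * R1 + x ^ 2 * R2 c - x ^ 3 * R3 c + x ^ 4 * R4 c"
  have x5': "x ^ 5 = Y 1" using x5 by (simp add: y_eq_Y[symmetric])
  have "N.tau x * F = (A * R0 c + x ^ 5 * B * R4 c + x ^ 5 * C * R2 c) + x * (- A * R1 + B * R0 c - x ^ 5 * C * R3 c)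
     + x ^ 2 * (A * R2 c - B * R1 + x ^ 5 * C * R4 c) + x ^ 3 * (- A * R3 c + B * R2 c + C * R0 c) + x ^ 4 * (A * R4 c - B * R3 c - C * R1)"
    unfolding psi_dissection F_def by (simp add: algebra_simps power_numeral_reduce)
  also have "\<dots> = (1 - z) * N.S x z"
    unfolding x5' residue_0 residue_1 residue_2 residue_3 residue_4 lambert_dissection[OF z] c_def[symmetric]
    by (simp add: algebra_simps)
  also have "\<dots> = N.tau x * (1 + (\<Sum>s<5. (\<Sum>n. of_nat (N2_mod (int s) 5 n) * (- x) ^ n) * z ^ s))"
    using rank_generating_function[of "- x" z] x_nz norm_x z by simp
  finally have "N.tau x * F = N.tau x * (1 + (\<Sum>s<5. (\<Sum>n. of_nat (N2_mod (int s) 5 n) * (- x) ^ n) * z ^ s))" .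
  \<comment> \<open>Gauss's product for \<psi> times \<open>qp x (x\<^sup>2)\<close> is the nonzero
    E, so \<psi> can be cancelled.\<close>
  moreover have "N.tau x \<noteq> 0"
    using N.tau_half_eq[of x] N.E_nz by (auto simp: power2_eq_square)
  ultimately show ?thesis by (simp add: F_def c_def)
qed

end

end

section \<open>Rank differences\<close>

lemma suminf_mod_5:
  fixes f :: "nat \<Rightarrow> complex"
  assumes "summable (\<lambda>n. norm (f n))"
  shows "suminf f = (\<Sum>d\<le>4. \<Sum>n. f (5 * n + d))"
proof -
  have f: "f summable_on UNIV" using assms by (rule norm_summable_imp_summable_on)
  have "(f has_sum (\<Sum>d\<le>4. \<Sum>n. f (5 * n + d))) (\<Union>d\<le>4. range (\<lambda>n. 5 * n + d))"
  proof (rule sum_has_sum)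
    fix d :: nat
    have inj: "inj (\<lambda>n. 5 * n + d)" by (auto simp: inj_on_def)
    have "f summable_on range (\<lambda>n. 5 * n + d)"
      using f by (rule summable_on_subset_banach) auto
    hence "((f \<circ> (\<lambda>n. 5 * n + d)) has_sum infsum f (range (\<lambda>n. 5 * n + d))) UNIV"
      by (subst has_sum_reindex[OF inj, symmetric]) (rule has_sum_infsum)
    from has_sum_imp_sums[OF this] have "(\<Sum>n. f (5 * n + d)) = infsum f (range (\<lambda>n. 5 * n + d))"
      unfolding o_def by (rule sums_unique[symmetric])
    thus "(f has_sum (\<Sum>n. f (5 * n + d))) (range (\<lambda>n. 5 * n + d))"
      using has_sum_infsum[OF \<open>f summable_on range (\<lambda>n. 5 * n + d)\<close>] by (simp only:)
  next
    fix d e :: nat assume "d \<in> {..4}" "e \<in> {..4}" "d \<noteq> e"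
    hence "5 * m + d \<noteq> 5 * n + e" for m n
      unfolding atMost_iff by presburger
    thus "range (\<lambda>n. 5 * n + d) \<inter> range (\<lambda>n. 5 * n + e) = {}" by blast
  qed auto
  moreover have "(\<Union>d\<le>4. range (\<lambda>n. 5 * n + d)) = (UNIV :: nat set)"
  proof (intro equalityI subsetI)
    fix n :: nat
    have "n = 5 * (n div 5) + n mod 5" by simp
    moreover have "n mod 5 \<in> {..4}" by simp
    ultimately show "n \<in> (\<Union>d\<le>4. range (\<lambda>n. 5 * n + d))" by (metis UN_iff rangeI)
  qed auto
  ultimately have "(f has_sum (\<Sum>d\<le>4. \<Sum>n. f (5 * n + d))) UNIV"
    by simp
  from has_sum_imp_sums[OF this] show ?thesis
    by (rule sums_unique[symmetric])
qed

lemma lessThan_5: "{..<5::nat} = {..4}"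
  by auto

lemma sum_atMost_4:
  fixes f :: "nat \<Rightarrow> complex"
  shows "(\<Sum>d\<le>4. f d) = f 0 + f 1 + f 2 + f 3 + f 4"
proof -
  have "{..4::nat} = {0, 1, 2, 3, 4}" by auto
  thus ?thesis by (simp add: add.assoc)
qed

lemma ex_fifth_root:
  fixes w :: complex
  assumes "w \<noteq> 0"
  shows "\<exists>x. x ^ 5 = w"
proof -
  have "card {z. z ^ 5 = w} = 5" using card_nth_roots[OF assms, of 5] by simp
  hence "{z. z ^ 5 = w} \<noteq> {}" by (metis card.empty zero_neq_numeral)
  thus ?thesis by blast
qed

text \<open>For Q = q^5 this is a subseries of a series in q, up to the factor q^d. For Q = 0, where
  q^d could not be divided out, only one term is nonzero.\<close>

lemma summable_N2_mod_progression:
  fixes Q :: complex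
  assumes "norm Q < 1"
  shows "summable (\<lambda>n. of_nat (N2_mod s 5 (5 * n + d)) * Q ^ n)"
proof (cases "Q = 0")
  case True
  have "summable (\<lambda>n. of_nat (N2_mod s 5 (5 * Suc n + d)) * Q ^ Suc n)" by (simp add: True)
  thus ?thesis by (subst (asm) summable_Suc_iff)
next
  case False
  obtain q where q: "q ^ 5 = Q" using ex_fifth_root[OF False] by blast
  have q0: "q \<noteq> 0" using q False by auto
  have "norm q ^ 5 < 1" using q assms by (metis norm_power)
  hence q1: "norm q < 1" by (simp add: power_less_one_iff)
  have "(\<lambda>n. of_nat (N2_mod s 5 n) * q ^ n) summable_on UNIV"
    using summable_N2_mod[OF q1] by (rule norm_summable_imp_summable_on)
  hence "(\<lambda>n. of_nat (N2_mod s 5 n) * q ^ n) summable_on range (\<lambda>n. 5 * n + d)"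
    by (rule summable_on_subset_banach) auto
  hence "(\<lambda>n. of_nat (N2_mod s 5 (5 * n + d)) * q ^ (5 * n + d)) summable_on UNIV"
    by (subst (asm) summable_on_reindex) (auto simp: inj_on_def o_def)
  from summable_on_imp_summable[OF this]
  have "summable (\<lambda>n. of_nat (N2_mod s 5 (5 * n + d)) * q ^ (5 * n + d) / q ^ d)"
    by (rule summable_divide)
  thus ?thesis using q0 by (simp add: power_add power_mult q)
qed

lemma R_eq:
  assumes "norm Q < 1"
  shows "R 5 s t d Q = (\<Sum>n. of_nat (N2_mod s 5 (5 * n + d)) * Q ^ n) - (\<Sum>n. of_nat (N2_mod t 5 (5 * n + d)) * Q ^ n)"
  unfolding R_def left_diff_distrib by (intro suminf_diff[symmetric] summable_N2_mod_progression assms)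

context level10
begin

definition Nsum :: "nat \<Rightarrow> nat \<Rightarrow> complex" where
  "Nsum s d = (\<Sum>n. of_nat (N2_mod (int s) 5 (5 * n + d)) * (- y) ^ n)"

text \<open>The components without the empty partition, which affects exponent 0 only; the signs
  (-1)^d are left to \<open>Nsum_eq_Rd\<close>.\<close>

definition Rd :: "nat \<Rightarrow> complex \<Rightarrow> complex" where
  "Rd d c = (if d = 0 then R0 c - 1 else if d = 1 then R1 else if d = 2 then R2 c else if d = 3 then R3 c else R4 c)"

text \<open>Replacing x by w x with w^5 = 1 leaves y, hence \<open>Nsum\<close> and
  \<open>Rd\<close>, unchanged. The identity of the rank series thus becomes a polynomial in w of
  degree at most 4 with five zeros, and the residues of the exponent separate.\<close>

lemma Nsum_eq_Rd:
  assumes z: "z ^ 5 = 1" "z \<noteq> 1" and d: "d \<le> 4"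
  shows "(\<Sum>s\<le>4. Nsum s d * z ^ s) = Rd d (z + z ^ 4)"
proof -
  obtain x where x: "x ^ 5 = y" using ex_fifth_root[OF y_nz] by blast
  have x0: "x \<noteq> 0" using x y_nz by auto
  define c where "c = z + z ^ 4"
  define h where "h d = (- x) ^ d * ((\<Sum>s\<le>4. Nsum s d * z ^ s) - Rd d c)" for d
  have "h d = 0"
  proof (rule coeffs_eq_0_of_fifth_roots[OF _ d])
    fix w :: complex assume w: "w ^ 5 = 1"
    have wx: "(w * x) ^ 5 = y" using w x by (simp add: power_mult_distrib)
    have n: "norm (- (w * x)) < 1" using norm_x[OF wx] by simp
    have "(\<Sum>n. of_nat (N2_mod (int s) 5 n) * (- (w * x)) ^ n) = (\<Sum>d\<le>4. (- x) ^ d * Nsum s d * w ^ d)" for s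
    proof -
      have "(\<Sum>n. of_nat (N2_mod (int s) 5 n) * (- (w * x)) ^ n) = (\<Sum>d\<le>4. \<Sum>n. of_nat (N2_mod (int s) 5 (5 * n + d)) * (- (w * x)) ^ (5 * n + d))"
        by (rule suminf_mod_5[OF summable_N2_mod[OF n]])
      also have "\<dots> = (\<Sum>d\<le>4. (- x) ^ d * Nsum s d * w ^ d)"
      proof (rule sum.cong)
        fix d :: nat
        have "(- (w * x)) ^ (5 * n + d) = (- y) ^ n * ((- x) ^ d * w ^ d)" for n
        proof -
          have "(- (w * x)) ^ 5 = - y" using wx by simp
          moreover have "(- (w * x)) ^ d = (- x) ^ d * w ^ d"
            by (metis mult.commute mult_minus_left power_mult_distrib)
          ultimately show ?thesis by (simp add: power_add power_mult)
        qed
        hence "(\<Sum>n. of_nat (N2_mod (int s) 5 (5 * n + d)) * (- (w * x)) ^ (5 * n + d)) = (\<Sum>n. of_nat (N2_mod (int s) 5 (5 * n + d)) * (- y) ^ n * ((- x) ^ d * w ^ d))"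
          by (simp add: mult.assoc)
        also have "\<dots> = Nsum s d * ((- x) ^ d * w ^ d)"
          unfolding Nsum_def using norm_y by (intro suminf_mult2[symmetric] summable_N2_mod_progression) auto
        finally show "(\<Sum>n. of_nat (N2_mod (int s) 5 (5 * n + d)) * (- (w * x)) ^ (5 * n + d)) = (- x) ^ d * Nsum s d * w ^ d"
          by (simp add: mult_ac)
      qed auto
      finally show ?thesis .
    qed
    hence "1 + (\<Sum>s\<le>4. (\<Sum>d\<le>4. (- x) ^ d * Nsum s d * w ^ d) * z ^ s) =
        R0 c - w * x * R1 + (w * x) ^ 2 * R2 c - (w * x) ^ 3 * R3 c + (w * x) ^ 4 * R4 c"
      using rank_series_eq[OF wx z] unfolding c_def[symmetric] lessThan_5 by simp
    also have "R0 c - w * x * R1 + (w * x) ^ 2 * R2 c - (w * x) ^ 3 * R3 c + (w * x) ^ 4 * R4 c = 1 + (\<Sum>d\<le>4. (- x) ^ d * Rd d c * w ^ d)"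
      by (simp add: sum_atMost_4 Rd_def power_mult_distrib)
    also have "(\<Sum>s\<le>4. (\<Sum>d\<le>4. (- x) ^ d * Nsum s d * w ^ d) * z ^ s) = (\<Sum>d\<le>4. (- x) ^ d * (\<Sum>s\<le>4. Nsum s d * z ^ s) * w ^ d)"
      unfolding sum_distrib_right sum_distrib_left by (subst sum.swap) (simp add: mult_ac)
    finally show "(\<Sum>d\<le>4. h d * w ^ d) = 0"
      by (simp add: h_def right_diff_distrib left_diff_distrib sum_subtractf)
  qed
  thus ?thesis using x0 by (simp add: h_def c_def)
qed

text \<open>The rank counts enter only through sums over the primitive fifth roots of unity z, which determine
  them up to a common summand.\<close>

lemma Nsum_differences:
  assumes d: "d \<le> 4" and Rd: "\<And>c. Rd d c = \<alpha> + \<beta> * c"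
  shows "Nsum 0 d - Nsum 2 d = \<alpha>" "Nsum 1 d - Nsum 2 d = \<beta>"
proof -
  \<comment> \<open>As c = z + z^4, the coefficient \<beta> belongs to s = 1 and s = 4. No
    correction is made at s = 2, which serves as the reference.\<close>
  define h where "h s = Nsum s d - (if s = 0 then \<alpha> else 0) - (if s = 1 \<or> s = 4 then \<beta> else 0)" for s
  have h: "h s = h 4" if "s \<le> 4" for s
  proof (rule coeffs_eq_of_primitive_fifth_roots[OF _ that])
    fix z :: complex assume z: "z ^ 5 = 1" "z \<noteq> 1"
    have "(\<Sum>s\<le>4. h s * z ^ s) = (\<Sum>s\<le>4. Nsum s d * z ^ s) - (\<alpha> + \<beta> * (z + z ^ 4))"
      unfolding sum_atMost_4 by (simp add: h_def algebra_simps)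
    thus "(\<Sum>s\<le>4. h s * z ^ s) = 0" using Nsum_eq_Rd[OF z d] Rd by simp
  qed
  have "h 0 = h 2" "h 1 = h 2"
    using h[of 0] h[of 1] h[of 2] by simp_all
  thus "Nsum 0 d - Nsum 2 d = \<alpha>" "Nsum 1 d - Nsum 2 d = \<beta>"
    by (simp_all add: h_def algebra_simps)
qed

end

section \<open>Translation into the stated products\<close>

lemma prod_lessThan_10:
  fixes f :: "nat \<Rightarrow> complex"
  shows "(\<Prod>i<10. f (Suc i)) = f (Suc 0) * f 2 * f 3 * f 4 * f 5 * f 6 * f 7 * f 8 * f 9 * f 10"
proof -
  have "{..<10::nat} = {0, 1, 2, 3, 4, 5, 6, 7, 8, 9}" by auto
  thus ?thesis by (simp add: mult.assoc del: One_nat_def)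
qed

lemma prod_lessThan_5_odd:
  fixes f :: "nat \<Rightarrow> complex"
  shows "(\<Prod>i<5. f (Suc (2 * i))) = f (Suc 0) * f 3 * f 5 * f 7 * f 9"
proof -
  have "{..<5::nat} = {0, 1, 2, 3, 4}" by auto
  thus ?thesis by (simp add: mult.assoc del: One_nat_def)
qed

theorem theorem1p2:
  fixes q :: complex
  assumes "0 < norm q" and "norm q < 1"
  shows
    "(R 5 1 2 0 q =
       - 1
       - q^2 * (qpoch [-(q^5)] (q^10) / qpoch [q^10] (q^10)) *
           (\<Sum>\<^sub>\<infinity>n\<in>(UNIV :: int set).
              (-1) powi n * q powi (10 * n^2 + 15 * n) / (1 - q powi (10 * n + 2)))
       + (qpoch [q, q^9] (q^10))^2 * qpoch [q^6, q^8, q^12, q^14] (q^20)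
           * (qpoch [q^10] (q^20))^3 * (qpoch [q^20] (q^20))^2
         / qpoch [q] q) \<and>
     (R 5 1 2 1 q = 0) \<and>
     (R 5 1 2 2 q =
       q * qpoch [q^2, q^18] (q^20) * qpoch [q^5] (q^5) * qpoch [-(q^10)] (q^10)
         / qpoch [q, q^4] (q^5)) \<and>
     (R 5 1 2 3 q =
       qpoch [-(q^5), q^10] (q^10) / qpoch [q^4, q^6] (q^10)) \<and>
     (R 5 1 2 4 q =
       2 * q^3 * (qpoch [-(q^5)] (q^10) / qpoch [q^10] (q^10)) *
           (\<Sum>\<^sub>\<infinity>n\<in>(UNIV :: int set).
              (-1) powi n * q powi (10 * n^2 + 15 * n) / (1 - q powi (10 * n + 4)))
       + (qpoch [q^3, q^7, q^10] (q^10))^2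
         / (qpoch [q] (q^2) * qpoch [q^6, q^8, q^12, q^14, q^20] (q^20))) \<and>
     (R 5 0 2 0 q =
       1
       + 2 * q^2 * (qpoch [-(q^5)] (q^10) / qpoch [q^10] (q^10)) *
           (\<Sum>\<^sub>\<infinity>n\<in>(UNIV :: int set).
              (-1) powi n * q powi (10 * n^2 + 15 * n) / (1 - q powi (10 * n + 2)))
       - (qpoch [q, q^9] (q^10))^2 * (qpoch [q^10] (q^10))^3
           * qpoch [q^6, q^8, q^12, q^14] (q^20)
         / (qpoch [q] q * qpoch [q^20] (q^20))) \<and>
     (R 5 0 2 1 q =
       qpoch [-(q^5), q^10] (q^10) / qpoch [q^2, q^8] (q^10)) \<and>
     (R 5 0 2 2 q =
       qpoch [q^5] (q^5) * qpoch [-(q^10)] (q^10) * qpoch [q^6, q^14] (q^20)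
         / qpoch [q^2, q^3] (q^5)) \<and>
     (R 5 0 2 3 q = 0) \<and>
     (R 5 0 2 4 q =
       q^3 * (qpoch [-(q^5)] (q^10) / qpoch [q^10] (q^10)) *
           (\<Sum>\<^sub>\<infinity>n\<in>(UNIV :: int set).
              (-1) powi n * q powi (10 * n^2 + 15 * n) / (1 - q powi (10 * n + 4)))
       + (qpoch [q^3, q^7, q^10] (q^10))^2
         / (qpoch [q] (q^2) * qpoch [q^6, q^8, q^12, q^14, q^20] (q^20)))"
proof -
  have q0: "q \<noteq> 0" using assms by auto
  have nrm: "norm (q ^ n) < 1" if "n > 0" for n
    using assms that by (simp add: norm_power power_less_one_iff)
  define P where "P = q ^ 10"
  have P1: "norm P < 1" unfolding P_def by (rule nrm) simp
  \<comment> \<open>With y = -q odd powers of y carry a minus sign: theta values of odd index become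
    products of the \<open>m k\<close>, those of even index products of the
    \<open>a k\<close>.\<close>
  interpret level10 P "- q"
    using q0 P1 by unfold_locales (auto simp: P_def)
  define a where "a k = qp (q ^ k) P" for k
  define m where "m k = qp (- (q ^ k)) P" for k
  have a_nz: "a k \<noteq> 0" if "k > 0" for k
    unfolding a_def by (rule qp_nonzero[OF P1 nrm[OF that]])
  have m_nz: "m k \<noteq> 0" if "k > 0" for k
    unfolding m_def using nrm[OF that] by (intro qp_nonzero[OF P1]) simp
  have Y_even: "Y 2 = q ^ 2" "Y 4 = q ^ 4" "Y 10 = P" and Y_odd: "Y 1 = - q" "Y 3 = - (q ^ 3)" "Y 5 = - (q ^ 5)" "Y 15 = - (q ^ 15)"
    by (simp_all add: Y_def P_def)
  have pk: "P / q ^ k = q ^ (10 - k)" if "k \<le> 10" for k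
    using q0 that by (simp add: P_def power_diff)
  have \<theta>: "th (Y 1) = m 1 * m 9" "th (Y 2) = a 2 * a 8" "th (Y 3) = m 3 * m 7" "th (Y 4) = a 4 * a 6"
    using pk[of 1] pk[of 2] pk[of 3] pk[of 4] by (simp_all add: th_def Y_even Y_odd a_def m_def)
  have E: "E = a 10" by (simp only: E_def a_def) (simp only: P_def)
  have e5: "e5 = m 5" by (simp add: e5_def Y_odd m_def)
  have sq: "qp (q ^ (2 * k)) (q ^ 20) = a k * m k" for k
    using qp_square[OF P1, of "q ^ k"] by (simp add: a_def m_def P_def mult.commute flip: power_mult)
  have base20: "qp (q ^ 2) (q ^ 20) = a 1 * m 1" "qp (q ^ 4) (q ^ 20) = a 2 * m 2" "qp (q ^ 6) (q ^ 20) = a 3 * m 3" "qp (q ^ 8) (q ^ 20) = a 4 * m 4"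
    "qp (q ^ 10) (q ^ 20) = a 5 * m 5" "qp (q ^ 12) (q ^ 20) = a 6 * m 6" "qp (q ^ 14) (q ^ 20) = a 7 * m 7" "qp (q ^ 18) (q ^ 20) = a 9 * m 9" "qp (q ^ 20) (q ^ 20) = a 10 * m 10"
    using sq[of 1] sq[of 2] sq[of 3] sq[of 4] sq[of 5] sq[of 6] sq[of 7] sq[of 9] sq[of 10] by simp_all
  have split2: "a k = qp (q ^ k) (q ^ 20) * qp (q ^ (k + 10)) (q ^ 20)" for k
    using qp_split[OF P1, of 2 "q ^ k"] by (simp add: a_def P_def numeral_2_eq_2 power_add flip: power_mult)
  \<comment> \<open>Both sides are the product over the exponents 2, 8, 12, 18 modulo 20.\<close>
  have r28: "a 2 * a 8 = a 1 * m 1 * a 6 * m 6 * (a 4 * m 4 * a 9 * m 9)"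
    using split2[of 2] split2[of 8] by (simp add: base20)
  have "a 10 = a 5 * m 5 * (a 10 * m 10)"
    using split2[of 10] by (simp add: base20)
  \<comment> \<open>Euler's identity between odd and distinct parts, with q^5 in place of q.\<close>
  hence r10: "a 5 * m 5 * m 10 = 1" using a_nz[of 10] by (simp add: mult.assoc)
  have "qp q q = (\<Prod>i<10. qp (q * q ^ i) (q ^ 10))"
    by (rule qp_split[OF assms(2)]) simp
  also have "\<dots> = (\<Prod>i<10. a (Suc i))"
    by (simp only: a_def P_def power_Suc)
  finally have b1: "qp q q = a 1 * a 2 * a 3 * a 4 * a 5 * a 6 * a 7 * a 8 * a 9 * a 10"
    unfolding prod_lessThan_10 by simp
  have e: "q * (q ^ 2) ^ i = q ^ Suc (2 * i)" "(q ^ 2) ^ 5 = q ^ 10" for i by (simp_all flip: power_mult)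
  have "qp q (q ^ 2) = (\<Prod>i<5. qp (q * (q ^ 2) ^ i) ((q ^ 2) ^ 5))"
    by (rule qp_split[OF nrm[of 2]]) simp_all
  also have "\<dots> = (\<Prod>i<5. a (Suc (2 * i)))"
    by (simp only: a_def P_def e)
  finally have b2: "qp q (q ^ 2) = a 1 * a 3 * a 5 * a 7 * a 9"
    unfolding prod_lessThan_5_odd by simp
  have b5: "qp (q ^ k) (q ^ 5) = a k * a (k + 5)" for k
    using qp_split[OF nrm[of 5], of 2 "q ^ k"] by (simp add: a_def P_def numeral_2_eq_2 power_add flip: power_mult)
  have base5: "qp q (q ^ 5) = a 1 * a 6" "qp (q ^ 2) (q ^ 5) = a 2 * a 7" "qp (q ^ 3) (q ^ 5) = a 3 * a 8" "qp (q ^ 4) (q ^ 5) = a 4 * a 9" "qp (q ^ 5) (q ^ 5) = a 5 * a 10"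
    using b5[of 1] b5[of 2] b5[of 3] b5[of 4] b5[of 5] by simp_all
  have base10: "qp q (q ^ 10) = a 1" "qp (q ^ k) (q ^ 10) = a k" "qp (- (q ^ k)) (q ^ 10) = m k" for k
    by (simp_all add: a_def m_def P_def)
  note bases = base20 b1 b2 base5 base10
  \<comment> \<open>The factor (-1)^n comes from the sign of \<open>Y 15\<close>; for even i the
    power y^i has no sign.\<close>
  have Sum: "S (Y 15) (Y i) = (\<Sum>\<^sub>\<infinity>n\<in>UNIV. (-1) powi n * q powi (10 * n^2 + 15 * n) / (1 - q powi (10 * n + i)))" if "even i" for i
    unfolding S_def
  proof (rule infsum_cong)
    fix n :: int
    have 1: "P powi k = q powi (10 * k)" for k by (simp add: P_def power_int_power)
    have 2: "Y 15 powi n = (-1) powi n * q powi (15 * n)"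
      unfolding Y_odd by (simp add: power_int_minus_left power_int_power)
    have 3: "Y i = q powi i" using that by (simp add: Y_def)
    show "P powi (n\<^sup>2) * Y 15 powi n / (1 - Y i * P powi n) = (-1) powi n * q powi (10 * n^2 + 15 * n) / (1 - q powi (10 * n + i))"
      unfolding 1 2 3 using q0 by (simp add: power_int_add mult_ac)
  qed
  define \<Sigma>2 where "\<Sigma>2 = (\<Sum>\<^sub>\<infinity>n\<in>(UNIV :: int set). (-1) powi n * q powi (10 * n^2 + 15 * n) / (1 - q powi (10 * n + 2)))"
  define \<Sigma>4 where "\<Sigma>4 = (\<Sum>\<^sub>\<infinity>n\<in>(UNIV :: int set). (-1) powi n * q powi (10 * n^2 + 15 * n) / (1 - q powi (10 * n + 4)))"
  have S15: "S (Y 15) (Y 2) = \<Sigma>2" "S (Y 15) (Y 4) = \<Sigma>4"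
    unfolding \<Sigma>2_def \<Sigma>4_def by (simp_all add: Sum)
  have invC: "1 / C = m 5 / a 10" by (simp add: C_eq E e5)
  \<comment> \<open>The component uses w = Y 5, the stated sum w = Y 15. The shift by p costs one
    \<open>C\<close>, which becomes the constant 1 after division by \<open>C\<close>.\<close>
  have "S (Y 5) (Y 2) = C + Y 2 * S (Y 15) (Y 2)" using S_Y_mult[of 2 5] by (simp add: C_def)
  also have "\<dots> = C + q ^ 2 * \<Sigma>2"
    by (simp only: S15) (simp only: Y_even)
  finally have "S (Y 5) (Y 2) = C + q ^ 2 * \<Sigma>2" .
  hence "S (Y 5) (Y 2) / C = 1 + q ^ 2 * (1 / C) * \<Sigma>2"
    using C_nz by (simp add: add_divide_distrib)
  hence S5: "S (Y 5) (Y 2) / C = 1 + q ^ 2 * (m 5 / a 10) * \<Sigma>2"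
    unfolding invC .
  have S4: "S (Y 15) (Y 4) / C = (m 5 / a 10) * \<Sigma>4"
    unfolding invC[symmetric] S15 by simp
  define P0 where "P0 = E * e5 * th (Y 3) / (th (Y 1) * th (Y 4))"
  define P4 where "P4 = E * e5 * th (Y 1) / (th (Y 2) * th (Y 3))"
  have nz: "a 1 \<noteq> 0" "a 2 \<noteq> 0" "a 3 \<noteq> 0" "a 4 \<noteq> 0" "a 5 \<noteq> 0" "a 6 \<noteq> 0" "a 7 \<noteq> 0" "a 8 \<noteq> 0" "a 9 \<noteq> 0" "a 10 \<noteq> 0"
    "m 1 \<noteq> 0" "m 3 \<noteq> 0" "m 4 \<noteq> 0" "m 5 \<noteq> 0" "m 6 \<noteq> 0" "m 7 \<noteq> 0" "m 9 \<noteq> 0" "m 10 \<noteq> 0"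
    using a_nz m_nz by simp_all
  \<comment> \<open>Eliminating \<open>m 10\<close> and \<open>a 8\<close> builds the two relations
    into the products; the remaining identities then hold by cancellation.\<close>
  have m10: "m 10 = 1 / (a 5 * m 5)" using r10 nz by (simp add: field_simps)
  have a8: "a 8 = a 1 * m 1 * a 6 * m 6 * (a 4 * m 4 * a 9 * m 9) / a 2" using r28 nz by (simp add: field_simps)
  have P0a: "P0 = (qpoch [q, q^9] (q^10))^2 * qpoch [q^6, q^8, q^12, q^14] (q^20) * (qpoch [q^10] (q^20))^3 * (qpoch [q^20] (q^20))^2 / qpoch [q] q"
    unfolding P0_def E e5 \<theta> qpoch_Cons qpoch_Nil bases m10 a8 using nz by (simp add: field_simps power2_eq_square power3_eq_cube)
  have P0b: "P0 = (qpoch [q, q^9] (q^10))^2 * (qpoch [q^10] (q^10))^3 * qpoch [q^6, q^8, q^12, q^14] (q^20) / (qpoch [q] q * qpoch [q^20] (q^20))"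
    unfolding P0_def E e5 \<theta> qpoch_Cons qpoch_Nil bases m10 a8 using nz by (simp add: field_simps power2_eq_square power3_eq_cube)
  have P4: "P4 = (qpoch [q^3, q^7, q^10] (q^10))^2 / (qpoch [q] (q^2) * qpoch [q^6, q^8, q^12, q^14, q^20] (q^20))"
    unfolding P4_def E e5 \<theta> qpoch_Cons qpoch_Nil bases m10 a8 using nz by (simp add: field_simps power2_eq_square power3_eq_cube)
  have W1: "E * e5 / th (Y 2) = qpoch [-(q^5), q^10] (q^10) / qpoch [q^2, q^8] (q^10)"
    unfolding E e5 \<theta> qpoch_Cons qpoch_Nil bases by simp
  have W3: "E * e5 / th (Y 4) = qpoch [-(q^5), q^10] (q^10) / qpoch [q^4, q^6] (q^10)"
    unfolding E e5 \<theta> qpoch_Cons qpoch_Nil bases by simp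
  have V2: "E * th (Y 3) / (e5 * th (Y 2)) = qpoch [q^5] (q^5) * qpoch [-(q^10)] (q^10) * qpoch [q^6, q^14] (q^20) / qpoch [q^2, q^3] (q^5)"
    unfolding E e5 \<theta> qpoch_Cons qpoch_Nil bases m10 using nz by (simp add: field_simps)
  have U2: "E * th (Y 1) / (e5 * th (Y 4)) = qpoch [q^2, q^18] (q^20) * qpoch [q^5] (q^5) * qpoch [-(q^10)] (q^10) / qpoch [q, q^4] (q^5)"
    unfolding E e5 \<theta> qpoch_Cons qpoch_Nil bases m10 using nz by (simp add: field_simps)
  have pre: "qpoch [-(q^5)] (q^10) / qpoch [q^10] (q^10) = m 5 / a 10"
    by (simp add: bases)
  have RN: "R 5 0 2 d q = Nsum 0 d - Nsum 2 d" "R 5 1 2 d q = Nsum 1 d - Nsum 2 d" for d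
    using assms(2) by (simp_all add: R_eq Nsum_def)
  \<comment> \<open>The coefficient of c^0 is the difference of the classes 0 and 2, that of c the
    difference of 1 and 2. The constants 1 and -1 come from (2 - c) - 1 = 1 - c.\<close>
  have d0: "Rd 0 c = (1 + 2 * (q ^ 2 * (m 5 / a 10) * \<Sigma>2) - P0) + (- 1 - q ^ 2 * (m 5 / a 10) * \<Sigma>2 + P0) * c" for c
  proof -
    have "Rd 0 c = (2 - c) * (S (Y 5) (Y 2) / C) - (1 - c) * P0 - 1"
      by (simp add: Rd_def R0_def P0_def)
    also have "\<dots> = (2 - c) * (1 + q ^ 2 * (m 5 / a 10) * \<Sigma>2) - (1 - c) * P0 - 1"
      unfolding S5 ..
    also have "(2 - c) * (1 + k) - (1 - c) * P0 - 1 = (1 + 2 * k - P0) + (- 1 - k + P0) * c" for k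
      by (simp add: algebra_simps)
    finally show ?thesis .
  qed
  have d1: "Rd 1 c = E * e5 / th (Y 2) + 0 * c" for c
    by (simp add: Rd_def R1_def)
  have d2: "Rd 2 c = E * th (Y 3) / (e5 * th (Y 2)) + q * (E * th (Y 1) / (e5 * th (Y 4))) * c" for c
    by (simp add: Rd_def R2_def Y_odd)
  have d3: "Rd 3 c = 0 + E * e5 / th (Y 4) * c" for c
    by (simp add: Rd_def R3_def)
  \<comment> \<open>\<open>Y 3\<close> is -q^3, which turns the minus sign in \<open>R4\<close> into
    a plus; the factor 1 + 2 c explains why the Lambert sum occurs doubled in one of the two
    differences.\<close>
  have d4: "Rd 4 c = (q ^ 3 * (m 5 / a 10) * \<Sigma>4 + P4) + (2 * q ^ 3 * (m 5 / a 10) * \<Sigma>4 + P4) * c" for c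
  proof -
    have "Rd 4 c = - (1 + 2 * c) * Y 3 * (S (Y 15) (Y 4) / C) + (1 + c) * P4"
      by (simp add: Rd_def R4_def P4_def)
    also have "\<dots> = - (1 + 2 * c) * - (q ^ 3) * (m 5 / a 10 * \<Sigma>4) + (1 + c) * P4"
      unfolding S4 unfolding Y_odd ..
    also have "- (1 + 2 * c) * - (q ^ 3) * (k * \<Sigma>4) + (1 + c) * P4 = (q ^ 3 * k * \<Sigma>4 + P4) + (2 * q ^ 3 * k * \<Sigma>4 + P4) * c" for k
      by (simp add: algebra_simps)
    finally show ?thesis .
  qed
  note D = Nsum_differences[OF _ d0] Nsum_differences[OF _ d1] Nsum_differences[OF _ d2] Nsum_differences[OF _ d3] Nsum_differences[OF _ d4]
  have "R 5 0 2 0 q = 1 + 2 * q ^ 2 * (m 5 / a 10) * \<Sigma>2 - P0" "R 5 1 2 0 q = - 1 - q ^ 2 * (m 5 / a 10) * \<Sigma>2 + P0"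
    "R 5 0 2 1 q = E * e5 / th (Y 2)" "R 5 1 2 1 q = 0"
    "R 5 0 2 2 q = E * th (Y 3) / (e5 * th (Y 2))" "R 5 1 2 2 q = q * (E * th (Y 1) / (e5 * th (Y 4)))"
    "R 5 0 2 3 q = 0" "R 5 1 2 3 q = E * e5 / th (Y 4)"
    "R 5 0 2 4 q = q ^ 3 * (m 5 / a 10) * \<Sigma>4 + P4" "R 5 1 2 4 q = 2 * q ^ 3 * (m 5 / a 10) * \<Sigma>4 + P4"
    using D by (simp_all add: RN mult.assoc)
  note R_values = this
  show ?thesis
    unfolding R_values pre \<Sigma>2_def[symmetric] \<Sigma>4_def[symmetric] P0a[symmetric] P0b[symmetric] P4[symmetric] W1[symmetric] W3[symmetric] V2[symmetric] U2
    by (simp only: times_divide_eq_right mult.assoc simp_thms)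
qed

end
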